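(* Let $\Lambda$ be a basic finite-dimensional $\tau$-tilting finite algebra over a field $K$ that is hereditary, and let $\mathcal{T}\in\mathrm{tors}\,\Lambda$. Then $\mathcal{T}$ is in the image of $\mathrm{pop}^{\downarrow}_{\mathrm{tors}\,\Lambda}$ if and only if both (1) $\mathrm{Ext}^1_\Lambda(X,X')=0$ for all $X,X'\in\mathcal{D}(\mathcal{T})$, and (2) there is no nonzero projective module in $\mathcal{T}$. Dually, $\mathcal{T}$ is in the image of $\mathrm{pop}^{\uparrow}_{\mathrm{tors}\,\Lambda}$ if and only if both (1* ) $\mathrm{Ext}^1_\Lambda(Y,Y')=0$ for all $Y,Y'\in\mathcal{U}(\mathcal{T})$, and (2* ) there is no nonzero injective module in $\mathcal{T}^\perp$.
   Context: $\mathrm{mod}\,\Lambda$: finitely generated right $\Lambda$-modules; hereditary means $\mathrm{Ext}^m_\Lambda=0$ for $m>1$. $\mathrm{tors}\,\Lambda$: finite lattice of torsion classes (subcategories closed under extensions and quotients) under inclusion. $\mathrm{pop}^{\downarrow}(x)=x\wedge\bigwedge\{y:y\lessdot x\}$, $\mathrm{pop}^{\uparrow}(x)=x\vee\bigvee\{y:x\lessdot y\}$. A brick is a module with division-ring endomorphism ring. For a cover $\mathcal{T}_1\lessdot\mathcal{T}_2$, $\mathcal{T}_2\cap\mathcal{T}_1^\perp$ contains a unique brick up to isomorphism (its brick label), where $\mathcal{C}^\perp=\{M:\mathrm{Hom}(\mathcal{C},M)=0\}$. $\mathcal{D}(\mathcal{T})$ (resp. $\mathcal{U}(\mathcal{T})$):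 brick labels of covers $\mathcal{T}_1\lessdot\mathcal{T}$ (resp. $\mathcal{T}\lessdot\mathcal{T}_2$). *)

theory Defs
  imports "Jordan_Normal_Form.Matrix"
begin

text \<open>
Conventions.  The algebra Lambda is the type 'a (class ring_1) together with a
scalar multiplication sm :: 'k \<Rightarrow> 'a \<Rightarrow> 'a over a field 'k.
A finitely generated right Lambda-module is finite-dimensional over K and is
represented (up to isomorphism) as a pair (n, rho): the underlying space is K^n
(row vectors), and v \<cdot> a = v * rho a, so rho a is an n x n matrix with
rho (a*b) = rho a * rho b.  A homomorphism (m,rho) \<rightarrow> (n,sigma) is an m x n
matrix f with rho a * f = f * sigma a (acting by v \<mapsto> v * f); composition
M -f-> N -g-> P is the matrix product f * g.
\<close>

type_synonym ('a,'k) rmod = "nat \<times> ('a \<Rightarrow> 'k mat)"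

definition fd_algebra :: "('k::field \<Rightarrow> 'a::ring_1 \<Rightarrow> 'a) \<Rightarrow> bool" where
  "fd_algebra sm \<longleftrightarrow>
     (\<forall>c x y. sm c (x + y) = sm c x + sm c y) \<and>
     (\<forall>c d x. sm (c + d) x = sm c x + sm d x) \<and>
     (\<forall>c d x. sm (c * d) x = sm c (sm d x)) \<and>
     (\<forall>x. sm 1 x = x) \<and>
     (\<forall>c x y. sm c (x * y) = sm c x * y \<and> sm c (x * y) = x * sm c y) \<and>
     (\<exists>B::'a set. finite B \<and> (\<forall>x. \<exists>co. x = (\<Sum>b\<in>B. sm (co b) b)))"

definition is_mod :: "('k::field \<Rightarrow> 'a::ring_1 \<Rightarrow> 'a) \<Rightarrow> ('a,'k) rmod \<Rightarrow> bool" where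
  "is_mod sm M \<longleftrightarrow>
     (\<forall>a. snd M a \<in> carrier_mat (fst M) (fst M)) \<and>
     snd M 1 = 1\<^sub>m (fst M) \<and>
     (\<forall>a b. snd M (a * b) = snd M a * snd M b) \<and>
     (\<forall>a b. snd M (a + b) = snd M a + snd M b) \<and>
     (\<forall>c a. snd M (sm c a) = c \<cdot>\<^sub>m snd M a)"

definition is_hom :: "('a::ring_1,'k::field) rmod \<Rightarrow> ('a,'k) rmod \<Rightarrow> 'k mat \<Rightarrow> bool" where
  "is_hom M N f \<longleftrightarrow> f \<in> carrier_mat (fst M) (fst N) \<and>
     (\<forall>a. snd M a * f = f * snd N a)"

definition surj_map :: "nat \<Rightarrow> nat \<Rightarrow> 'k::field mat \<Rightarrow> bool" where
  "surj_map m n f \<longleftrightarrow> (\<exists>s \<in> carrier_mat n m. s * f = 1\<^sub>m n)"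

definition inj_map :: "nat \<Rightarrow> nat \<Rightarrow> 'k::field mat \<Rightarrow> bool" where
  "inj_map m n f \<longleftrightarrow> (\<exists>t \<in> carrier_mat n m. f * t = 1\<^sub>m m)"

definition zero_mod :: "('a,'k::field) rmod \<Rightarrow> bool" where
  "zero_mod M \<longleftrightarrow> fst M = 0"

definition projective :: "('k::field \<Rightarrow> 'a::ring_1 \<Rightarrow> 'a) \<Rightarrow> ('a,'k) rmod \<Rightarrow> bool" where
  "projective sm P \<longleftrightarrow> is_mod sm P \<and>
     (\<forall>M N g h. is_mod sm M \<and> is_mod sm N \<and> is_hom M N g \<and> surj_map (fst M) (fst N) g
        \<and> is_hom P N h \<longrightarrow> (\<exists>k. is_hom P M k \<and> k * g = h))"

definition injective :: "('k::field \<Rightarrow> 'a::ring_1 \<Rightarrow> 'a) \<Rightarrow> ('a,'k) rmod \<Rightarrow> bool" where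
  "injective sm I \<longleftrightarrow> is_mod sm I \<and>
     (\<forall>M N g h. is_mod sm M \<and> is_mod sm N \<and> is_hom M N g \<and> inj_map (fst M) (fst N) g
        \<and> is_hom M I h \<longrightarrow> (\<exists>k. is_hom N I k \<and> g * k = h))"

text \<open>Hereditary: every submodule of a projective module is projective
  (equivalently global dimension at most 1, i.e. Ext^m vanishes for m > 1).\<close>
definition hereditary :: "('k::field \<Rightarrow> 'a::ring_1 \<Rightarrow> 'a) \<Rightarrow> bool" where
  "hereditary sm \<longleftrightarrow>
     (\<forall>M P f. is_mod sm M \<and> projective sm P \<and> is_hom M P f \<and> inj_map (fst M) (fst P) f
        \<longrightarrow> projective sm M)"

text \<open>Basic: a complete set of primitive orthogonal idempotents e_0..e_(n-1)
  with e_i Lambda not isomorphic to e_j Lambda for i \<noteq> j.\<close>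
definition idem_iso :: "'a::ring_1 \<Rightarrow> 'a \<Rightarrow> bool" where
  "idem_iso e f \<longleftrightarrow> (\<exists>x y. x = f * x * e \<and> y = e * y * f \<and> y * x = e \<and> x * y = f)"

definition primitive_idem :: "'a::ring_1 \<Rightarrow> bool" where
  "primitive_idem e \<longleftrightarrow> e \<noteq> 0 \<and> e * e = e \<and>
     \<not> (\<exists>u v. u \<noteq> 0 \<and> v \<noteq> 0 \<and> u * u = u \<and> v * v = v \<and> u * v = 0 \<and> v * u = 0 \<and> e = u + v)"

definition basic_alg :: "'a::ring_1 itself \<Rightarrow> bool" where
  "basic_alg (_ :: 'a itself) \<longleftrightarrow> (\<exists>n (e :: nat \<Rightarrow> 'a). (\<forall>i<n. primitive_idem (e i)) \<and>
     (\<forall>i<n. \<forall>j<n. i \<noteq> j \<longrightarrow> e i * e j = 0) \<and> (\<Sum>i<n. e i) = 1 \<and>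
     (\<forall>i<n. \<forall>j<n. i \<noteq> j \<longrightarrow> \<not> idem_iso (e i) (e j)))"

definition ses :: "('k::field \<Rightarrow> 'a::ring_1 \<Rightarrow> 'a) \<Rightarrow> ('a,'k) rmod \<Rightarrow> 'k mat \<Rightarrow> ('a,'k) rmod
    \<Rightarrow> 'k mat \<Rightarrow> ('a,'k) rmod \<Rightarrow> bool" where
  "ses sm Y f E g X \<longleftrightarrow> is_mod sm Y \<and> is_mod sm E \<and> is_mod sm X \<and>
     is_hom Y E f \<and> is_hom E X g \<and> inj_map (fst Y) (fst E) f \<and> surj_map (fst E) (fst X) g \<and>
     f * g = 0\<^sub>m (fst Y) (fst X) \<and> fst E = fst Y + fst X"

definition ext1_zero :: "('k::field \<Rightarrow> 'a::ring_1 \<Rightarrow> 'a) \<Rightarrow> ('a,'k) rmod \<Rightarrow> ('a,'k) rmod \<Rightarrow> bool" where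
  "ext1_zero sm X Y \<longleftrightarrow> (\<forall>f E g. ses sm Y f E g X \<longrightarrow>
      (\<exists>s. is_hom X E s \<and> s * g = 1\<^sub>m (fst X)))"

definition brick :: "('k::field \<Rightarrow> 'a::ring_1 \<Rightarrow> 'a) \<Rightarrow> ('a,'k) rmod \<Rightarrow> bool" where
  "brick sm X \<longleftrightarrow> is_mod sm X \<and> fst X \<noteq> 0 \<and>
     (\<forall>f. is_hom X X f \<and> f \<noteq> 0\<^sub>m (fst X) (fst X) \<longrightarrow>
        (\<exists>g. is_hom X X g \<and> f * g = 1\<^sub>m (fst X) \<and> g * f = 1\<^sub>m (fst X)))"

definition torsion_class :: "('k::field \<Rightarrow> 'a::ring_1 \<Rightarrow> 'a) \<Rightarrow> ('a,'k) rmod set \<Rightarrow> bool" where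
  "torsion_class sm T \<longleftrightarrow> T \<subseteq> {M. is_mod sm M} \<and> T \<noteq> {} \<and>
     (\<forall>M N g. M \<in> T \<and> is_mod sm N \<and> is_hom M N g \<and> surj_map (fst M) (fst N) g \<longrightarrow> N \<in> T) \<and>
     (\<forall>Y f E g X. ses sm Y f E g X \<and> Y \<in> T \<and> X \<in> T \<longrightarrow> E \<in> T)"

definition perp :: "('k::field \<Rightarrow> 'a::ring_1 \<Rightarrow> 'a) \<Rightarrow> ('a,'k) rmod set \<Rightarrow> ('a,'k) rmod set" where
  "perp sm C = {M. is_mod sm M \<and> (\<forall>N\<in>C. \<forall>f. is_hom N M f \<longrightarrow> f = 0\<^sub>m (fst N) (fst M))}"

definition tors_cover :: "('k::field \<Rightarrow> 'a::ring_1 \<Rightarrow> 'a) \<Rightarrow> ('a,'k) rmod set \<Rightarrow> ('a,'k) rmod set \<Rightarrow> bool" where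
  "tors_cover sm T1 T2 \<longleftrightarrow> torsion_class sm T1 \<and> torsion_class sm T2 \<and> T1 \<subset> T2 \<and>
     \<not> (\<exists>S. torsion_class sm S \<and> T1 \<subset> S \<and> S \<subset> T2)"

text \<open>Meets in tors Lambda are intersections; joins are the intersection of all
  torsion classes above (tors Lambda is a complete lattice).\<close>
definition pop_down :: "('k::field \<Rightarrow> 'a::ring_1 \<Rightarrow> 'a) \<Rightarrow> ('a,'k) rmod set \<Rightarrow> ('a,'k) rmod set" where
  "pop_down sm T = T \<inter> \<Inter> {S. tors_cover sm S T}"

definition pop_up :: "('k::field \<Rightarrow> 'a::ring_1 \<Rightarrow> 'a) \<Rightarrow> ('a,'k) rmod set \<Rightarrow> ('a,'k) rmod set" where
  "pop_up sm T = \<Inter> {S. torsion_class sm S \<and> T \<subseteq> S \<and> (\<forall>U. tors_cover sm T U \<longrightarrow> U \<subseteq> S)}"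

text \<open>D(T) and U(T): all modules isomorphic to brick labels of lower / upper covers.\<close>
definition down_labels :: "('k::field \<Rightarrow> 'a::ring_1 \<Rightarrow> 'a) \<Rightarrow> ('a,'k) rmod set \<Rightarrow> ('a,'k) rmod set" where
  "down_labels sm T = {X. \<exists>T1. tors_cover sm T1 T \<and> brick sm X \<and> X \<in> T \<inter> perp sm T1}"

definition up_labels :: "('k::field \<Rightarrow> 'a::ring_1 \<Rightarrow> 'a) \<Rightarrow> ('a,'k) rmod set \<Rightarrow> ('a,'k) rmod set" where
  "up_labels sm T = {X. \<exists>T2. tors_cover sm T T2 \<and> brick sm X \<and> X \<in> T2 \<inter> perp sm T}"

text \<open>tau-tilting finite, via Demonet-Iyama-Jasso: tors Lambda is finite.\<close>
definition tau_tilting_finite :: "('k::field \<Rightarrow> 'a::ring_1 \<Rightarrow> 'a) \<Rightarrow> bool" where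
  "tau_tilting_finite sm \<longleftrightarrow> finite {T. torsion_class sm T}"

end

theory Submission
  imports Defs "Jordan_Normal_Form.Determinant"
begin

text \<open>
Since the algebra is hereditary, Ext(X, -) is right exact, so the modules on which it vanishes form a
torsion class. A torsion class is generated by one brick label for each of its lower covers.

Let T be the pop-down of T', let X be a label of T and Y the label of a lower cover of T'. A non-split
extension E of X by Y receives no nonzero map from T, because X is a label of T. On the other hand E lies
in every lower cover of T', hence in T: a nonzero map from E to a label of T' would restrict to an
isomorphism on Y, splitting the extension, or factor through X. So E = 0, a contradiction. Thus Ext(X, -)
vanishes on the labels of T' and therefore on T'. A projective module P in T has no nonzero map to a label
of T', hence none to T', and so P = 0.

Conversely, let S consist of one label for each lower cover of T. Then T is the pop-down of the torsion
class T2 of all M with Ext(X, M) = 0 for X in S. First, each X in S is non-projective, so iterated pushouts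
produce a non-split epimorphism E \<rightarrow> X with E in T2. A nonzero map from X to a label Z of T2 would lift to
E, because the kernel of E \<rightarrow> Z is again in T2; this would split E \<rightarrow> X. So T lies in every lower cover of
T2. Second, if M in T2 is not in T, choose a smallest nonzero quotient N of M receiving no nonzero map from T.
A lower cover of T2 that contains every module of T2 without nonzero maps to N has N as its label and
therefore does not contain M.

Vector space duality exchanges torsion and torsion-free classes of an algebra and its opposite, and turns
the statement about pop-down into the one about pop-up.
\<close>

section \<open>Matrices over a field\<close>

text \<open>Two rigidity facts about labels of T carry the proof. A nonzero map from a module of T
  to a label of T is onto, because a label has the least dimension among the nonzero modules of T
  perpendicular to its lower cover; hence nonzero maps between labels of T are isomorphisms. And a
  map to a label whose kernel receives nothing nonzero from T splits as soon as its source receives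
  something nonzero from T. The second fact explains why the extension E receives no map from T, and
  also why the kernel of E \<rightarrow> Z lies in T2: pushing E out along the torsion-free quotient
  of that kernel gives a map onto Z that must split.

  How many copies of X a universal extension needs depends on End(X), so it is not written in one
  step: one pushout is made per generator of Ext over K, and a generator that already extends is
  skipped.

  Extensions are never given a group structure. Vanishing of Ext is read off from a projective
  presentation. Since injectivity and surjectivity are encoded by one-sided inverse matrices, every
  exact sequence carries linear splittings, and pushouts become block matrices.\<close>

lemma mat_assoc: 
  "dim_col A = dim_row B \<Longrightarrow> dim_col B = dim_row C \<Longrightarrow> (A * B) * C = A * (B * (C::'k::field mat))"
  by (metis assoc_mult_mat carrier_matI)

lemma mat_distr:
  fixes A :: "'k::field mat"
  shows "dim_row A = dim_row B \<Longrightarrow> dim_col A = dim_col B \<Longrightarrow> dim_col B = dim_row C \<Longrightarrow> (A + B) * C = A * C + B * C"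
    "dim_row A = dim_row B \<Longrightarrow> dim_col A = dim_col B \<Longrightarrow> dim_col D = dim_row A \<Longrightarrow> D * (A + B) = D * A + D * B"
    "dim_row A = dim_row B \<Longrightarrow> dim_col A = dim_col B \<Longrightarrow> dim_col B = dim_row C \<Longrightarrow> (A - B) * C = A * C - B * C"
    "dim_row A = dim_row B \<Longrightarrow> dim_col A = dim_col B \<Longrightarrow> dim_col D = dim_row A \<Longrightarrow> D * (A - B) = D * A - D * B"
  by (metis add_mult_distrib_mat mult_add_distrib_mat minus_mult_distrib_mat mult_minus_distrib_mat carrier_matI)+

lemma mat_one[simp]: "dim_row A = n \<Longrightarrow> 1\<^sub>m n * A = (A::'k::field mat)" "dim_col A = n \<Longrightarrow> A * 1\<^sub>m n = A"
  by (auto simp: left_mult_one_mat right_mult_one_mat)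

lemma mat_zero[simp]: "dim_row A = n \<Longrightarrow> 0\<^sub>m m n * A = (0\<^sub>m m (dim_col A) :: 'k::field mat)" 
  "dim_col A = n \<Longrightarrow> A * 0\<^sub>m n m = 0\<^sub>m (dim_row A) m"
  by (auto)

lemma mat_add_zero[simp]:
  fixes A :: "'k::field mat"
  shows "dim_row A = m \<Longrightarrow> dim_col A = n \<Longrightarrow> A + 0\<^sub>m m n = A"
    "dim_row A = m \<Longrightarrow> dim_col A = n \<Longrightarrow> 0\<^sub>m m n + A = A"
    "dim_row A = m \<Longrightarrow> dim_col A = n \<Longrightarrow> A - 0\<^sub>m m n = A"
    "A - A = 0\<^sub>m (dim_row A) (dim_col A)"
  by auto

text \<open>Gauss-Jordan elimination gives C = P * A with Q inverse to P. The factors are the first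
  r columns of Q and the r nonzero rows of C; the first r rows of P and the selection of the pivot
  columns are their one-sided inverses.\<close>

lemma rank_factorization:
  fixes A :: "'k::field mat"
  assumes A: "A \<in> carrier_mat m n"
  obtains r e i s t where "e \<in> carrier_mat m r" "i \<in> carrier_mat r n" "s \<in> carrier_mat r m"
    "t \<in> carrier_mat n r" "A = e * i" "s * e = 1\<^sub>m r" "i * t = 1\<^sub>m r"
proof -
  obtain C where C: "gauss_jordan_single A = C" by simp
  note gj = gauss_jordan_single[OF A C]
  from gj(4) obtain P Q where P: "P \<in> carrier_mat m m" and Q: "Q \<in> carrier_mat m m"
    and PQ: "P * Q = 1\<^sub>m m" and QP: "Q * P = 1\<^sub>m m" and CP: "C = P * A" by auto
  from gj(3) gj(2) obtain f where f: "pivot_fun C f n" unfolding row_echelon_form_def by auto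
  have dC: "dim_row C = m" using gj(2) by auto
  note p = pivot_funD[OF dC f]
  have AQ: "A = Q * C" unfolding CP using A P Q QP by (simp add: mat_assoc[symmetric])
  \<comment> \<open>A pivot value n marks a zero row, so r is the first zero row, or m if there is
    none.\<close>
  define r where "r = (LEAST i. i = m \<or> (i < m \<and> f i = n))"
  have rm: "r \<le> m" unfolding r_def by (rule Least_le) simp
  have rlt: "f i < n" if "i < r" for i
    using not_less_Least[OF that[unfolded r_def]] p(1)[of i] that rm by fastforce
  have rge: "f i = n" if "r \<le> i" "i < m" for i
  proof -
    have "r = m \<or> (r < m \<and> f r = n)" unfolding r_def by (rule LeastI[of _ m]) simp
    with that have fr: "f r = n" "r < m" by auto
    show ?thesis using that
    proof (induction i rule: dec_induct)
      case base show ?case using fr by simp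
    next
      case (step j) then show ?case using p(1)[of "Suc j"] p(3)[of j] by (metis Suc_lessD le_neq_implies_less not_less p(1))
    qed
  qed
  have zero: "C $$ (i,j) = 0" if "r \<le> i" "i < m" "j < n" for i j
    using p(2)[of i j] rge[of i] that by auto
  define e where "e = mat m r (\<lambda>(i,j). Q $$ (i,j))"
  define i where "i = mat r n (\<lambda>(i,j). C $$ (i,j))"
  define s where "s = mat r m (\<lambda>(i,j). P $$ (i,j))"
  define t where "t = mat n r (\<lambda>(j,k). if j = f k then (1::'k) else 0)"
  have it: "i * t = 1\<^sub>m r"
  proof (rule eq_matI)
    fix a b assume ab: "a < dim_row (1\<^sub>m r)" "b < dim_col (1\<^sub>m r)"
    have "(i * t) $$ (a,b) = (\<Sum>j<n. C $$ (a,j) * (if j = f b then 1 else 0))"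
      using ab by (auto simp: i_def t_def scalar_prod_def lessThan_atLeast0)
    also have "\<dots> = C $$ (a, f b)" using rlt[of b] ab by (simp add: if_distrib cong: if_cong)
    also have "\<dots> = 1\<^sub>m r $$ (a,b)" using ab rm rlt[of b] p(4)[of b] p(5)[of b a] by auto
    finally show "(i * t) $$ (a,b) = 1\<^sub>m r $$ (a,b)" .
  qed (auto simp: i_def t_def)
  have se: "s * e = 1\<^sub>m r"
  proof (rule eq_matI)
    fix a b assume ab: "a < dim_row (1\<^sub>m r)" "b < dim_col (1\<^sub>m r)"
    have "(s * e) $$ (a,b) = (P * Q) $$ (a,b)"
      using ab P Q rm by (auto simp: s_def e_def scalar_prod_def)
    then show "(s * e) $$ (a,b) = 1\<^sub>m r $$ (a,b)" using ab rm PQ by simp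
  qed (auto simp: s_def e_def)
  have "A = e * i"
  proof (rule eq_matI)
    fix a b assume ab: "a < dim_row (e * i)" "b < dim_col (e * i)"
    then have ab: "a < m" "b < n" by (auto simp: e_def i_def)
    have "A $$ (a,b) = (\<Sum>j<m. Q $$ (a,j) * C $$ (j,b))"
      using ab Q gj(2) by (subst AQ) (auto simp: scalar_prod_def lessThan_atLeast0)
    also have "\<dots> = (\<Sum>j<r. Q $$ (a,j) * C $$ (j,b))"
      by (rule sum.mono_neutral_right) (use rm zero ab in auto)
    also have "\<dots> = (e * i) $$ (a,b)" using ab
      by (auto simp: e_def i_def scalar_prod_def lessThan_atLeast0)
    finally show "A $$ (a,b) = (e * i) $$ (a,b)" .
  qed (use A in \<open>auto simp: e_def i_def\<close>)
  then show thesis using it se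
    by (intro that[of e r i s t]) (auto simp: e_def i_def s_def t_def)
qed

text \<open>If n < m, padding with zeros makes both matrices square, where a right inverse is also a
  left inverse; but the product in the other order has a zero entry at (n, n).\<close>

lemma right_inverse_dim_le:
  fixes A :: "'k::field mat"
  assumes A: "A \<in> carrier_mat m n" and B: "B \<in> carrier_mat n m" and AB: "A * B = 1\<^sub>m m"
  shows "m \<le> n"
proof (rule ccontr)
  assume "\<not> m \<le> n"
  then have nm: "n < m" by simp
  define A' where "A' = mat m m (\<lambda>(i,j). if j < n then A $$ (i,j) else 0)"
  define B' where "B' = mat m m (\<lambda>(i,j). if i < n then B $$ (i,j) else 0)"
  have "A' * B' = 1\<^sub>m m"
  proof (rule eq_matI)
    fix a b assume ab: "a < dim_row (1\<^sub>m m)" "b < dim_col (1\<^sub>m m)"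
    then have ab: "a < m" "b < m" by auto
    have "(A' * B') $$ (a,b) = (\<Sum>j<m. if j < n then A $$ (a,j) * B $$ (j,b) else 0)"
      using ab by (auto simp: A'_def B'_def scalar_prod_def lessThan_atLeast0 intro!: sum.cong)
    also have "\<dots> = (\<Sum>j<n. A $$ (a,j) * B $$ (j,b))"
      by (rule sum.mono_neutral_cong_right) (use nm in auto)
    also have "\<dots> = (A * B) $$ (a,b)" using ab A B by (auto simp: scalar_prod_def lessThan_atLeast0)
    finally show "(A' * B') $$ (a,b) = 1\<^sub>m m $$ (a,b)" using AB ab by simp
  qed (auto simp: A'_def B'_def)
  then have "B' * A' = 1\<^sub>m m"
    by (intro mat_mult_left_right_inverse[of A' m B']) (auto simp: A'_def B'_def)
  then have "(B' * A') $$ (n,n) = 1" using nm by simp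
  moreover have "(B' * A') $$ (n,n) = 0" using nm by (auto simp: A'_def B'_def scalar_prod_def)
  ultimately show False by simp
qed

text \<open>The matrix 1 - g * s projects onto the kernel of g, and its rank factorization e * i
  gives a basis of that kernel together with a projection to it.\<close>

lemma split_complement:
  fixes g :: "'k::field mat"
  assumes g: "g \<in> carrier_mat m n" and s: "s \<in> carrier_mat n m" and sg: "s * g = 1\<^sub>m n"
  obtains k i e where "i \<in> carrier_mat k m" "e \<in> carrier_mat m k" "i * e = 1\<^sub>m k" "i * g = 0\<^sub>m k n"
    "s * e = 0\<^sub>m n k" "g * s + e * i = 1\<^sub>m m" "m = k + n"
proof -
  let ?d = "1\<^sub>m m - g * s"
  have dd: "?d \<in> carrier_mat m m" using g s by auto
  obtain k e i a b where e: "e \<in> carrier_mat m k" and i: "i \<in> carrier_mat k m" and a: "a \<in> carrier_mat k m"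
    and b: "b \<in> carrier_mat m k" and d: "?d = e * i" and ae: "a * e = 1\<^sub>m k" and ib: "i * b = 1\<^sub>m k"
    by (rule rank_factorization[OF dd])
  have dims: "dim_row g = m" "dim_col g = n" "dim_row s = n" "dim_col s = m" "dim_row e = m" "dim_col e = k"
    "dim_row i = k" "dim_col i = m" "dim_row a = k" "dim_col a = m" "dim_row b = m" "dim_col b = k"
    using g s e i a b by auto
  have sgx: "s * (g * x) = x" if "dim_row x = n" for x
    using sg that dims by (simp add: mat_assoc[symmetric])
  have "(e * i) * g = g - g * (s * g)" unfolding d[symmetric] using dims by (simp add: mat_assoc mat_distr)
  also have "\<dots> = 0\<^sub>m m n" using sg dims g by simp
  finally have "a * ((e * i) * g) = 0\<^sub>m k n" using dims by simp
  then have ig: "i * g = 0\<^sub>m k n" using dims ae by (simp add: mat_assoc) (simp add: mat_assoc[symmetric])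
  have "s * (e * i) = s - s * (g * s)" unfolding d[symmetric] using dims by (simp add: mat_assoc mat_distr)
  also have "\<dots> = 0\<^sub>m n m" using sgx dims s by simp
  finally have "(s * (e * i)) * b = 0\<^sub>m n k" using dims by simp
  then have se: "s * e = 0\<^sub>m n k" using dims ib by (simp add: mat_assoc)
  have "(e * i) * e = e - g * (s * e)" unfolding d[symmetric] using dims by (simp add: mat_assoc mat_distr)
  also have "\<dots> = e" using se dims by simp
  finally have "a * ((e * i) * e) = 1\<^sub>m k" using ae by simp
  then have ie: "i * e = 1\<^sub>m k" using dims ae by (simp add: mat_assoc) (simp add: mat_assoc[symmetric])
  have sum: "g * s + e * i = 1\<^sub>m m" unfolding d[symmetric] using dims g s
    by (intro eq_matI) auto
  \<comment> \<open>The row of blocks g, e and the column of blocks s, i are mutually inverse, which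
    forces m = n + k.\<close>
  define U where "U = four_block_mat g e (0\<^sub>m 0 n) (0\<^sub>m 0 k)"
  define V where "V = four_block_mat s (0\<^sub>m n 0) i (0\<^sub>m k 0)"
  have UV: "U * V = 1\<^sub>m m"
    unfolding U_def V_def mult_four_block_mat[OF g e zero_carrier_mat zero_carrier_mat s zero_carrier_mat i zero_carrier_mat]
    sum using g s e i dims by (intro eq_matI) simp_all
  have "V * U = four_block_mat (1\<^sub>m n) (0\<^sub>m n k) (0\<^sub>m k n) (1\<^sub>m k)"
    unfolding U_def V_def mult_four_block_mat[OF s zero_carrier_mat i zero_carrier_mat g e zero_carrier_mat zero_carrier_mat]
    sg se ig ie by simp
  then have VU: "V * U = 1\<^sub>m (n + k)" by simp
  have U: "U \<in> carrier_mat m (n + k)" using dims by (intro carrier_matI) (auto simp: U_def)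
  have V: "V \<in> carrier_mat (n + k) m" using dims by (intro carrier_matI) (auto simp: V_def)
  have "m = n + k"
    using right_inverse_dim_le[OF U V] right_inverse_dim_le[OF V U] UV VU by simp
  then show thesis using i e ie ig se sum by (intro that[of i k e]) auto
qed

section \<open>Modules\<close>

lemma mat_smult:
  fixes A :: "'k::field mat"
  shows "dim_col A = dim_row B \<Longrightarrow> A * (c \<cdot>\<^sub>m B) = c \<cdot>\<^sub>m (A * B)"
    "dim_col A = dim_row B \<Longrightarrow> (c \<cdot>\<^sub>m A) * B = c \<cdot>\<^sub>m (A * B)"
  by (metis mult_smult_distrib mult_smult_assoc_mat carrier_matI)+

locale module_category =
  fixes sm :: "'k::field \<Rightarrow> 'a::ring_1 \<Rightarrow> 'a"
begin

abbreviation Md :: "('a,'k) rmod set" where "Md \<equiv> {M. is_mod sm M}"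

definition mor :: "('a,'k) rmod \<Rightarrow> ('a,'k) rmod \<Rightarrow> 'k mat \<Rightarrow> bool" where
  "mor M N f \<longleftrightarrow> is_mod sm M \<and> is_mod sm N \<and> is_hom M N f"

definition epi :: "('a,'k) rmod \<Rightarrow> ('a,'k) rmod \<Rightarrow> 'k mat \<Rightarrow> bool" where
  "epi M N f \<longleftrightarrow> mor M N f \<and> surj_map (fst M) (fst N) f"

definition mono :: "('a,'k) rmod \<Rightarrow> ('a,'k) rmod \<Rightarrow> 'k mat \<Rightarrow> bool" where
  "mono M N f \<longleftrightarrow> mor M N f \<and> inj_map (fst M) (fst N) f"

abbreviation ident :: "('a,'k) rmod \<Rightarrow> 'k mat" where "ident M \<equiv> 1\<^sub>m (fst M)"
abbreviation nul :: "('a,'k) rmod \<Rightarrow> ('a,'k) rmod \<Rightarrow> 'k mat" where "nul M N \<equiv> 0\<^sub>m (fst M) (fst N)"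

lemma mod_dims: "is_mod sm M \<Longrightarrow> dim_row (snd M a) = fst M \<and> dim_col (snd M a) = fst M"
  unfolding is_mod_def by auto

lemma mor_dims: "mor M N f \<Longrightarrow> dim_row f = fst M \<and> dim_col f = fst N \<and>
    dim_row (snd M a) = fst M \<and> dim_col (snd M a) = fst M \<and> dim_row (snd N a) = fst N \<and> dim_col (snd N a) = fst N"
  unfolding mor_def is_hom_def using mod_dims by auto

lemma mor_mod: "mor M N f \<Longrightarrow> is_mod sm M" "mor M N f \<Longrightarrow> is_mod sm N"
  by (auto simp: mor_def)

lemma mor_carrier: "mor M N f \<Longrightarrow> f \<in> carrier_mat (fst M) (fst N)"
  by (auto simp: mor_def is_hom_def)

lemma mor_eq: "mor M N f \<Longrightarrow> snd M a * f = f * snd N a"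
  by (auto simp: mor_def is_hom_def)

lemma morI: "is_mod sm M \<Longrightarrow> is_mod sm N \<Longrightarrow> dim_row f = fst M \<Longrightarrow> dim_col f = fst N \<Longrightarrow>
   (\<And>a. snd M a * f = f * snd N a) \<Longrightarrow> mor M N f"
  by (auto simp: mor_def is_hom_def intro!: carrier_matI)

lemma mor_comp: assumes f: "mor M N f" and g: "mor N P g" shows "mor M P (f * g)"
proof (rule morI)
  fix a
  have "snd M a * (f * g) = (snd M a * f) * g"
    using mor_dims[OF f, of a] mor_dims[OF g, of a] by (simp add: mat_assoc)
  also have "\<dots> = f * (snd N a * g)"
    unfolding mor_eq[OF f] using mor_dims[OF f, of a] mor_dims[OF g, of a] by (simp add: mat_assoc)
  also have "\<dots> = (f * g) * snd P a"
    unfolding mor_eq[OF g] using mor_dims[OF f, of a] mor_dims[OF g, of a] by (simp add: mat_assoc)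
  finally show "snd M a * (f * g) = (f * g) * snd P a" .
qed (use mor_mod f g mor_dims in auto)

lemma mor_id: "is_mod sm M \<Longrightarrow> mor M M (ident M)"
  by (rule morI) (auto simp: mod_dims)

lemma mor_nul: "is_mod sm M \<Longrightarrow> is_mod sm N \<Longrightarrow> mor M N (nul M N)"
  by (rule morI) (auto simp: mod_dims)

lemma mor_add: "mor M N f \<Longrightarrow> mor M N g \<Longrightarrow> mor M N (f + g)"
  by (rule morI) (auto simp: mor_mod mor_dims mat_distr mor_eq)

lemma mor_diff: "mor M N f \<Longrightarrow> mor M N g \<Longrightarrow> mor M N (f - g)"
  by (rule morI) (auto simp: mor_mod mor_dims mat_distr mor_eq)

lemma mor_smult: "mor M N f \<Longrightarrow> mor M N (c \<cdot>\<^sub>m f)"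
  by (rule morI) (auto simp: mor_mod mor_dims mat_smult mor_eq)

lemma comp_assoc: "mor A B f \<Longrightarrow> mor B C g \<Longrightarrow> mor C D h \<Longrightarrow> (f * g) * h = f * (g * h)"
  by (rule mat_assoc) (auto simp: mor_dims)

lemma comp_id[simp]: "mor M N f \<Longrightarrow> ident M * f = f" "mor M N f \<Longrightarrow> f * ident N = f"
  by (auto simp: mor_dims)

lemma comp_nul[simp]: "mor M N f \<Longrightarrow> nul L M * f = nul L N" "mor M N f \<Longrightarrow> f * nul N L = nul M L"
  by (auto simp: mor_dims)

lemma mono_mor: "mono M N f \<Longrightarrow> mor M N f" by (simp add: mono_def)
lemma epi_mor: "epi M N f \<Longrightarrow> mor M N f" by (simp add: epi_def)

lemma mono_cancel:
  assumes u: "mono M N u" and f: "dim_col f = fst M" "dim_col g = fst M" and eq: "f * u = g * u"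
  shows "f = g"
proof -
  obtain t where t: "t \<in> carrier_mat (fst N) (fst M)" "u * t = ident M"
    using u by (auto simp: mono_def inj_map_def)
  have "(f * u) * t = f" "(g * u) * t = g" using f t mor_dims[OF mono_mor[OF u]] by (auto simp: mat_assoc)
  then show ?thesis using eq by metis
qed

lemma mono_cancel_nul:
  assumes u: "mono M N u" and f: "mor L M f" and eq: "f * u = nul L N"
  shows "f = nul L M"
  by (rule mono_cancel[OF u]) (simp_all add: eq mor_dims[OF f] comp_nul(1)[OF mono_mor[OF u]])

lemma epi_cancel:
  assumes u: "epi M N u" and f: "dim_row f = fst N" "dim_row g = fst N" and eq: "u * f = u * g"
  shows "f = g"
proof -
  obtain s where s: "s \<in> carrier_mat (fst N) (fst M)" "s * u = ident N"
    using u by (auto simp: epi_def surj_map_def)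
  have "s * (u * f) = f" "s * (u * g) = g" using f s mor_dims[OF epi_mor[OF u]] by (auto simp: mat_assoc[symmetric])
  then show ?thesis using eq by metis
qed

lemma epi_cancel_nul:
  assumes u: "epi M N u" and f: "mor N L f" and eq: "u * f = nul M L"
  shows "f = nul N L"
  by (rule epi_cancel[OF u]) (simp_all add: eq mor_dims[OF f] comp_nul(2)[OF epi_mor[OF u]])

lemma epi_comp: assumes "epi M N f" "epi N P g" shows "epi M P (f * g)"
proof -
  obtain s t where s: "s \<in> carrier_mat (fst N) (fst M)" "s * f = ident N"
    "t \<in> carrier_mat (fst P) (fst N)" "t * g = ident P"
    using assms by (auto simp: epi_def surj_map_def)
  have "(t * s) * (f * g) = t * ((s * f) * g)"
    using s(1,3) mor_dims[OF epi_mor[OF assms(1)]] mor_dims[OF epi_mor[OF assms(2)]] by (auto simp: mat_assoc)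
  then have "(t * s) * (f * g) = ident P" unfolding s using s mor_dims[OF epi_mor[OF assms(2)]] by simp
  moreover have "t * s \<in> carrier_mat (fst P) (fst M)" using s by auto
  ultimately show ?thesis using assms by (auto simp: epi_def surj_map_def intro: mor_comp)
qed

text \<open>The rows of i span a subspace; \<open>inv\<close> says that it is invariant, and t reads
  off the induced action in this basis.\<close>

lemma sub_module:
  assumes N: "is_mod sm N" and i: "i \<in> carrier_mat r (fst N)" and t: "t \<in> carrier_mat (fst N) r"
    and it: "i * t = 1\<^sub>m r" and inv: "\<And>a. i * snd N a = (i * snd N a * t) * i"
  shows "mono (r, \<lambda>a. i * snd N a * t) N i"
proof -
  have d: "dim_row i = r" "dim_col i = fst N" "dim_row t = fst N" "dim_col t = r"
    "\<And>a. dim_row (snd N a) = fst N" "\<And>a. dim_col (snd N a) = fst N"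
    using i t mod_dims[OF N] by auto
  have m: "i * snd N (a * b) * t = (i * snd N a * t) * (i * snd N b * t)" for a b
  proof -
    have "i * snd N (a * b) * t = ((i * snd N a) * snd N b) * t"
      using N d by (simp add: is_mod_def mat_assoc)
    also have "\<dots> = (i * snd N a * t) * (i * snd N b * t)"
      by (subst inv) (use d in \<open>simp add: mat_assoc\<close>)
    finally show ?thesis .
  qed
  have "is_mod sm (r, \<lambda>a. i * snd N a * t)"
    unfolding is_mod_def
    using d it m N[unfolded is_mod_def] by (auto simp: mat_distr mat_smult intro!: carrier_matI)
  then have "mor (r, \<lambda>a. i * snd N a * t) N i"
    by (rule morI) (use N d inv in auto)
  then show ?thesis unfolding mono_def inj_map_def using it t by auto
qed

lemma quot_module:
  assumes M: "is_mod sm M" and e: "e \<in> carrier_mat (fst M) r" and s: "s \<in> carrier_mat r (fst M)"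
    and se: "s * e = 1\<^sub>m r" and inv: "\<And>a. snd M a * e = e * (s * (snd M a * e))"
  shows "epi M (r, \<lambda>a. s * (snd M a * e)) e"
proof -
  have d: "dim_row s = r" "dim_col s = fst M" "dim_row e = fst M" "dim_col e = r"
    "\<And>a. dim_row (snd M a) = fst M" "\<And>a. dim_col (snd M a) = fst M"
    using e s mod_dims[OF M] by auto
  have m: "s * (snd M (a * b) * e) = (s * (snd M a * e)) * (s * (snd M b * e))" for a b
  proof -
    have "s * (snd M (a * b) * e) = s * (snd M a * (snd M b * e))"
      using M d by (simp add: is_mod_def mat_assoc)
    also have "\<dots> = (s * (snd M a * e)) * (s * (snd M b * e))"
      by (subst inv) (use d in \<open>simp add: mat_assoc\<close>)
    finally show ?thesis .
  qed
  have "is_mod sm (r, \<lambda>a. s * (snd M a * e))"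
    unfolding is_mod_def
    using d se m M[unfolded is_mod_def] by (auto simp: mat_distr mat_smult intro!: carrier_matI)
  then have "mor M (r, \<lambda>a. s * (snd M a * e)) e"
    by (rule morI[OF M]) (use d inv in auto)
  then show ?thesis unfolding epi_def surj_map_def using se s by auto
qed

section \<open>Images, kernels, cokernels and linear splittings\<close>

lemma image:
  assumes f: "mor M N f"
  obtains I e i where "epi M I e" "mono I N i" "f = e * i"
proof -
  obtain r e i s t where e: "e \<in> carrier_mat (fst M) r" and i: "i \<in> carrier_mat r (fst N)"
    and s: "s \<in> carrier_mat r (fst M)" and t: "t \<in> carrier_mat (fst N) r"
    and fei: "f = e * i" and se: "s * e = 1\<^sub>m r" and it: "i * t = 1\<^sub>m r"
    by (rule rank_factorization[OF mor_carrier[OF f]])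
  have d: "dim_row i = r" "dim_col i = fst N" "dim_row t = fst N" "dim_col t = r"
    "dim_row s = r" "dim_col s = fst M" "dim_row e = fst M" "dim_col e = r"
    "\<And>a. dim_row (snd N a) = fst N" "\<And>a. dim_col (snd N a) = fst N"
    "\<And>a. dim_row (snd M a) = fst M" "\<And>a. dim_col (snd M a) = fst M"
    using i t e s mor_dims[OF f] by auto
  have sex: "s * (e * x) = x" if "dim_row x = r" for x
    using that se d by (simp add: mat_assoc[symmetric])
  have itx: "i * (t * x) = x" if "dim_row x = r" for x
    using that it d by (simp add: mat_assoc[symmetric])
  have eq: "snd M a * (e * i) = e * (i * snd N a)" for a
    using mor_eq[OF f, of a] d unfolding fei by (simp add: mat_assoc)
  \<comment> \<open>Through the section s of e, the product i * snd N a is rewritten so that it ends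
    in the factor i; hence the row space of i is invariant.\<close>
  have iN: "i * snd N a = s * (snd M a * (e * i))" for a
    unfolding eq using sex d by simp
  have mono: "mono (r, \<lambda>a. i * snd N a * t) N i"
    by (rule sub_module) (use f i t it iN d itx mor_mod in \<open>auto simp: mat_assoc\<close>)
  have "snd M a * e = e * (i * snd N a * t)" for a
  proof -
    have "snd M a * e = (snd M a * (e * i)) * t" using d it by (simp add: mat_assoc)
    also have "\<dots> = e * (i * snd N a * t)" unfolding eq using d by (simp add: mat_assoc)
    finally show ?thesis .
  qed
  then have "mor M (r, \<lambda>a. i * snd N a * t) e"
    using mor_mod(1)[OF f] mor_mod(1)[OF mono_mor[OF mono]] d by (intro morI) auto
  then have "epi M (r, \<lambda>a. i * snd N a * t) e" using s se by (auto simp: epi_def surj_map_def)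
  then show thesis using mono fei that by blast
qed

lemma inverse_mor:
  assumes f: "mor M N f" and g: "dim_row g = fst N" "dim_col g = fst M" and fg: "f * g = ident M" and gf: "g * f = ident N"
  shows "mor N M g"
proof (rule morI)
  fix a
  note d = mor_dims[OF f, of a] g
  have "snd N a * g = (g * f) * (snd N a * g)" unfolding gf using d by simp
  also have "\<dots> = g * ((f * snd N a) * g)" using d by (simp add: mat_assoc)
  also have "\<dots> = g * (snd M a * (f * g))" unfolding mor_eq[OF f, symmetric] using d by (simp add: mat_assoc)
  also have "\<dots> = g * snd M a" unfolding fg using d by simp
  finally show "snd N a * g = g * snd M a" .
qed (use f g mor_mod in auto)

lemma epi_le: "epi M N f \<Longrightarrow> fst N \<le> fst M"
  unfolding epi_def surj_map_def using right_inverse_dim_le mor_carrier by blast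

lemma mono_le: "mono M N f \<Longrightarrow> fst M \<le> fst N"
  unfolding mono_def inj_map_def using right_inverse_dim_le mor_carrier by blast

lemma epi_iso:
  assumes f: "epi M N f" and le: "fst M \<le> fst N"
  obtains g where "mor N M g" "f * g = ident M" "g * f = ident N"
proof -
  obtain s where s: "s \<in> carrier_mat (fst N) (fst M)" "s * f = ident N"
    using f by (auto simp: epi_def surj_map_def)
  have eq: "fst M = fst N" using epi_le[OF f] le by simp
  have "f * s = ident M"
    using mat_mult_left_right_inverse[of s "fst N" f] s mor_carrier[OF epi_mor[OF f]] eq by auto
  then show thesis using s inverse_mor[OF epi_mor[OF f], of s] by (intro that[of s]) auto
qed

lemma mono_iso:
  assumes f: "mono M N f" and le: "fst N \<le> fst M"
  obtains g where "mor N M g" "f * g = ident M" "g * f = ident N"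
proof -
  obtain s where s: "s \<in> carrier_mat (fst N) (fst M)" "f * s = ident M"
    using f by (auto simp: mono_def inj_map_def)
  have eq: "fst M = fst N" using mono_le[OF f] le by simp
  have "s * f = ident N"
    using mat_mult_left_right_inverse[of f "fst N" s] s mor_carrier[OF mono_mor[OF f]] eq by auto
  then show thesis using s inverse_mor[OF mono_mor[OF f], of s] by (intro that[of s]) auto
qed

lemma sesD:
  assumes "ses sm Y f E g X"
  shows "mono Y E f" "epi E X g" "f * g = nul Y X" "fst E = fst Y + fst X"
  using assms by (auto simp: ses_def mono_def epi_def mor_def)

lemma sesI: "mono Y E f \<Longrightarrow> epi E X g \<Longrightarrow> f * g = nul Y X \<Longrightarrow> fst E = fst Y + fst X \<Longrightarrow> ses sm Y f E g X"
  by (auto simp: ses_def mono_def epi_def mor_def)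

text \<open>The complement of a linear section s of g gives a basis i of the kernel. Its row space
  is invariant because the component along g * s passes through i * g = 0.\<close>

lemma kernel:
  assumes g: "epi E X g"
  obtains Y f where "ses sm Y f E g X"
proof -
  obtain s where s: "s \<in> carrier_mat (fst X) (fst E)" "s * g = ident X"
    using g by (auto simp: epi_def surj_map_def)
  obtain k i e where i: "i \<in> carrier_mat k (fst E)" and e: "e \<in> carrier_mat (fst E) k" and ie: "i * e = 1\<^sub>m k"
    and ig: "i * g = 0\<^sub>m k (fst X)" and sum: "g * s + e * i = ident E" and k: "fst E = k + fst X"
    by (rule split_complement[OF mor_carrier[OF epi_mor[OF g]] s])
  have d: "dim_row i = k" "dim_col i = fst E" "dim_row e = fst E" "dim_col e = k"
    "dim_row s = fst X" "dim_col s = fst E" "dim_row g = fst E" "dim_col g = fst X"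
    "\<And>a. dim_row (snd E a) = fst E" "\<And>a. dim_col (snd E a) = fst E"
    "\<And>a. dim_row (snd X a) = fst X" "\<And>a. dim_col (snd X a) = fst X"
    using i e s mor_dims[OF epi_mor[OF g]] by auto
  have "i * snd E a = (i * snd E a * e) * i" for a
  proof -
    have "i * snd E a = (i * snd E a) * (g * s + e * i)" unfolding sum using d by simp
    also have "\<dots> = i * ((snd E a * g) * s) + (i * snd E a * e) * i" using d by (simp add: mat_distr mat_assoc)
    also have "i * ((snd E a * g) * s) = (i * g) * (snd X a * s)"
      unfolding mor_eq[OF epi_mor[OF g]] using d by (simp add: mat_assoc)
    finally show ?thesis unfolding ig using d by simp
  qed
  then have m: "mono (k, \<lambda>a. i * snd E a * e) E i"
    by (intro sub_module mor_mod(1)[OF epi_mor[OF g]] i e ie)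
  show thesis by (rule that, rule sesI[OF m g]) (use ig k in auto)
qed

lemma cokernel:
  assumes f: "mono Y E f"
  obtains X g where "ses sm Y f E g X"
proof -
  obtain t where t: "t \<in> carrier_mat (fst E) (fst Y)" "f * t = ident Y"
    using f by (auto simp: mono_def inj_map_def)
  obtain k i e where i: "i \<in> carrier_mat k (fst E)" and e: "e \<in> carrier_mat (fst E) k" and ie: "i * e = 1\<^sub>m k"
    and fe: "f * e = 0\<^sub>m (fst Y) k" and sum: "t * f + e * i = ident E" and k: "fst E = k + fst Y"
    by (rule split_complement[OF t(1) mor_carrier[OF mono_mor[OF f]] t(2)])
  have d: "dim_row i = k" "dim_col i = fst E" "dim_row e = fst E" "dim_col e = k"
    "dim_row t = fst E" "dim_col t = fst Y" "dim_row f = fst Y" "dim_col f = fst E"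
    "\<And>a. dim_row (snd E a) = fst E" "\<And>a. dim_col (snd E a) = fst E"
    "\<And>a. dim_row (snd Y a) = fst Y" "\<And>a. dim_col (snd Y a) = fst Y"
    using i e t mor_dims[OF mono_mor[OF f]] by auto
  have "snd E a * e = e * (i * (snd E a * e))" for a
  proof -
    have "snd E a * e = (t * f + e * i) * (snd E a * e)" unfolding sum using d by simp
    also have "\<dots> = t * ((f * snd E a) * e) + e * (i * (snd E a * e))" using d by (simp add: mat_distr mat_assoc)
    also have "t * ((f * snd E a) * e) = t * (snd Y a * (f * e))"
      unfolding mor_eq[OF mono_mor[OF f], symmetric] using d by (simp add: mat_assoc)
    finally show ?thesis unfolding fe using d by simp
  qed
  then have m: "epi E (k, \<lambda>a. i * (snd E a * e)) e"
    by (intro quot_module mor_mod(2)[OF mono_mor[OF f]] i e ie)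
  show thesis by (rule that, rule sesI[OF f m]) (use fe k in auto)
qed

text \<open>The complement of s comes with its own basis i of the kernel, whereas f is prescribed.
  The invertible matrix f * e compares the two, and the retraction e is corrected by its inverse i *
  t.\<close>

lemma ses_splitting:
  assumes ses: "ses sm Y f E g X"
  obtains s t where "s \<in> carrier_mat (fst X) (fst E)" "t \<in> carrier_mat (fst E) (fst Y)"
    "s * g = ident X" "f * t = ident Y" "g * s + t * f = ident E" "s * t = nul X Y"
proof -
  note S = sesD[OF ses]
  obtain s where s: "s \<in> carrier_mat (fst X) (fst E)" "s * g = ident X"
    using S(2) by (auto simp: epi_def surj_map_def)
  obtain k i e where i: "i \<in> carrier_mat k (fst E)" and e: "e \<in> carrier_mat (fst E) k" and ie: "i * e = 1\<^sub>m k"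
    and se: "s * e = 0\<^sub>m (fst X) k" and ig: "i * g = 0\<^sub>m k (fst X)" and sum: "g * s + e * i = ident E" and k: "fst E = k + fst X"
    by (rule split_complement[OF mor_carrier[OF epi_mor[OF S(2)]] s])
  have kY: "k = fst Y" using k S(4) by simp
  obtain t where t: "t \<in> carrier_mat (fst E) (fst Y)" "f * t = ident Y"
    using S(1) by (auto simp: mono_def inj_map_def)
  have d: "dim_row i = fst Y" "dim_col i = fst E" "dim_row e = fst E" "dim_col e = fst Y"
    "dim_row s = fst X" "dim_col s = fst E" "dim_row g = fst E" "dim_col g = fst X"
    "dim_row t = fst E" "dim_col t = fst Y" "dim_row f = fst Y" "dim_col f = fst E"
    using i e s t mor_dims[OF epi_mor[OF S(2)]] mor_dims[OF mono_mor[OF S(1)]] kY by auto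
  have fei: "f * (e * i) = f"
  proof -
    have "f = f * (g * s + e * i)" unfolding sum using d by simp
    also have "\<dots> = (f * g) * s + f * (e * i)" using d by (simp add: mat_distr mat_assoc)
    also have "\<dots> = f * (e * i)" unfolding S(3) using d by simp
    finally show ?thesis by simp
  qed
  have "(f * e) * (i * t) = (f * (e * i)) * t" using d by (simp add: mat_assoc)
  then have "(f * e) * (i * t) = ident Y" unfolding fei t(2) .
  then have inv: "(i * t) * (f * e) = ident Y"
    by (intro mat_mult_left_right_inverse[of "f * e" "fst Y" "i * t"]) (use d in \<open>auto intro!: carrier_matI\<close>)
  define t' where "t' = e * (i * t)"
  have "f * t' = (f * (e * i)) * t" unfolding t'_def using d by (simp add: mat_assoc)
  then have ft': "f * t' = ident Y" unfolding fei t(2) .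
  have "t' * f = e * ((i * t) * (f * (e * i)))" unfolding t'_def fei using d by (simp add: mat_assoc)
  also have "\<dots> = e * (((i * t) * (f * e)) * i)" using d by (simp add: mat_assoc)
  finally have "t' * f = e * i" unfolding inv using d by simp
  then have sum': "g * s + t' * f = ident E" using sum by simp
  have "s * t' = (s * e) * (i * t)" unfolding t'_def using d by (simp add: mat_assoc)
  then have "s * t' = nul X Y" unfolding se kY using d by simp
  then show thesis using s ft' sum' d by (intro that[of s t']) (auto simp: t'_def intro!: carrier_matI)
qed

text \<open>The retraction t is only linear; h * t nevertheless commutes with the action, because (h
  * t) * f = h and f can be cancelled.\<close>

lemma ses_lift:
  assumes ses: "ses sm Y f E g X" and h: "mor M E h" and hg: "h * g = nul M X"
  obtains h' where "mor M Y h'" "h' * f = h"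
proof -
  note S = sesD[OF ses]
  obtain s t where st: "s \<in> carrier_mat (fst X) (fst E)" "t \<in> carrier_mat (fst E) (fst Y)"
    "f * t = ident Y" "g * s + t * f = ident E" by (rule ses_splitting[OF ses])
  have d: "dim_row s = fst X" "dim_col s = fst E" "dim_row g = fst E" "dim_col g = fst X"
    "dim_row t = fst E" "dim_col t = fst Y" "dim_row f = fst Y" "dim_col f = fst E"
    "dim_row h = fst M" "dim_col h = fst E" 
    "\<And>a. dim_row (snd M a) = fst M" "\<And>a. dim_col (snd M a) = fst M"
    "\<And>a. dim_row (snd E a) = fst E" "\<And>a. dim_col (snd E a) = fst E"
    "\<And>a. dim_row (snd Y a) = fst Y" "\<And>a. dim_col (snd Y a) = fst Y"
    using st mor_dims[OF epi_mor[OF S(2)]] mor_dims[OF mono_mor[OF S(1)]] mor_dims[OF h] by auto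
  have "h = h * (g * s + t * f)" unfolding st using d by simp
  also have "\<dots> = (h * g) * s + (h * t) * f" using d by (simp add: mat_distr mat_assoc)
  finally have eq: "(h * t) * f = h" unfolding hg using d by simp
  have "mor M Y (h * t)"
  proof (rule morI)
    fix a
    have "snd M a * (h * t) = (snd M a * h) * t" using d by (simp add: mat_assoc)
    also have "\<dots> = ((h * t) * f) * (snd E a * t)" unfolding mor_eq[OF h] eq using d by (simp add: mat_assoc)
    also have "\<dots> = (h * t) * ((f * snd E a) * t)" using d by (simp add: mat_assoc)
    also have "\<dots> = (h * t) * snd Y a * (f * t)" unfolding mor_eq[OF mono_mor[OF S(1)], symmetric] using d by (simp add: mat_assoc)
    finally show "snd M a * (h * t) = (h * t) * snd Y a" unfolding st using d by simp
  qed (use mor_mod(1)[OF h] mor_mod(1)[OF mono_mor[OF S(1)]] d in auto)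
  with eq show thesis using that by blast
qed

lemma ses_desc:
  assumes ses: "ses sm Y f E g X" and h: "mor E M h" and fh: "f * h = nul Y M"
  obtains h' where "mor X M h'" "g * h' = h"
proof -
  note S = sesD[OF ses]
  obtain s t where st: "s \<in> carrier_mat (fst X) (fst E)" "t \<in> carrier_mat (fst E) (fst Y)"
    "s * g = ident X" "g * s + t * f = ident E" by (rule ses_splitting[OF ses])
  have d: "dim_row s = fst X" "dim_col s = fst E" "dim_row g = fst E" "dim_col g = fst X"
    "dim_row t = fst E" "dim_col t = fst Y" "dim_row f = fst Y" "dim_col f = fst E"
    "dim_row h = fst E" "dim_col h = fst M" 
    "\<And>a. dim_row (snd M a) = fst M" "\<And>a. dim_col (snd M a) = fst M"
    "\<And>a. dim_row (snd E a) = fst E" "\<And>a. dim_col (snd E a) = fst E"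
    "\<And>a. dim_row (snd X a) = fst X" "\<And>a. dim_col (snd X a) = fst X"
    using st mor_dims[OF epi_mor[OF S(2)]] mor_dims[OF mono_mor[OF S(1)]] mor_dims[OF h] by auto
  have "h = (g * s + t * f) * h" unfolding st using d by simp
  also have "\<dots> = g * (s * h) + t * (f * h)" using d by (simp add: mat_distr mat_assoc)
  finally have eq: "g * (s * h) = h" unfolding fh using d by simp
  have "mor X M (s * h)"
  proof (rule morI)
    fix a
    have "snd X a * (s * h) = (s * g) * (snd X a * (s * h))" unfolding st using d by simp
    also have "\<dots> = s * ((g * snd X a) * (s * h))" using d by (simp add: mat_assoc)
    also have "\<dots> = s * (snd E a * (g * (s * h)))" unfolding mor_eq[OF epi_mor[OF S(2)], symmetric] using d by (simp add: mat_assoc)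
    also have "\<dots> = s * (snd E a * h)" unfolding eq ..
    finally show "snd X a * (s * h) = (s * h) * snd M a" unfolding mor_eq[OF h] using d by (simp add: mat_assoc)
  qed (use mor_mod(2)[OF h] mor_mod(2)[OF epi_mor[OF S(2)]] d in auto)
  with eq show thesis using that by blast
qed

end

section \<open>Extensions\<close>

lemma mat_add_ac:
  fixes A :: "'k::field mat"
  shows "dim_row A = dim_row B \<Longrightarrow> dim_col A = dim_col B \<Longrightarrow> A + B = B + A"
    "dim_row A = dim_row B \<Longrightarrow> dim_col A = dim_col B \<Longrightarrow> dim_row B = dim_row C \<Longrightarrow> dim_col B = dim_col C \<Longrightarrow>
      (A + B) + C = A + (B + C)"
    "dim_row A = dim_row B \<Longrightarrow> dim_col A = dim_col B \<Longrightarrow> dim_row B = dim_row C \<Longrightarrow> dim_col B = dim_col C \<Longrightarrow>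
      A + (B + C) = B + (A + C)"
  by (auto intro!: eq_matI simp: ac_simps)

text \<open>Only the inclusion and projection of the x-dimensional summand are written down, in the
  first x coordinates. The complement from \<open>split_complement\<close> has dimension m and
  supplies the other pair.\<close>

lemma biproduct_matrices:
  obtains j \<sigma> r q :: "'k::field mat" where
    "j \<in> carrier_mat m (m + x)" "r \<in> carrier_mat (m + x) m" "\<sigma> \<in> carrier_mat x (m + x)" "q \<in> carrier_mat (m + x) x"
    "j * r = 1\<^sub>m m" "\<sigma> * q = 1\<^sub>m x" "j * q = 0\<^sub>m m x" "\<sigma> * r = 0\<^sub>m x m" "q * \<sigma> + r * j = 1\<^sub>m (m + x)"
proof -
  define \<sigma> where "\<sigma> = mat x (m + x) (\<lambda>(a,b). if a = b then 1::'k else 0)"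
  define q where "q = mat (m + x) x (\<lambda>(a,b). if a = b then 1::'k else 0)"
  have s: "\<sigma> \<in> carrier_mat x (m + x)" and q: "q \<in> carrier_mat (m + x) x" by (auto simp: \<sigma>_def q_def)
  have sq: "\<sigma> * q = 1\<^sub>m x"
  proof (rule eq_matI)
    fix a b assume ab: "a < dim_row (1\<^sub>m x)" "b < dim_col (1\<^sub>m x)"
    have "(\<sigma> * q) $$ (a,b) = (\<Sum>k<m+x. (if a = k then 1 else 0) * (if k = b then 1 else 0))"
      using ab by (simp add: \<sigma>_def q_def scalar_prod_def lessThan_atLeast0)
    also have "\<dots> = (\<Sum>k<m+x. if k = a then (if a = b then 1 else 0) else 0)"
      by (rule sum.cong) auto
    finally have "(\<sigma> * q) $$ (a,b) = (\<Sum>k<m+x. if k = a then (if a = b then 1 else 0) else 0)" .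
    then show "(\<sigma> * q) $$ (a,b) = 1\<^sub>m x $$ (a,b)" using ab by simp
  qed (auto simp: \<sigma>_def q_def)
  show thesis
  proof (rule split_complement[OF q s sq])
    fix k i e
    assume *: "i \<in> carrier_mat k (m + x)" "e \<in> carrier_mat (m + x) k" "i * e = 1\<^sub>m k" "i * q = 0\<^sub>m k x"
      "\<sigma> * e = 0\<^sub>m x k" "q * \<sigma> + e * i = 1\<^sub>m (m + x)" "m + x = k + x"
    then have "k = m" by simp
    with * s q sq that show thesis by blast
  qed
qed

context module_category begin

lemma monoI: "mor M N f \<Longrightarrow> f * t = ident M \<Longrightarrow> dim_row t = fst N \<Longrightarrow> dim_col t = fst M \<Longrightarrow> mono M N f"
  unfolding mono_def inj_map_def by (auto intro!: carrier_matI)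

lemma epiI: "mor M N f \<Longrightarrow> s * f = ident N \<Longrightarrow> dim_row s = fst N \<Longrightarrow> dim_col s = fst M \<Longrightarrow> epi M N f"
  unfolding epi_def surj_map_def by (auto intro!: carrier_matI)

text \<open>N' is the preimage of I in M, an extension of I by N. Thus a torsion submodule N can be
  enlarged as long as its quotient C contains a torsion submodule I.\<close>

lemma composite_kernel:
  assumes s1: "ses sm N n M g1 C" and s2: "ses sm I u C g2 C'"
  obtains N' v a b where "ses sm N' v M (g1 * g2) C'" "ses sm N a N' b I"
proof -
  note S1 = sesD[OF s1] and S2 = sesD[OF s2]
  note m = mono_mor[OF S1(1)] epi_mor[OF S1(2)] mono_mor[OF S2(1)] epi_mor[OF S2(2)]
  obtain N' v where s3: "ses sm N' v M (g1 * g2) C'"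
    by (rule kernel[OF epi_comp[OF S1(2) S2(2)]])
  note S3 = sesD[OF s3] and mv = mono_mor[OF sesD(1)[OF s3]]
  have "n * (g1 * g2) = (n * g1) * g2" by (rule comp_assoc[OF m(1,2,4), symmetric])
  then have "n * (g1 * g2) = nul N C'" unfolding S1(3) using m by simp
  then obtain a where a: "mor N N' a" "a * v = n" using ses_lift[OF s3 m(1)] by blast
  have "(v * g1) * g2 = nul N' C'" using S3(3) comp_assoc[OF mv m(2,4)] by simp
  then obtain b where b: "mor N' I b" "b * u = v * g1" using ses_lift[OF s2 mor_comp[OF mv m(2)]] by blast
  obtain t where t: "t \<in> carrier_mat (fst M) (fst N)" "n * t = ident N"
    using S1(1) by (auto simp: mono_def inj_map_def)
  have "a * (v * t) = ident N"
    using a(2) t mor_dims[OF a(1)] mor_dims[OF mv] by (simp add: mat_assoc[symmetric])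
  then have ma: "mono N N' a" using a t mor_dims[OF mv] by (intro monoI[of _ _ _ "v * t"]) auto
  have "(a * b) * u = (a * v) * g1"
    using comp_assoc[OF a(1) b(1) m(3)] comp_assoc[OF a(1) mv m(2)] b(2) by simp
  then have "(a * b) * u = nul N C" using S1(3) a(2) by simp
  then have ab: "a * b = nul N I" using mono_cancel_nul[OF S2(1) mor_comp[OF a(1) b(1)]] by simp
  obtain s' where s1': "s' \<in> carrier_mat (fst C) (fst M)" "s' * g1 = ident C"
    using S1(2) by (auto simp: epi_def surj_map_def)
  obtain s3' t3 where st3: "s3' \<in> carrier_mat (fst C') (fst M)" "t3 \<in> carrier_mat (fst M) (fst N')"
    "(g1 * g2) * s3' + t3 * v = ident M" by (rule ses_splitting[OF s3])
  have d: "dim_row s' = fst C" "dim_col s' = fst M" "dim_row s3' = fst C'" "dim_col s3' = fst M"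
      "dim_row t3 = fst M" "dim_col t3 = fst N'" "dim_row g1 = fst M" "dim_col g1 = fst C"
      "dim_row g2 = fst C" "dim_col g2 = fst C'" "dim_row u = fst I" "dim_col u = fst C"
      "dim_row v = fst N'" "dim_col v = fst M" "dim_row b = fst N'" "dim_col b = fst I"
    using s1' st3 mor_dims[OF m(2)] mor_dims[OF m(3)] mor_dims[OF m(4)] mor_dims[OF mv] mor_dims[OF b(1)] by auto
  \<comment> \<open>A linear lift of u through g1. It is killed by g1 * g2, hence lands in N' and
    yields a linear section of b.\<close>
  let ?w = "u * s'"
  have wg: "?w * g1 = u" using s1'(2) d by (simp add: mat_assoc)
  have "?w * (g1 * g2) = (?w * g1) * g2" using d by (simp add: mat_assoc)
  then have wgg: "?w * (g1 * g2) = nul I C'" unfolding wg S2(3) .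
  have "?w = ?w * ((g1 * g2) * s3' + t3 * v)" unfolding st3(3) using d by simp
  also have "\<dots> = (?w * (g1 * g2)) * s3' + ((?w * t3) * v)" using d by (simp add: mat_distr mat_assoc)
  finally have w: "(?w * t3) * v = ?w" unfolding wgg using d by simp
  have "((?w * t3) * b) * u = (?w * t3) * (b * u)" using d by (simp add: mat_assoc)
  also have "\<dots> = ((?w * t3) * v) * g1" unfolding b(2) using d by (simp add: mat_assoc)
  also have "\<dots> = ident I * u" unfolding w wg using d by simp
  finally have "(?w * t3) * b = ident I" by (rule mono_cancel[OF S2(1), rotated 2]) (use d in auto)
  then have "epi N' I b" using b(1) d by (intro epiI[of _ _ _ "?w * t3"]) auto
  moreover have "fst N' = fst N + fst I" using S1(4) S2(4) S3(4) by simp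
  ultimately have "ses sm N a N' b I" using ma ab by (intro sesI)
  with s3 show thesis by (rule that)
qed

text \<open>A block triangular action with off-diagonal entry c is multiplicative because c is a
  derivation with values in the linear maps X \<rightarrow> M. Direct sums and pushouts are both
  obtained from this.\<close>

lemma cocycle_extension:
  assumes M: "is_mod sm M" and X: "is_mod sm X"
    and c: "\<And>a. dim_row (c a) = fst X" "\<And>a. dim_col (c a) = fst M"
    and c_add: "\<And>a b. c (a + b) = c a + c b" and c_smult: "\<And>k a. c (sm k a) = k \<cdot>\<^sub>m c a"
    and c_mult: "\<And>a b. c (a * b) = c a * snd M b + snd X a * c b"
    and js: "j \<in> carrier_mat (fst M) n" "r \<in> carrier_mat n (fst M)" "\<sigma> \<in> carrier_mat (fst X) n" "q \<in> carrier_mat n (fst X)"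
    "j * r = ident M" "\<sigma> * q = ident X" "j * q = nul M X" "\<sigma> * r = nul X M" "q * \<sigma> + r * j = 1\<^sub>m n"
    and n: "n = fst M + fst X"
    and E: "E = (n, \<lambda>a. r * (snd M a * j) + (q * (snd X a * \<sigma>) + q * (c a * j)))"
  shows "ses sm M j E q X"
proof -
  have d: "dim_row j = fst M" "dim_col j = n" "dim_row r = n" "dim_col r = fst M"
    "dim_row \<sigma> = fst X" "dim_col \<sigma> = n" "dim_row q = n" "dim_col q = fst X"
    "\<And>a. dim_row (snd M a) = fst M" "\<And>a. dim_col (snd M a) = fst M"
    "\<And>a. dim_row (snd X a) = fst X" "\<And>a. dim_col (snd X a) = fst X"
    using js mod_dims[OF M] mod_dims[OF X] by auto
  have x: "dim_row x = fst M \<Longrightarrow> j * (r * x) = x" "dim_row y = fst X \<Longrightarrow> \<sigma> * (q * y) = y"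
     "dim_row y = fst X \<Longrightarrow> j * (q * y) = 0\<^sub>m (fst M) (dim_col y)" "dim_row x = fst M \<Longrightarrow> \<sigma> * (r * x) = 0\<^sub>m (fst X) (dim_col x)" for x y
    using js d by (simp_all add: mat_assoc[symmetric])
  \<comment> \<open>The derivation rule gives c 1 = c 1 + c 1, so 1 acts as the identity on the
    extension.\<close>
  have c1: "c 1 = nul X M"
  proof -
    have "c 1 = c 1 + c 1" using c_mult[of 1 1] c M X d by (simp add: is_mod_def)
    then have "c 1 - c 1 = (c 1 + c 1) - c 1" by simp
    also have "\<dots> = c 1" using c by (intro eq_matI) auto
    finally show ?thesis using c by simp
  qed
  let ?\<rho> = "\<lambda>a. r * (snd M a * j) + (q * (snd X a * \<sigma>) + q * (c a * j))"
  have mult: "?\<rho> (a * b) = ?\<rho> a * ?\<rho> b" for a b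
    using d c M X by (simp add: c_mult mat_distr mat_assoc is_mod_def x mat_add_ac)
  have "r * j + q * \<sigma> = 1\<^sub>m n" using js(9) d by (simp add: mat_add_ac)
  then have one: "?\<rho> 1 = 1\<^sub>m n" using d M X by (simp add: c1 is_mod_def)
  have add: "?\<rho> (a + b) = ?\<rho> a + ?\<rho> b" for a b
    using d c M X by (simp add: c_add mat_distr is_mod_def mat_add_ac)
  have sm: "?\<rho> (sm k a) = k \<cdot>\<^sub>m ?\<rho> a" for k a
  proof -
    have "k \<cdot>\<^sub>m (A + B) = k \<cdot>\<^sub>m A + k \<cdot>\<^sub>m B" if "dim_row A = dim_row B" "dim_col A = dim_col B" for A B :: "'k mat"
      using that by (intro eq_matI) (auto simp: algebra_simps)
    then show ?thesis using d c M X by (simp add: c_smult mat_smult is_mod_def)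
  qed
  have EM: "is_mod sm E" unfolding E is_mod_def fst_conv snd_conv using d c mult one add sm by (auto intro!: carrier_matI)
  have "mor M E j" unfolding E
    by (rule morI[OF M EM[unfolded E]]) (use d c in \<open>auto simp: mat_distr x mat_assoc\<close>)
  then have "mono M E j" by (rule monoI[OF _ js(5)]) (use d E in auto)
  moreover have "mor E X q" unfolding E
    by (rule morI[OF EM[unfolded E] X]) (use d c js in \<open>auto simp: mat_distr x mat_assoc\<close>)
  then have "epi E X q" by (rule epiI[OF _ js(6)]) (use d E in auto)
  ultimately show ?thesis by (rule sesI) (use js n E in auto)
qed

lemma direct_sum:
  assumes M: "is_mod sm M" and X: "is_mod sm X"
  obtains E j \<sigma> r q where "mor M E j" "mor E X q" "mor X E \<sigma>" "mor E M r"
    "j * r = ident M" "\<sigma> * q = ident X" "j * q = nul M X" "\<sigma> * r = nul X M" "q * \<sigma> + r * j = ident E"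
proof -
  obtain j \<sigma> r q :: "'k mat" where js: "j \<in> carrier_mat (fst M) (fst M + fst X)" "r \<in> carrier_mat (fst M + fst X) (fst M)"
     "\<sigma> \<in> carrier_mat (fst X) (fst M + fst X)" "q \<in> carrier_mat (fst M + fst X) (fst X)"
    "j * r = ident M" "\<sigma> * q = ident X" "j * q = nul M X" "\<sigma> * r = nul X M" "q * \<sigma> + r * j = 1\<^sub>m (fst M + fst X)"
    by (rule biproduct_matrices)
  define E where "E = (fst M + fst X, \<lambda>a. r * (snd M a * j) + (q * (snd X a * \<sigma>) + q * (nul X M * j)))"
  have "ses sm M j E q X"
    by (rule cocycle_extension[OF M X _ _ _ _ _ js refl E_def])
      (use mod_dims[OF M] mod_dims[OF X] in auto)
  note S = sesD[OF this]
  have d: "dim_row j = fst M" "dim_col j = fst M + fst X" "dim_row r = fst M + fst X" "dim_col r = fst M"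
    "dim_row \<sigma> = fst X" "dim_col \<sigma> = fst M + fst X" "dim_row q = fst M + fst X" "dim_col q = fst X"
    "\<And>a. dim_row (snd M a) = fst M" "\<And>a. dim_col (snd M a) = fst M"
    "\<And>a. dim_row (snd X a) = fst X" "\<And>a. dim_col (snd X a) = fst X"
    using js mod_dims[OF M] mod_dims[OF X] by auto
  have x: "dim_row x = fst M \<Longrightarrow> j * (r * x) = x" "dim_row y = fst X \<Longrightarrow> \<sigma> * (q * y) = y"
     "dim_row y = fst X \<Longrightarrow> j * (q * y) = 0\<^sub>m (fst M) (dim_col y)" "dim_row x = fst M \<Longrightarrow> \<sigma> * (r * x) = 0\<^sub>m (fst X) (dim_col x)" for x y
    using js d by (simp_all add: mat_assoc[symmetric])
  have EM: "is_mod sm E" using S mor_mod epi_mor by blast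
  have "mor X E \<sigma>" by (rule morI[OF X EM]) (use d in \<open>auto simp: E_def mat_distr x mat_assoc\<close>)
  moreover have "mor E M r" by (rule morI[OF EM M]) (use d js in \<open>auto simp: E_def mat_distr x mat_assoc\<close>)
  moreover have "q * \<sigma> + r * j = ident E" using js(9) by (simp add: E_def)
  ultimately show thesis using mono_mor[OF S(1)] epi_mor[OF S(2)] js(5-8) by (intro that)
qed

text \<open>A linear section s and retraction t measure the failure of the given sequence to split.
  Pushing this defect along h gives a derivation, and the pushout is the extension that it defines;
  no quotient has to be formed.\<close>

lemma pushout:
  assumes ses: "ses sm K i Q p X" and h: "mor K M h"
  obtains E j q k where "ses sm M j E q X" "mor Q E k" "i * k = h * j" "k * q = p"
proof -
  note S = sesD[OF ses]
  note mi = mono_mor[OF S(1)] and mp = epi_mor[OF S(2)]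
  note M = mor_mod(2)[OF h] and X = mor_mod(2)[OF mp]
  obtain s t where st: "s \<in> carrier_mat (fst X) (fst Q)" "t \<in> carrier_mat (fst Q) (fst K)"
    "s * p = ident X" "i * t = ident K" "p * s + t * i = ident Q" "s * t = nul X K" by (rule ses_splitting[OF ses])
  obtain j \<sigma> r q :: "'k mat" where js: "j \<in> carrier_mat (fst M) (fst M + fst X)" "r \<in> carrier_mat (fst M + fst X) (fst M)"
     "\<sigma> \<in> carrier_mat (fst X) (fst M + fst X)" "q \<in> carrier_mat (fst M + fst X) (fst X)"
    "j * r = ident M" "\<sigma> * q = ident X" "j * q = nul M X" "\<sigma> * r = nul X M" "q * \<sigma> + r * j = 1\<^sub>m (fst M + fst X)"
    by (rule biproduct_matrices)
  have d: "dim_row j = fst M" "dim_col j = fst M + fst X" "dim_row r = fst M + fst X" "dim_col r = fst M"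
    "dim_row \<sigma> = fst X" "dim_col \<sigma> = fst M + fst X" "dim_row q = fst M + fst X" "dim_col q = fst X"
    "dim_row s = fst X" "dim_col s = fst Q" "dim_row t = fst Q" "dim_col t = fst K"
    "dim_row i = fst K" "dim_col i = fst Q" "dim_row p = fst Q" "dim_col p = fst X" "dim_row h = fst K" "dim_col h = fst M"
    "\<And>a. dim_row (snd M a) = fst M" "\<And>a. dim_col (snd M a) = fst M"
    "\<And>a. dim_row (snd X a) = fst X" "\<And>a. dim_col (snd X a) = fst X"
    "\<And>a. dim_row (snd Q a) = fst Q" "\<And>a. dim_col (snd Q a) = fst Q"
    "\<And>a. dim_row (snd K a) = fst K" "\<And>a. dim_col (snd K a) = fst K"
    using js st mod_dims[OF M] mod_dims[OF X] mor_dims[OF mi] mor_dims[OF mp] mor_dims[OF h] by auto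
  have x: "dim_row x = fst M \<Longrightarrow> j * (r * x) = x" "dim_row y = fst X \<Longrightarrow> \<sigma> * (q * y) = y"
     "dim_row y = fst X \<Longrightarrow> j * (q * y) = 0\<^sub>m (fst M) (dim_col y)" "dim_row x = fst M \<Longrightarrow> \<sigma> * (r * x) = 0\<^sub>m (fst X) (dim_col x)" 
     "dim_row z = fst K \<Longrightarrow> i * (t * z) = z" "dim_row y = fst X \<Longrightarrow> s * (p * y) = y" for x y z
    using js st d by (simp_all add: mat_assoc[symmetric])
  define c where "c = (\<lambda>a. s * (snd Q a * (t * h)))"
  have Qm: "snd Q (a * b) = snd Q a * snd Q b" "snd Q (a + b) = snd Q a + snd Q b" "snd Q (sm l a) = l \<cdot>\<^sub>m snd Q a" for a b l
    using mor_mod(1)[OF mp] by (auto simp: is_mod_def)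
  have Qi: "snd Q a * y = p * (s * (snd Q a * y)) + t * (i * (snd Q a * y))" if "dim_row y = fst Q" for a y
  proof -
    have "snd Q a * y = (p * s + t * i) * (snd Q a * y)" unfolding st using d that by simp
    then show ?thesis using d that by (simp add: mat_distr mat_assoc)
  qed
  have iQ: "i * (snd Q a * y) = snd K a * (i * y)" if "dim_row y = fst Q" for a y
    using that d mor_eq[OF mi, of a] by (simp add: mat_assoc[symmetric])
  have Qp: "snd Q a * (p * y) = p * (snd X a * y)" if "dim_row y = fst X" for a y
    using that d mor_eq[OF mp, of a] by (simp add: mat_assoc[symmetric])
  have hM: "snd K a * (h * y) = h * (snd M a * y)" if "dim_row y = fst M" for a y
    using that d mor_eq[OF h, of a] by (simp add: mat_assoc[symmetric])
  have tQ: "snd Q a * (t * h) = p * c a + t * (h * snd M a)" for a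
    using Qi[of "t * h" a] d mor_eq[OF h, of a] by (simp add: c_def iQ x)
  have c_mult: "c (a * b) = c a * snd M b + snd X a * c b" for a b
  proof -
    have "c (a * b) = s * (snd Q a * (snd Q b * (t * h)))" unfolding c_def Qm using d by (simp add: mat_assoc)
    also have "\<dots> = s * (snd Q a * (p * c b)) + s * (snd Q a * (t * (h * snd M b)))"
      unfolding tQ using d by (simp add: mat_distr c_def)
    also have "s * (snd Q a * (p * c b)) = snd X a * c b" using d by (simp add: Qp x c_def)
    also have "s * (snd Q a * (t * (h * snd M b))) = c a * snd M b" using d by (simp add: c_def mat_assoc)
    finally show ?thesis using d by (simp add: mat_add_ac c_def)
  qed
  define E where "E = (fst M + fst X, \<lambda>a. r * (snd M a * j) + (q * (snd X a * \<sigma>) + q * (c a * j)))"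
  have sE: "ses sm M j E q X"
    by (rule cocycle_extension[OF M X _ _ _ _ c_mult js refl E_def])
      (use d in \<open>auto simp: c_def Qm mat_distr mat_smult\<close>)
  have EM: "is_mod sm E" using sesD[OF sE] mor_mod epi_mor by blast
  \<comment> \<open>In the linear decomposition of Q into K and X, this is h on K and the identity
    on X.\<close>
  define k where "k = t * (h * j) + p * \<sigma>"
  have "mor Q E k"
  proof (rule morI[OF mor_mod(1)[OF mp] EM])
    fix a
    have "snd Q a * k = (snd Q a * (t * h)) * j + snd Q a * (p * \<sigma>)" unfolding k_def using d by (simp add: mat_distr mat_assoc)
    also have "\<dots> = p * (c a * j) + (t * (h * (snd M a * j)) + p * (snd X a * \<sigma>))"
      unfolding tQ using d by (simp add: mat_distr mat_assoc Qp c_def mat_add_ac)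
    also have "\<dots> = k * snd E a" unfolding k_def E_def using d c_def
      by (simp add: mat_distr mat_assoc x mat_add_ac)
    finally show "snd Q a * k = k * snd E a" .
  qed (use d in \<open>auto simp: k_def E_def\<close>)
  moreover have "i * k = h * j"
  proof -
    have "i * (p * \<sigma>) = (i * p) * \<sigma>" using d by (simp add: mat_assoc)
    then show ?thesis unfolding k_def using S(3) d by (simp add: mat_distr x)
  qed
  moreover have "k * q = p" unfolding k_def using d js by (simp add: mat_distr mat_assoc)
  ultimately show thesis using sE that by blast
qed


section \<open>Torsion classes and brick labels\<close>

lemma mor_through_zero:
  assumes e: "mor M I e" and i: "mor I N i" and I: "fst I = 0"
  shows "e * i = nul M N"
  using mor_dims[OF e] mor_dims[OF i] I by (intro eq_matI) (auto simp: scalar_prod_def)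

lemma mor_zero_source: "mor M N f \<Longrightarrow> fst M = 0 \<Longrightarrow> f = nul M N"
  using mor_dims[of M N f] by (intro eq_matI) auto

lemma mor_zero_target: "mor M N f \<Longrightarrow> fst N = 0 \<Longrightarrow> f = nul M N"
  using mor_dims[of M N f] by (intro eq_matI) auto

lemma ident_nul: "ident M = nul M M \<Longrightarrow> fst M = 0"
proof (rule ccontr)
  assume "ident M = nul M M" "fst M \<noteq> 0"
  then have "ident M $$ (0,0) = nul M M $$ (0,0)" "0 < fst M" by auto
  then show False by simp
qed

lemma zero_module: "is_mod sm (0, \<lambda>a. 0\<^sub>m 0 0)"
  by (auto simp: is_mod_def intro!: eq_matI)

lemma epi_zero: "is_mod sm M \<Longrightarrow> is_mod sm N \<Longrightarrow> fst N = 0 \<Longrightarrow> epi M N (nul M N)"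
  by (rule epiI[OF mor_nul, of _ _ "nul N M"]) (auto intro!: eq_matI)

lemma ses_zero_ident:
  assumes "is_mod sm M"
  shows "ses sm (0, \<lambda>a. 0\<^sub>m 0 0) (nul (0, \<lambda>a. 0\<^sub>m 0 0) M) M (ident M) M"
proof (rule sesI)
  show "mono (0, \<lambda>a. 0\<^sub>m 0 0) M (nul (0, \<lambda>a. 0\<^sub>m 0 0) M)"
    by (rule monoI[of _ _ _ "0\<^sub>m (fst M) 0"]) (use mor_nul[OF zero_module assms] in \<open>auto intro!: eq_matI\<close>)
  show "epi M M (ident M)"
    by (rule epiI[of _ _ _ "ident M"]) (use mor_id[OF assms] in auto)
qed auto

lemma mono_epi: "mono M N f \<Longrightarrow> fst N \<le> fst M \<Longrightarrow> epi M N f"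
  by (rule mono_iso[of M N f]) (auto intro!: epiI mono_mor dest: mor_dims)

section \<open>Torsion classes, perpendicular classes and the torsion radical\<close>

lemma tc_mod: "torsion_class sm T \<Longrightarrow> M \<in> T \<Longrightarrow> is_mod sm M"
  by (auto simp: torsion_class_def)

lemma tc_quot: "torsion_class sm T \<Longrightarrow> M \<in> T \<Longrightarrow> epi M N g \<Longrightarrow> N \<in> T"
  unfolding torsion_class_def epi_def mor_def by blast

lemma tc_ext: "torsion_class sm T \<Longrightarrow> ses sm Y f E g X \<Longrightarrow> Y \<in> T \<Longrightarrow> X \<in> T \<Longrightarrow> E \<in> T"
  unfolding torsion_class_def by blast

lemma tc_zero: "torsion_class sm T \<Longrightarrow> is_mod sm M \<Longrightarrow> fst M = 0 \<Longrightarrow> M \<in> T"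
  using tc_quot[OF _ _ epi_zero] tc_mod unfolding torsion_class_def by blast

lemma tcI:
  assumes "\<And>M. M \<in> T \<Longrightarrow> is_mod sm M" "\<And>M. is_mod sm M \<Longrightarrow> fst M = 0 \<Longrightarrow> M \<in> T"
    "\<And>M N g. M \<in> T \<Longrightarrow> epi M N g \<Longrightarrow> N \<in> T"
    "\<And>Y f E g X. ses sm Y f E g X \<Longrightarrow> Y \<in> T \<Longrightarrow> X \<in> T \<Longrightarrow> E \<in> T"
  shows "torsion_class sm T"
  unfolding torsion_class_def
proof (intro conjI allI impI)
  show "T \<noteq> {}" using assms(2)[OF zero_module] by auto
  show "N \<in> T" if "M \<in> T \<and> is_mod sm N \<and> is_hom M N g \<and> surj_map (fst M) (fst N) g" for M N g
    using that assms(1) by (intro assms(3)[of M N g]) (auto simp: epi_def mor_def)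
  show "T \<subseteq> Md" using assms(1) by auto
  show "E \<in> T" if "ses sm Y f E g X \<and> Y \<in> T \<and> X \<in> T" for Y f E g X using assms(4) that by blast
qed

lemma tc_Int: "torsion_class sm T \<Longrightarrow> torsion_class sm U \<Longrightarrow> torsion_class sm (T \<inter> U)"
  by (rule tcI) (auto intro: tc_mod tc_zero tc_quot tc_ext)

lemma perp_iff: "T \<subseteq> Md \<Longrightarrow> M \<in> perp sm T \<longleftrightarrow> is_mod sm M \<and> (\<forall>N\<in>T. \<forall>f. mor N M f \<longrightarrow> f = nul N M)"
  unfolding perp_def mor_def by blast

lemma perp_mod: "M \<in> perp sm T \<Longrightarrow> is_mod sm M"
  by (auto simp: perp_def)

lemma perpD: "M \<in> perp sm T \<Longrightarrow> N \<in> T \<Longrightarrow> mor N M f \<Longrightarrow> f = nul N M"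
  unfolding perp_def mor_def by blast

lemma perpI: "is_mod sm M \<Longrightarrow> (\<And>N f. N \<in> T \<Longrightarrow> mor N M f \<Longrightarrow> f = nul N M) \<Longrightarrow> torsion_class sm T \<Longrightarrow> M \<in> perp sm T"
  using tc_mod by (subst perp_iff) auto

lemma perp_mono: "S \<subseteq> T \<Longrightarrow> perp sm T \<subseteq> perp sm S"
  by (auto simp: perp_def)

lemma perp_sub:
  assumes "N \<in> perp sm T" "torsion_class sm T" "mono M N i" shows "M \<in> perp sm T"
proof (rule perpI)
  fix L f assume "L \<in> T" "mor L M f"
  then have "f * i = nul L N" using assms perpD mor_comp mono_mor by blast
  then show "f = nul L M" using assms(3) \<open>mor L M f\<close> mono_cancel_nul by blast
qed (use assms mono_mor mor_mod in blast)+

lemma perp_zero: "M \<in> T \<Longrightarrow> M \<in> perp sm T \<Longrightarrow> fst M = 0"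
  using perpD[of M T M "ident M"] mor_id[OF perp_mod] ident_nul by blast

text \<open>Take the quotient of M by a submodule in T that has the smallest dimension. A nonzero
  image I of an object of T in it could be absorbed by \<open>composite_kernel\<close>, which would
  leave a smaller quotient.\<close>

lemma torsion_radical:
  assumes T: "torsion_class sm T" and M: "is_mod sm M"
  obtains N n C g where "ses sm N n M g C" "N \<in> T" "C \<in> perp sm T"
proof -
  let ?P = "\<lambda>C. \<exists>N n g. ses sm N n M g C \<and> N \<in> T"
  have "?P M" using ses_zero_ident[OF M] tc_zero[OF T zero_module] by force
  then obtain C where C: "?P C" and min: "\<And>D. ?P D \<Longrightarrow> fst C \<le> fst D"
    using ex_has_least_nat[of ?P M fst] by blast
  then obtain N n g where s: "ses sm N n M g C" "N \<in> T" by blast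
  have "C \<in> perp sm T"
  proof (rule perpI[OF _ _ T])
    show "is_mod sm C" using s(1) by (simp add: ses_def)
    fix L f assume L: "L \<in> T" and f: "mor L C f"
    obtain I e i where ei: "epi L I e" "mono I C i" "f = e * i" by (rule image[OF f])
    have I: "I \<in> T" using tc_quot[OF T L ei(1)] .
    obtain C' g2 where s2: "ses sm I i C g2 C'" by (rule cokernel[OF ei(2)])
    obtain N' v a b where s3: "ses sm N' v M (g * g2) C'" "ses sm N a N' b I"
      by (rule composite_kernel[OF s(1) s2])
    have "N' \<in> T" using tc_ext[OF T s3(2) s(2) I] .
    then have "fst C \<le> fst C'" using s3(1) by (intro min) blast
    then have "fst I = 0" using sesD(4)[OF s2] by simp
    then show "f = nul L C" unfolding ei(3) using ei by (intro mor_through_zero) (auto intro: epi_mor mono_mor)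
  qed
  with s show thesis by (rule that)
qed

text \<open>Having no nonzero map to N passes to quotients and extensions. When N is perpendicular
  to T1, this class lies between T1 and T, so a cover relation decides what it is.\<close>

lemma tc_left_orth:
  assumes T: "torsion_class sm T"
  shows "torsion_class sm {V \<in> T. \<forall>f. mor V N f \<longrightarrow> f = nul V N}"
proof (rule tcI)
  fix M M' g assume M: "M \<in> {V \<in> T. \<forall>f. mor V N f \<longrightarrow> f = nul V N}" and g: "epi M M' g"
  have "f = nul M' N" if f: "mor M' N f" for f
    using M mor_comp[OF epi_mor[OF g] f] by (intro epi_cancel_nul[OF g f]) auto
  then show "M' \<in> {V \<in> T. \<forall>f. mor V N f \<longrightarrow> f = nul V N}" using tc_quot[OF T _ g] M by auto
next
  fix Y f E g X assume s: "ses sm Y f E g X" and Y: "Y \<in> {V \<in> T. \<forall>f. mor V N f \<longrightarrow> f = nul V N}"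
    and X: "X \<in> {V \<in> T. \<forall>f. mor V N f \<longrightarrow> f = nul V N}"
  note S = sesD[OF s]
  have "h = nul E N" if h: "mor E N h" for h
  proof -
    have "f * h = nul Y N" using Y mor_comp[OF mono_mor[OF S(1)] h] by auto
    then obtain h' where h': "mor X N h'" "g * h' = h" by (rule ses_desc[OF s h])
    then have "h' = nul X N" using X by auto
    then show ?thesis using comp_nul(2)[OF epi_mor[OF S(2)], of N] unfolding h'(2)[symmetric] by simp
  qed
  then show "E \<in> {V \<in> T. \<forall>f. mor V N f \<longrightarrow> f = nul V N}" using tc_ext[OF T s] X Y by auto
next
  show "M \<in> {V \<in> T. \<forall>f. mor V N f \<longrightarrow> f = nul V N}" if "is_mod sm M" "fst M = 0" for M
    using tc_zero[OF T that] mor_zero_source that by blast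
qed (use tc_mod[OF T] in blast)

lemma coverD: "tors_cover sm T1 T \<Longrightarrow> torsion_class sm T1" "tors_cover sm T1 T \<Longrightarrow> torsion_class sm T"
    "tors_cover sm T1 T \<Longrightarrow> T1 \<subseteq> T" "tors_cover sm T1 T \<Longrightarrow> T1 \<noteq> T"
  by (auto simp: tors_cover_def)

lemma cover_eq: "tors_cover sm T1 T \<Longrightarrow> torsion_class sm U \<Longrightarrow> T1 \<subseteq> U \<Longrightarrow> U \<subseteq> T \<Longrightarrow> U = T1 \<or> U = T"
  unfolding tors_cover_def by blast

text \<open>The modules of T without nonzero maps to N form a torsion class between T1 and T. If it
  contained M it would be all of T, and then it would contain N despite the identity of N.\<close>

lemma cover_hom:
  assumes cov: "tors_cover sm T1 T" and M: "M \<in> T" "M \<notin> T1" and N: "N \<in> T" "N \<in> perp sm T1" "fst N \<noteq> 0"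
  obtains f where "mor M N f" "f \<noteq> nul M N"
proof (rule ccontr)
  assume no: "\<not> thesis"
  let ?U = "{V \<in> T. \<forall>f. mor V N f \<longrightarrow> f = nul V N}"
  have "torsion_class sm ?U" by (rule tc_left_orth[OF coverD(2)[OF cov]])
  moreover have "T1 \<subseteq> ?U" using coverD(3)[OF cov] perpD[OF N(2)] by auto
  moreover have "M \<in> ?U" using no that M by blast
  ultimately have "?U = T" using cover_eq[OF cov] M(2) by blast
  then have "N \<in> ?U" using N(1) by simp
  then have "ident N = nul N N" using mor_id[OF perp_mod[OF N(2)]] by blast
  then show False using ident_nul[of N] N(3) by simp
qed

section \<open>Brick labels of lower covers\<close>

definition is_label :: "('a,'k) rmod set \<Rightarrow> ('a,'k) rmod set \<Rightarrow> ('a,'k) rmod \<Rightarrow> bool" where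
  "is_label T1 T X \<longleftrightarrow> tors_cover sm T1 T \<and> brick sm X \<and> X \<in> T \<inter> perp sm T1"

lemma labelD:
  assumes "is_label T1 T X"
  shows "tors_cover sm T1 T" "torsion_class sm T1" "torsion_class sm T" "brick sm X" "is_mod sm X" "fst X \<noteq> 0"
    "X \<in> T" "X \<in> perp sm T1" "X \<notin> T1"
  using assms coverD perp_zero[of X T1] by (auto simp: is_label_def brick_def)

lemma brick_inverse:
  assumes "brick sm X" "mor X X f" "f \<noteq> nul X X"
  obtains g where "mor X X g" "f * g = ident X" "g * f = ident X"
  using assms unfolding brick_def mor_def by blast

text \<open>Choose a nonzero module of least dimension in T and perpendicular to T1. The image of a
  nonzero endomorphism is another such module, hence everything, so the endomorphism is
  invertible.\<close>

lemma label_exists: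
  assumes cov: "tors_cover sm T1 T"
  obtains X where "is_label T1 T X"
proof -
  note C = coverD[OF cov]
  obtain M where M: "M \<in> T" "M \<notin> T1" using C(3,4) by blast
  obtain N n Q g where s: "ses sm N n M g Q" "N \<in> T1" "Q \<in> perp sm T1" 
    by (rule torsion_radical[OF C(1) tc_mod[OF C(2) M(1)]])
  let ?P = "\<lambda>X. X \<in> T \<and> X \<in> perp sm T1 \<and> fst X \<noteq> 0"
  have "fst Q \<noteq> 0" using tc_ext[OF C(1) s(1,2)] tc_zero[OF C(1) perp_mod[OF s(3)]] M(2) by blast
  then have "?P Q" using tc_quot[OF C(2) M(1) sesD(2)[OF s(1)]] s(3) by simp
  then obtain X where X: "?P X" and min: "\<And>Y. ?P Y \<Longrightarrow> fst X \<le> fst Y"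
    using ex_has_least_nat[of ?P Q fst] by blast
  have "brick sm X" unfolding brick_def
  proof (intro conjI allI impI)
    show Xm: "is_mod sm X" using X perp_mod by blast
    fix f assume "is_hom X X f \<and> f \<noteq> nul X X"
    then have f: "mor X X f" "f \<noteq> nul X X" using Xm by (auto simp: mor_def)
    obtain I e i where ei: "epi X I e" "mono I X i" "f = e * i" by (rule image[OF f(1)])
    have "fst I \<noteq> 0" using f(2) ei mor_through_zero epi_mor mono_mor by blast
    then have "?P I" using tc_quot[OF C(2) _ ei(1)] perp_sub[OF _ C(1) ei(2)] X by auto
    then have le: "fst X \<le> fst I" by (rule min)
    obtain e' where e': "mor I X e'" "e * e' = ident X" "e' * e = ident I" by (rule epi_iso[OF ei(1) le])
    obtain i' where i': "mor X I i'" "i * i' = ident I" "i' * i = ident X" by (rule mono_iso[OF ei(2) le])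
    note d = mor_dims[OF epi_mor[OF ei(1)]] mor_dims[OF mono_mor[OF ei(2)]] mor_dims[OF e'(1)] mor_dims[OF i'(1)]
    have "f * (i' * e') = e * ((i * i') * e')" using d ei(3) by (simp add: mat_assoc)
    moreover have "(i' * e') * f = i' * ((e' * e) * i)" using d ei(3) by (simp add: mat_assoc)
    ultimately have "f * (i' * e') = ident X" "(i' * e') * f = ident X"
      unfolding e'(3) i'(2) using d e' i' by auto
    then show "\<exists>g. is_hom X X g \<and> f * g = ident X \<and> g * f = ident X"
      using mor_comp[OF i'(1) e'(1)] by (auto simp: mor_def)
  qed (use X in auto)
  then have "is_label T1 T X" using X cov by (auto simp: is_label_def)
  then show thesis by (rule that)
qed

text \<open>\<open>is_label\<close> asks only for a brick, so minimality has to be recovered. For a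
  smallest competitor Z there are nonzero maps X \<rightarrow> Z \<rightarrow> X by
  \<open>cover_hom\<close>. The first is onto by minimality of Z, so the composite is nonzero, hence
  invertible on the brick X, and X embeds in Z.\<close>

lemma label_dim_le:
  assumes X: "is_label T1 T X" and N: "N \<in> T" "N \<in> perp sm T1" "fst N \<noteq> 0"
  shows "fst X \<le> fst N"
proof -
  note L = labelD[OF X]
  let ?P = "\<lambda>X. X \<in> T \<and> X \<in> perp sm T1 \<and> fst X \<noteq> 0"
  obtain Z where Z: "?P Z" and min: "\<And>Y. ?P Y \<Longrightarrow> fst Z \<le> fst Y"
    using ex_has_least_nat[of ?P N fst] N by blast
  have "Z \<notin> T1" using Z perp_zero[of Z T1] by auto
  obtain f where f: "mor X Z f" "f \<noteq> nul X Z" using cover_hom[OF L(1,7,9), of Z] Z by blast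
  obtain g where g: "mor Z X g" "g \<noteq> nul Z X" using cover_hom[OF L(1) _ \<open>Z \<notin> T1\<close> L(7,8,6)] Z by blast
  obtain I e i where ei: "epi X I e" "mono I Z i" "f = e * i" by (rule image[OF f(1)])
  have "fst I \<noteq> 0" using f(2) ei mor_through_zero epi_mor mono_mor by blast
  then have "?P I" using tc_quot[OF L(3,7) ei(1)] perp_sub[OF _ L(2) ei(2)] Z by auto
  then have "epi X Z f" unfolding ei(3) using epi_comp[OF ei(1) mono_epi[OF ei(2) min]] by blast
  then have "f * g \<noteq> nul X X" using epi_cancel_nul g by blast
  then obtain h where h: "mor X X h" "(f * g) * h = ident X" using brick_inverse[OF L(4) mor_comp[OF f(1) g(1)]] by blast
  then have "f * (g * h) = ident X" using comp_assoc[OF f(1) g(1) h(1)] by simp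
  then have "mono X Z f" using f(1) mor_dims[OF mor_comp[OF g(1) h(1)]] by (intro monoI) auto
  then have "fst X \<le> fst Z" by (rule mono_le)
  also have "\<dots> \<le> fst N" using min N by blast
  finally show ?thesis .
qed

text \<open>The image of f is a nonzero module of T perpendicular to T1, so by minimality of the
  dimension of a label it fills X.\<close>

lemma label_epi:
  assumes X: "is_label T1 T X" and N: "N \<in> T" and f: "mor N X f" "f \<noteq> nul N X"
  shows "epi N X f"
proof -
  note L = labelD[OF X]
  obtain I e i where ei: "epi N I e" "mono I X i" "f = e * i" by (rule image[OF f(1)])
  have "fst I \<noteq> 0" using f(2) ei mor_through_zero epi_mor mono_mor by blast
  then have "fst X \<le> fst I"
    using tc_quot[OF L(3) N ei(1)] perp_sub[OF L(8,2) ei(2)] by (intro label_dim_le[OF X])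
  then show ?thesis unfolding ei(3) using epi_comp[OF ei(1) mono_epi[OF ei(2)]] by blast
qed

text \<open>
If the kernel of p contains no nonzero image of an object of T, then a nonzero image I of an object
of T in E lies in T and in the perpendicular class of T1, so X maps nontrivially to I, and the composite X to E to X is
an automorphism of the brick X.
\<close>
lemma label_split:
  assumes X: "is_label T1 T X" and p: "mor E X p"
    and ker: "\<And>V f. V \<in> T \<Longrightarrow> mor V E f \<Longrightarrow> f * p = nul V X \<Longrightarrow> f = nul V E"
    and E: "E \<notin> perp sm T"
  obtains s where "mor X E s" "s * p = ident X"
proof -
  note L = labelD[OF X]
  obtain V f where V: "V \<in> T" and f: "mor V E f" "f \<noteq> nul V E" 
    using E perpI[OF mor_mod(1)[OF p] _ L(3)] by blast
  obtain I e i where ei: "epi V I e" "mono I E i" "f = e * i" by (rule image[OF f(1)])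
  note mi = mono_mor[OF ei(2)]
  have I0: "fst I \<noteq> 0" using f(2) ei mor_through_zero epi_mor mono_mor by blast
  have I: "I \<in> T" using tc_quot[OF L(3) V ei(1)] .
  have "I \<in> perp sm T1"
  proof (rule perpI[OF mor_mod(1)[OF mi] _ L(2)])
    fix W g assume W: "W \<in> T1" and g: "mor W I g"
    have "(g * i) * p = nul W X" using perpD[OF L(8) W] mor_comp[OF mor_comp[OF g mi] p] by blast
    then have "g * i = nul W E" using ker mor_comp[OF g mi] W coverD(3)[OF L(1)] by blast
    then show "g = nul W I" using mono_cancel_nul[OF ei(2) g] by blast
  qed
  then obtain h where h: "mor X I h" "h \<noteq> nul X I" using cover_hom[OF L(1,7,9) I _ I0] by blast
  have hi: "h * i \<noteq> nul X E" using mono_cancel_nul[OF ei(2) h(1)] h(2) by blast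
  note mhi = mor_comp[OF h(1) mi]
  have "(h * i) * p \<noteq> nul X X" using ker[OF L(7) mhi] hi by blast
  then obtain k where k: "mor X X k" "k * ((h * i) * p) = ident X"
    using brick_inverse[OF L(4) mor_comp[OF mhi p]] by blast
  show thesis
    using k comp_assoc[OF k(1) mhi p] by (intro that[OF mor_comp[OF k(1) mhi]]) auto
qed

text \<open>By \<open>label_epi\<close>, f is onto, and so is every nonzero map from T to X, which
  therefore cannot land in the kernel of f. Hence \<open>label_split\<close> gives a section s, and
  f * s is an automorphism of the brick X, which makes f injective.\<close>

lemma label_hom_iso:
  assumes X: "is_label T1 T X" and Y: "is_label T2 T Y" and f: "mor X Y f" "f \<noteq> nul X Y"
  obtains g where "mor Y X g" "f * g = ident X" "g * f = ident Y"
proof -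
  note L = labelD[OF X] and L' = labelD[OF Y]
  have epi: "epi X Y f" by (rule label_epi[OF Y L(7) f])
  have "X \<notin> perp sm T" using perp_zero[OF L(7)] L(6) by auto
  moreover have "g = nul V X" if "V \<in> T" "mor V X g" "g * f = nul V Y" for V g
    using label_epi[OF X that(1,2)] epi_cancel_nul[OF _ f(1) that(3)] f(2) by blast
  ultimately obtain s where s: "mor Y X s" "s * f = ident Y" using label_split[OF Y f(1)] by blast
  have "f * s \<noteq> nul X X"
  proof
    assume "f * s = nul X X"
    then have "f * (s * f) = nul X Y" using comp_assoc[OF f(1) s(1) f(1)] f by simp
    then show False using f s by simp
  qed
  then obtain k where k: "mor X X k" "(f * s) * k = ident X"
    using brick_inverse[OF L(4) mor_comp[OF f(1) s(1)]] by blast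
  have "f * (s * k) = ident X" using k comp_assoc[OF f(1) s(1) k(1)] by simp
  then have "mono X Y f" using f(1) mor_dims[OF mor_comp[OF s(1) k(1)]] by (intro monoI) auto
  then show thesis using epi_iso[OF epi mono_le] that by blast
qed

lemma below_cover:
  assumes fin: "tau_tilting_finite sm" and T: "torsion_class sm T" and U: "torsion_class sm U" "U \<subset> T"
  obtains T1 where "tors_cover sm T1 T" "U \<subseteq> T1"
proof -
  let ?A = "{S. torsion_class sm S \<and> S \<subset> T}"
  have "finite ?A" using fin unfolding tau_tilting_finite_def by (rule rev_finite_subset) auto
  then obtain T1 where "T1 \<in> ?A" "U \<subseteq> T1" "\<forall>S\<in>?A. T1 \<subseteq> S \<longrightarrow> T1 = S"
    using finite_has_maximal2[of ?A U] U by blast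
  then show thesis using T by (intro that[of T1]) (auto simp: tors_cover_def)
qed

text \<open>Otherwise the intersection of T and U is proper in T, so by finiteness it lies in a
  lower cover T1, and the label of T1 in U would belong to T1. This reduces membership of T in a
  torsion class to one label per lower cover.\<close>

lemma labels_generate:
  assumes fin: "tau_tilting_finite sm" and T: "torsion_class sm T" and U: "torsion_class sm U"
    and lab: "\<And>T1. tors_cover sm T1 T \<Longrightarrow> \<exists>X\<in>U. is_label T1 T X"
  shows "T \<subseteq> U"
proof (rule ccontr)
  assume "\<not> T \<subseteq> U"
  then have "T \<inter> U \<subset> T" by blast
  then obtain T1 where T1: "tors_cover sm T1 T" "T \<inter> U \<subseteq> T1" by (rule below_cover[OF fin T tc_Int[OF T U]])
  obtain X where "X \<in> U" "is_label T1 T X" using lab[OF T1(1)] by blast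
  then show False using labelD[of T1 T X] T1(2) by blast
qed

lemma pop_downD: "M \<in> pop_down sm T \<Longrightarrow> tors_cover sm T1 T \<Longrightarrow> M \<in> T1"
  by (auto simp: pop_down_def)


section \<open>Ext and projective resolutions\<close>

text \<open>The idempotent 1 - g * s is killed by g, so it factors through f; the factor is the
  retraction.\<close>

lemma section_retraction:
  assumes ses: "ses sm Y f E g X" and s: "mor X E s" "s * g = ident X"
  obtains r where "mor E Y r" "f * r = ident Y"
proof -
  note S = sesD[OF ses]
  note mf = mono_mor[OF S(1)] and mg = epi_mor[OF S(2)]
  note d = mor_dims[OF mf] mor_dims[OF mg] mor_dims[OF s(1)]
  let ?e = "ident E - g * s"
  have e: "mor E E ?e" using mor_diff[OF mor_id mor_comp[OF mg s(1)]] mor_mod[OF mf] by simp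
  have "?e * g = g - g * (s * g)" using d by (simp add: mat_distr mat_assoc)
  then have "?e * g = nul E X" unfolding s(2) using d by simp
  then obtain r where r: "mor E Y r" "r * f = ?e" by (rule ses_lift[OF ses e])
  have "(f * r) * f = f * ?e" unfolding r(2)[symmetric] using d mor_dims[OF r(1)] by (simp add: mat_assoc)
  also have "\<dots> = f - (f * g) * s" using d by (simp add: mat_distr mat_assoc)
  also have "\<dots> = ident Y * f" unfolding S(3) using d by simp
  finally have "f * r = ident Y" by (rule mono_cancel[OF S(1), rotated 2]) (use mor_dims[OF r(1)] in auto)
  with r(1) show thesis by (rule that)
qed

lemma retraction_section:
  assumes ses: "ses sm Y f E g X" and r: "mor E Y r" "f * r = ident Y"
  obtains s where "mor X E s" "s * g = ident X"
proof -
  note S = sesD[OF ses]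
  note mf = mono_mor[OF S(1)] and mg = epi_mor[OF S(2)]
  note d = mor_dims[OF mf] mor_dims[OF mg] mor_dims[OF r(1)]
  let ?e = "ident E - r * f"
  have e: "mor E E ?e" using mor_diff[OF mor_id mor_comp[OF r(1) mf]] mor_mod[OF mf] by simp
  have "f * ?e = f - (f * r) * f" using d by (simp add: mat_distr mat_assoc)
  then have "f * ?e = nul Y E" unfolding r(2) using d by simp
  then obtain s where s: "mor X E s" "g * s = ?e" by (rule ses_desc[OF ses e])
  have "g * (s * g) = ?e * g" unfolding s(2)[symmetric] using d mor_dims[OF s(1)] by (simp add: mat_assoc)
  also have "\<dots> = g - r * (f * g)" using d by (simp add: mat_distr mat_assoc)
  also have "\<dots> = g * ident X" unfolding S(3) using d by simp
  finally have "s * g = ident X" by (rule epi_cancel[OF S(2), rotated 2]) (use mor_dims[OF s(1)] in auto)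
  with s(1) show thesis by (rule that)
qed

lemma projective_lift:
  assumes "projective sm P" "epi M N g" "mor P N h"
  obtains k where "mor P M k" "k * g = h"
  using assms unfolding projective_def epi_def mor_def by meson

lemma ext1_zeroD:
  assumes "ext1_zero sm X Y" "ses sm Y f E g X"
  obtains s where "mor X E s" "s * g = ident X"
  using assms unfolding ext1_zero_def ses_def mor_def by meson

text \<open>Exactness of Hom(E, M) \<rightarrow> Hom(Y, M) \<rightarrow> Ext(X, M): the pushout
  along h splits, and the map from E to it followed by a retraction extends h.\<close>

lemma ext1_zero_extend:
  assumes ext: "ext1_zero sm X M" and ses: "ses sm Y f E g X" and h: "mor Y M h"
  obtains h' where "mor E M h'" "f * h' = h"
proof -
  obtain E2 j q k where po: "ses sm M j E2 q X" "mor E E2 k" "f * k = h * j" "k * q = g"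
    by (rule pushout[OF ses h])
  obtain s where s: "mor X E2 s" "s * q = ident X" by (rule ext1_zeroD[OF ext po(1)])
  obtain r where r: "mor E2 M r" "j * r = ident M" by (rule section_retraction[OF po(1) s])
  note d = mor_dims[OF mono_mor[OF sesD(1)[OF ses]]] mor_dims[OF h] mor_dims[OF r(1)] mor_dims[OF po(2)]
    mor_dims[OF mono_mor[OF sesD(1)[OF po(1)]]]
  have "f * (k * r) = (f * k) * r" using d by (simp add: mat_assoc)
  also have "\<dots> = h * (j * r)" unfolding po(3) using d by (simp add: mat_assoc)
  finally have "f * (k * r) = h" using r d by simp
  then show thesis using mor_comp[OF po(2) r(1)] that by blast
qed

text \<open>For projective Q, Ext(X, M) is the cokernel of Hom(Q, M) \<rightarrow> Hom(K, M); this
  criterion stands in for the long exact sequence.\<close>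

lemma ext1_zero_iff:
  assumes ses: "ses sm K i Q p X" and Q: "projective sm Q" and M: "is_mod sm M"
  shows "ext1_zero sm X M \<longleftrightarrow> (\<forall>h. mor K M h \<longrightarrow> (\<exists>g. mor Q M g \<and> i * g = h))"
proof
  assume "ext1_zero sm X M"
  then show "\<forall>h. mor K M h \<longrightarrow> (\<exists>g. mor Q M g \<and> i * g = h)"
    using ext1_zero_extend[OF _ ses] by blast
next
  assume ex: "\<forall>h. mor K M h \<longrightarrow> (\<exists>g. mor Q M g \<and> i * g = h)"
  note S = sesD[OF ses]
  note mi = mono_mor[OF S(1)] and mp = epi_mor[OF S(2)]
  show "ext1_zero sm X M" unfolding ext1_zero_def
  proof (intro allI impI)
    fix f E g assume s2: "ses sm M f E g X"
    note S2 = sesD[OF s2]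
    note mf = mono_mor[OF S2(1)] and mg = epi_mor[OF S2(2)]
    obtain k where k: "mor Q E k" "k * g = p" by (rule projective_lift[OF Q S2(2) mp])
    note d = mor_dims[OF mi] mor_dims[OF mp] mor_dims[OF mf] mor_dims[OF mg] mor_dims[OF k(1)]
    have "(i * k) * g = i * (k * g)" using d by (simp add: mat_assoc)
    then have "(i * k) * g = nul K X" unfolding k(2) S(3) .
    then obtain h where h: "mor K M h" "h * f = i * k" by (rule ses_lift[OF s2 mor_comp[OF mi k(1)]])
    obtain g' where g': "mor Q M g'" "i * g' = h" using ex h(1) by blast
    \<comment> \<open>k lifts p and restricts to h * f on K. Subtracting the extension g' of h makes
      it vanish on K, so it descends to a section of g.\<close>
    let ?d = "k - g' * f"
    note d = d mor_dims[OF h(1)] mor_dims[OF g'(1)]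
    have md: "mor Q E ?d" using mor_diff[OF k(1) mor_comp[OF g'(1) mf]] .
    have "i * ?d = i * k - (i * g') * f" using d by (simp add: mat_distr mat_assoc)
    then have "i * ?d = nul K E" unfolding g'(2) h(2) using d by simp
    then obtain s where s: "mor X E s" "p * s = ?d" by (rule ses_desc[OF ses md])
    have "p * (s * g) = ?d * g" unfolding s(2)[symmetric] using d mor_dims[OF s(1)] by (simp add: mat_assoc)
    also have "\<dots> = k * g - g' * (f * g)" using d by (simp add: mat_distr mat_assoc)
    also have "\<dots> = p * ident X" unfolding k(2) S2(3) using d by simp
    finally have "s * g = ident X" by (rule epi_cancel[OF S(2), rotated 2]) (use mor_dims[OF s(1)] d in auto)
    then show "\<exists>s. is_hom X E s \<and> s * g = ident X" using s(1) by (auto simp: mor_def)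
  qed
qed

end

text \<open>Finite dimension of the algebra enters here through \<open>enough_projectives\<close>.
  The locale is instantiated twice, for the algebra and for its opposite.\<close>

locale hereditary_category = module_category sm for sm :: "'k::field \<Rightarrow> 'a::ring_1 \<Rightarrow> 'a" +
  assumes enough_projectives: "is_mod sm X \<Longrightarrow> \<exists>P p. projective sm P \<and> epi P X p"
    and hered: "hereditary sm"
    and tors_finite: "tau_tilting_finite sm"
begin

lemma resolution:
  assumes "is_mod sm X"
  obtains K i Q p where "ses sm K i Q p X" "projective sm Q" "projective sm K"
proof -
  obtain Q p where Q: "projective sm Q" "epi Q X p" using enough_projectives[OF assms] by blast
  obtain K i where K: "ses sm K i Q p X" by (rule kernel[OF Q(2)])
  have "projective sm K" using hered Q(1) sesD(1)[OF K]
    unfolding hereditary_def mono_def mor_def by blast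
  with K Q(1) show thesis by (rule that)
qed

lemma tc_ext1_zero:
  assumes X: "is_mod sm X"
  shows "torsion_class sm {M. is_mod sm M \<and> ext1_zero sm X M}" (is "torsion_class sm ?T")
proof -
  obtain K i Q p where ses: "ses sm K i Q p X" and Q: "projective sm Q" and K: "projective sm K"
    by (rule resolution[OF X])
  note mi = mono_mor[OF sesD(1)[OF ses]]
  note iff = ext1_zero_iff[OF ses Q]
  show ?thesis
  proof (rule tcI)
    fix M :: "('a,'k) rmod" assume M: "is_mod sm M" "fst M = 0"
    have "mor Q M (nul Q M) \<and> i * nul Q M = h" if "mor K M h" for h
      using mor_nul[OF mor_mod(2)[OF mi] M(1)] mor_zero_target[OF that M(2)] mor_dims[OF mi] by simp
    then show "M \<in> ?T" using iff[OF M(1)] M(1) by blast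
  next
    fix M N g assume M: "M \<in> ?T" and g: "epi M N g"
    have N: "is_mod sm N" using mor_mod(2)[OF epi_mor[OF g]] .
    have "\<exists>k. mor Q N k \<and> i * k = h" if h: "mor K N h" for h
    proof -
      \<comment> \<open>Projectivity of K, which comes from heredity, lifts h to M, where the lift
        extends to Q.\<close>
      obtain k where k: "mor K M k" "k * g = h" by (rule projective_lift[OF K g h])
      then obtain e where e: "mor Q M e" "i * e = k" using M iff[of M] by blast
      have "i * (e * g) = h" using comp_assoc[OF mi e(1) epi_mor[OF g]] e k by simp
      then show ?thesis using mor_comp[OF e(1) epi_mor[OF g]] by blast
    qed
    then show "N \<in> ?T" using iff[OF N] N by blast
  next
    fix Y f E g Z assume s2: "ses sm Y f E g Z" and Y: "Y \<in> ?T" and Z: "Z \<in> ?T"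
    note S2 = sesD[OF s2]
    note mf = mono_mor[OF S2(1)] and mg = epi_mor[OF S2(2)]
    have E: "is_mod sm E" using mor_mod(2)[OF mf] .
    have "\<exists>k. mor Q E k \<and> i * k = h" if h: "mor K E h" for h
    proof -
      obtain e where e: "mor Q Z e" "i * e = h * g" using Z iff[of Z] mor_comp[OF h mg] by blast
      obtain e' where e': "mor Q E e'" "e' * g = e" by (rule projective_lift[OF Q S2(2) e(1)])
      note d = mor_dims[OF mf] mor_dims[OF mg] mor_dims[OF mi] mor_dims[OF e(1)] mor_dims[OF e'(1)] mor_dims[OF h]
      \<comment> \<open>e' extends h only modulo Y. The error has values in Y and extends to Q
        because Ext(X, Y) vanishes.\<close>
      let ?d = "h - i * e'"
      have "?d * g = h * g - i * (e' * g)" using d by (simp add: mat_distr mat_assoc)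
      then have "?d * g = nul K Z" unfolding e'(2) e(2) using d by simp
      then obtain u where u: "mor K Y u" "u * f = ?d"
        using ses_lift[OF s2 mor_diff[OF h mor_comp[OF mi e'(1)]]] by blast
      obtain u' where u': "mor Q Y u'" "i * u' = u" using Y iff[of Y] u(1) by blast
      have "i * (e' + u' * f) = i * e' + (i * u') * f" using d mor_dims[OF u'(1)] by (simp add: mat_distr mat_assoc)
      also have "\<dots> = i * e' + (h - i * e')" unfolding u'(2) u(2) ..
      also have "\<dots> = h" using d by (intro eq_matI) auto
      finally show ?thesis using mor_add[OF e'(1) mor_comp[OF u'(1) mf]] by blast
    qed
    then show "E \<in> ?T" using iff[OF E] E by blast
  qed blast
qed

text \<open>Exactness of Hom(X, E) \<rightarrow> Hom(X, Z) \<rightarrow> Ext(X, G): lift p * h from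
  Z to E, then correct the lift so that it vanishes on K.\<close>

lemma ext1_zero_hom_lift:
  assumes ses: "ses sm G f E g Z" and ext: "ext1_zero sm X G" and h: "mor X Z h"
  obtains k where "mor X E k" "k * g = h"
proof -
  note S = sesD[OF ses]
  note mf = mono_mor[OF S(1)] and mg = epi_mor[OF S(2)]
  obtain K i Q p where sX: "ses sm K i Q p X" and Q: "projective sm Q"
    by (rule resolution[OF mor_mod(1)[OF h]])
  note SX = sesD[OF sX]
  note mi = mono_mor[OF SX(1)] and mp = epi_mor[OF SX(2)]
  obtain e where e: "mor Q E e" "e * g = p * h" by (rule projective_lift[OF Q S(2) mor_comp[OF mp h]])
  note d = mor_dims[OF mf] mor_dims[OF mg] mor_dims[OF mi] mor_dims[OF mp] mor_dims[OF e(1)] mor_dims[OF h]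
  have "(i * e) * g = (i * p) * h" using e d by (simp add: mat_assoc)
  then have "(i * e) * g = nul K Z" unfolding SX(3) using d by simp
  then obtain u where u: "mor K G u" "u * f = i * e" by (rule ses_lift[OF ses mor_comp[OF mi e(1)]])
  obtain u' where u': "mor Q G u'" "i * u' = u" by (rule ext1_zero_extend[OF ext sX u(1)])
  note d = d mor_dims[OF u'(1)]
  let ?d = "e - u' * f"
  have "i * ?d = i * e - (i * u') * f" using d by (simp add: mat_distr mat_assoc)
  then have "i * ?d = nul K E" unfolding u'(2) u(2) using d by simp
  then obtain k where k: "mor X E k" "p * k = ?d"
    using ses_desc[OF sX mor_diff[OF e(1) mor_comp[OF u'(1) mf]]] by blast
  have "p * (k * g) = ?d * g" unfolding k(2)[symmetric] using d mor_dims[OF k(1)] by (simp add: mat_assoc)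
  also have "\<dots> = e * g - u' * (f * g)" using d by (simp add: mat_distr mat_assoc)
  also have "\<dots> = p * h" unfolding e(2) S(3) using d by simp
  finally have "k * g = h" by (rule epi_cancel[OF SX(2), rotated 2]) (use mor_dims[OF k(1)] d in auto)
  with k(1) show thesis by (rule that)
qed

text \<open>Exactness of Hom(X, N) \<rightarrow> Ext(X, L) \<rightarrow> Ext(X, V), where both outer
  terms vanish.\<close>

lemma ext1_zero_kernel:
  assumes ses: "ses sm L f V g N" and X: "is_mod sm X" and ext: "ext1_zero sm X V"
    and hom: "\<And>h. mor X N h \<Longrightarrow> h = nul X N"
  shows "ext1_zero sm X L"
proof -
  note S = sesD[OF ses]
  note mf = mono_mor[OF S(1)] and mg = epi_mor[OF S(2)]
  obtain K i Q p where sX: "ses sm K i Q p X" and Q: "projective sm Q"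
    by (rule resolution[OF X])
  note SX = sesD[OF sX]
  note mi = mono_mor[OF SX(1)] and mp = epi_mor[OF SX(2)]
  have "\<exists>k. mor Q L k \<and> i * k = h" if h: "mor K L h" for h
  proof -
    obtain e where e: "mor Q V e" "i * e = h * f" by (rule ext1_zero_extend[OF ext sX mor_comp[OF h mf]])
    note d = mor_dims[OF mf] mor_dims[OF mg] mor_dims[OF mi] mor_dims[OF mp] mor_dims[OF e(1)] mor_dims[OF h]
    have "i * (e * g) = (i * e) * g" using d by (simp add: mat_assoc)
    also have "\<dots> = h * (f * g)" unfolding e(2) using d by (simp add: mat_assoc)
    finally have "i * (e * g) = nul K N" unfolding S(3) using d by simp
    then obtain w where w: "mor X N w" "p * w = e * g" by (rule ses_desc[OF sX mor_comp[OF e(1) mg]])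
    then have "e * g = nul Q N" using hom[OF w(1)] d by simp
    then obtain e' where e': "mor Q L e'" "e' * f = e" by (rule ses_lift[OF ses e(1)])
    have "(i * e') * f = h * f" using comp_assoc[OF mi e'(1) mf] e e' by simp
    then have "i * e' = h" by (rule mono_cancel[OF S(1), rotated 2]) (use d mor_dims[OF e'(1)] in auto)
    then show ?thesis using e' by blast
  qed
  then show ?thesis using ext1_zero_iff[OF sX Q mor_mod(1)[OF mf]] by blast
qed

text \<open>Exactness of Hom(P, -) is what makes this work: here the vanishing maps go into V,
  whereas in \<open>tc_left_orth\<close> they leave V.\<close>

lemma tc_projective_orth:
  assumes P: "projective sm P" and T: "torsion_class sm T"
  shows "torsion_class sm {V \<in> T. \<forall>f. mor P V f \<longrightarrow> f = nul P V}" (is "torsion_class sm ?U")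
proof (rule tcI)
  show "M \<in> ?U" if "is_mod sm M" "fst M = 0" for M
    using tc_zero[OF T that] mor_zero_target that by blast
next
  fix M N g assume M: "M \<in> ?U" and g: "epi M N g"
  have "f = nul P N" if f: "mor P N f" for f
  proof -
    obtain k where k: "mor P M k" "k * g = f" by (rule projective_lift[OF P g f])
    then have "k = nul P M" using M by blast
    then show ?thesis using k comp_nul(1)[OF epi_mor[OF g]] by simp
  qed
  then show "N \<in> ?U" using tc_quot[OF T _ g] M by blast
next
  fix Y f E g X assume s: "ses sm Y f E g X" and Y: "Y \<in> ?U" and X: "X \<in> ?U"
  have "h = nul P E" if h: "mor P E h" for h
  proof -
    have "h * g = nul P X" using X mor_comp[OF h epi_mor[OF sesD(2)[OF s]]] by blast
    then obtain u where u: "mor P Y u" "u * f = h" by (rule ses_lift[OF s h])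
    then have "u = nul P Y" using Y by blast
    then show ?thesis using u comp_nul(1)[OF mono_mor[OF sesD(1)[OF s]]] by simp
  qed
  then show "E \<in> ?U" using tc_ext[OF T s] X Y by blast
qed (use tc_mod[OF T] in blast)

lemma pop_down_no_projective:
  assumes T': "torsion_class sm T'" and P: "P \<in> pop_down sm T'" "projective sm P"
  shows "fst P = 0"
proof -
  let ?U = "{V \<in> T'. \<forall>f. mor P V f \<longrightarrow> f = nul P V}"
  have "T' \<subseteq> ?U"
  proof (rule labels_generate[OF tors_finite T' tc_projective_orth[OF P(2) T']])
    fix T1 assume c: "tors_cover sm T1 T'"
    obtain X where X: "is_label T1 T' X" by (rule label_exists[OF c])
    have "f = nul P X" if "mor P X f" for f
      using perpD[OF labelD(8)[OF X] pop_downD[OF P(1) c] that] .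
    then show "\<exists>X\<in>?U. is_label T1 T' X" using X labelD(7)[OF X] by blast
  qed
  moreover have "P \<in> T'" using P(1) by (auto simp: pop_down_def)
  ultimately have "ident P = nul P P" using mor_id[OF tc_mod[OF T', of P]] by blast
  then show ?thesis by (rule ident_nul)
qed

lemma pop_down_ext1_zero:
  assumes T': "torsion_class sm T'" and T: "torsion_class sm T" and TT': "pop_down sm T' = T"
    and X: "X \<in> down_labels sm T" and X': "X' \<in> down_labels sm T"
  shows "ext1_zero sm X X'"
proof -
  obtain T1 where X: "is_label T1 T X" using X by (auto simp: down_labels_def is_label_def)
  note LX = labelD[OF X]
  have sub: "T \<subseteq> T'" using TT' by (auto simp: pop_down_def)
  have "T' \<subseteq> {M. is_mod sm M \<and> ext1_zero sm X M}"
  proof (rule labels_generate[OF tors_finite T' tc_ext1_zero[OF LX(5)]])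
    fix Ti assume c: "tors_cover sm Ti T'"
    obtain S where S: "is_label Ti T' S" by (rule label_exists[OF c])
    note LS = labelD[OF S]
    have Ti: "T \<subseteq> Ti" using pop_downD[OF _ c] TT' by blast
    have "ext1_zero sm X S" unfolding ext1_zero_def
    proof (intro allI impI, rule ccontr)
      fix f E g assume ses: "ses sm S f E g X"
        and "\<not> (\<exists>s. is_hom X E s \<and> s * g = ident X)"
      then have nonsplit: "\<And>s. mor X E s \<Longrightarrow> s * g \<noteq> ident X" by (auto simp: mor_def)
      note Se = sesD[OF ses]
      note mf = mono_mor[OF Se(1)] and mg = epi_mor[OF Se(2)]
      have ET': "E \<in> T'" using tc_ext[OF T' ses LS(7)] LX(7) sub by blast
      \<comment> \<open>Such an h factors through S, which is perpendicular to Ti and hence to T.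
        This is the kernel condition of \<open>label_split\<close> over X.\<close>
      have "h = nul V E" if V: "V \<in> T" and h: "mor V E h" "h * g = nul V X" for V h
      proof -
        obtain u where u: "mor V S u" "u * f = h" by (rule ses_lift[OF ses h])
        have "u = nul V S" using perpD[OF LS(8) _ u(1)] V Ti by blast
        then show ?thesis using u comp_nul(1)[OF mf] by simp
      qed
      then have Eperp: "E \<in> perp sm T" using label_split[OF X mg] nonsplit by blast
      have "E \<in> Tj" if cj: "tors_cover sm Tj T'" for Tj
      proof (rule ccontr)
        assume ETj: "E \<notin> Tj"
        obtain Sj where Sj: "is_label Tj T' Sj" by (rule label_exists[OF cj])
        note LSj = labelD[OF Sj]
        obtain h where h: "mor E Sj h" "h \<noteq> nul E Sj" by (rule cover_hom[OF cj ET' ETj LSj(7,8,6)])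
        show False
        proof (cases "f * h = nul S Sj")
          case True
          obtain h' where h': "mor X Sj h'" "g * h' = h" by (rule ses_desc[OF ses h(1) True])
          have "X \<in> Tj" using pop_downD[OF _ cj] TT' LX(7) by blast
          then have "h' = nul X Sj" using perpD[OF LSj(8) _ h'(1)] by blast
          then show False using h h' comp_nul(2)[OF mg] by simp
        next
          case False
          \<comment> \<open>S and Sj are labels of lower covers of the same class T', so f * h is
            invertible, and h followed by its inverse retracts f.\<close>
          obtain k where k: "mor Sj S k" "(f * h) * k = ident S"
            using label_hom_iso[OF S Sj mor_comp[OF mf h(1)] False] by blast
          have "f * (h * k) = ident S" using comp_assoc[OF mf h(1) k(1)] k(2) by simp
          then obtain s where "mor X E s" "s * g = ident X" by (rule retraction_section[OF ses mor_comp[OF h(1) k(1)]])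
          then show False using nonsplit by blast
        qed
      qed
      then have "E \<in> pop_down sm T'" using ET' by (auto simp: pop_down_def)
      \<comment> \<open>E lies both in T and in its perpendicular class, although it has the nonzero
        quotient X.\<close>
      then have "fst E = 0" using perp_zero[OF _ Eperp] TT' by blast
      then show False using Se(4) LX(6) by simp
    qed
    then show "\<exists>S\<in>{M. is_mod sm M \<and> ext1_zero sm X M}. is_label Ti T' S" using S LS(5) by blast
  qed
  moreover have "X' \<in> T'" using X' sub by (auto simp: down_labels_def)
  ultimately show ?thesis by blast
qed

end

section \<open>Constructing a preimage under pop-down\<close>

text \<open>The empty set qualifies, so membership of the zero matrix is demanded separately where
  it matters.\<close>

definition lin_closed :: "'k::field mat set \<Rightarrow> bool" where
  "lin_closed R \<longleftrightarrow> (\<forall>a\<in>R. \<forall>b\<in>R. a + b \<in> R) \<and> (\<forall>c. \<forall>a\<in>R. c \<cdot>\<^sub>m a \<in> R)"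

text \<open>Gaussian elimination, by induction over the positions I at which entries may be nonzero.
  Spanning means membership in every \<open>lin_closed\<close> set containing G and zero, so linear
  combinations never have to be written out.\<close>

lemma finite_spanning_set:
  fixes W :: "'k::field mat set"
  assumes "finite I" "lin_closed W" "W \<subseteq> carrier_mat m n" "\<And>w a b. w \<in> W \<Longrightarrow> a < m \<Longrightarrow> b < n \<Longrightarrow> (a,b) \<notin> I \<Longrightarrow> w $$ (a,b) = 0"
  shows "\<exists>G. finite G \<and> G \<subseteq> W \<and> (\<forall>R. lin_closed R \<and> 0\<^sub>m m n \<in> R \<and> G \<subseteq> R \<longrightarrow> W \<subseteq> R)"
  using assms
proof (induction I arbitrary: W)
  case empty
  then have "w = 0\<^sub>m m n" if "w \<in> W" for w using that by (intro eq_matI) auto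
  then show ?case by (intro exI[of _ "{}"]) auto
next
  case (insert p I)
  obtain a b where p: "p = (a,b)" by force
  show ?case
  proof (cases "\<exists>w\<in>W. a < m \<and> b < n \<and> w $$ (a,b) \<noteq> 0")
    case False
    show ?thesis
    proof (rule insert.IH[OF insert.prems(1,2)])
      fix w c d assume w: "w \<in> W" "c < m" "d < n" "(c,d) \<notin> I"
      show "w $$ (c,d) = 0"
      proof (cases "(c,d) = p")
        case True
        then have "c = a" "d = b" using p by auto
        then show ?thesis using False w(1-3) by blast
      next
        case c: False
        then have "(c,d) \<notin> insert p I" using w(4) by blast
        then show ?thesis by (rule insert.prems(3)[OF w(1-3)])
      qed
    qed
  next
    case True
    then obtain w where w: "w \<in> W" "a < m" "b < n" "w $$ (a,b) \<noteq> 0" by blast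
    let ?W = "{v \<in> W. v $$ (a,b) = 0}"
    have "lin_closed ?W" unfolding lin_closed_def
    proof (intro conjI ballI allI)
      fix x y assume "x \<in> ?W" "y \<in> ?W"
      moreover from this have "y \<in> carrier_mat m n" using insert.prems(2) by auto
      ultimately show "x + y \<in> ?W" using insert.prems(1) w(2,3) by (simp add: lin_closed_def)
    next
      fix c x assume "x \<in> ?W"
      moreover from this have "x \<in> carrier_mat m n" using insert.prems(2) by auto
      ultimately show "c \<cdot>\<^sub>m x \<in> ?W" using insert.prems(1) w(2,3) by (simp add: lin_closed_def)
    qed
    then have "\<exists>G. finite G \<and> G \<subseteq> ?W \<and> (\<forall>R. lin_closed R \<and> 0\<^sub>m m n \<in> R \<and> G \<subseteq> R \<longrightarrow> ?W \<subseteq> R)"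
    proof (rule insert.IH)
      show "?W \<subseteq> carrier_mat m n" using insert.prems(2) by blast
      fix v c d assume v: "v \<in> ?W" "c < m" "d < n" "(c,d) \<notin> I"
      show "v $$ (c,d) = 0"
      proof (cases "(c,d) = p")
        case True
        then have "c = a" "d = b" using p by auto
        then show ?thesis using v(1) by simp
      next
        case False
        then have "(c,d) \<notin> insert p I" using v(4) by blast
        moreover have "v \<in> W" using v(1) by simp
        ultimately show ?thesis using insert.prems(3)[OF _ v(2,3)] by blast
      qed
    qed
    then obtain G where G: "finite G" "G \<subseteq> ?W"
        "\<forall>R. lin_closed R \<and> 0\<^sub>m m n \<in> R \<and> G \<subseteq> R \<longrightarrow> ?W \<subseteq> R"
      by (elim exE conjE) (rule that)
    have "W \<subseteq> R" if R: "lin_closed R" "0\<^sub>m m n \<in> R" "insert w G \<subseteq> R" for R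
    proof
      fix h assume h: "h \<in> W"
      \<comment> \<open>Subtracting this multiple of w clears the entry at (a, b), and the induction
        hypothesis covers the remainder.\<close>
      let ?c = "h $$ (a,b) / w $$ (a,b)"
      let ?h = "h + (- ?c) \<cdot>\<^sub>m w"
      have hw: "h \<in> carrier_mat m n" "w \<in> carrier_mat m n" using h w insert.prems(2) by auto
      have "?h \<in> W" using h w insert.prems(1) unfolding lin_closed_def by blast
      moreover have "?h $$ (a,b) = 0" using hw w by simp
      ultimately have "?h \<in> R" using G(3)[rule_format, of R] R by blast
      then have "?h + ?c \<cdot>\<^sub>m w \<in> R" using R unfolding lin_closed_def by blast
      also have "?h + ?c \<cdot>\<^sub>m w = h" using hw by (intro eq_matI) auto
      finally show "h \<in> R" .
    qed
    then show ?thesis using G(1,2) w(1) by (intro exI[of _ "insert w G"]) auto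
  qed
qed

context module_category begin

lemma hom_finite_span:
  assumes "is_mod sm M" "is_mod sm N"
  obtains G where "finite G" "\<And>g. g \<in> G \<Longrightarrow> mor M N g"
    "\<And>R h. lin_closed R \<Longrightarrow> nul M N \<in> R \<Longrightarrow> G \<subseteq> R \<Longrightarrow> mor M N h \<Longrightarrow> h \<in> R"
proof -
  have "\<exists>G. finite G \<and> G \<subseteq> Collect (mor M N) \<and>
     (\<forall>R. lin_closed R \<and> nul M N \<in> R \<and> G \<subseteq> R \<longrightarrow> Collect (mor M N) \<subseteq> R)"
  proof (rule finite_spanning_set[of "{..<fst M} \<times> {..<fst N}"])
    show "lin_closed (Collect (mor M N))"
      unfolding lin_closed_def by (simp add: mor_add mor_smult)
    show "Collect (mor M N) \<subseteq> carrier_mat (fst M) (fst N)"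
      using mor_carrier by blast
  qed simp_all
  then obtain G where G: "finite G" "G \<subseteq> Collect (mor M N)"
    "\<forall>R. lin_closed R \<and> nul M N \<in> R \<and> G \<subseteq> R \<longrightarrow> Collect (mor M N) \<subseteq> R"
    by blast
  show thesis
  proof (rule that[OF G(1)])
    show "mor M N g" if "g \<in> G" for g using G(2) that by blast
    show "h \<in> R" if "lin_closed R" "nul M N \<in> R" "G \<subseteq> R" "mor M N h" for R h
      using G(3)[rule_format, of R] that by blast
  qed
qed


text \<open>The identity of E is the sum of a part lifted from X through p and a remainder with
  values in the image of j. The remainder lifts through h, which is onto, so together the lifts form
  a linear section of k.\<close>

lemma pushout_epi:
  assumes ses: "ses sm K i Q p X" and h: "epi K M h"
    and po: "ses sm M j E q X" "mor Q E k" "i * k = h * j" "k * q = p"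
  shows "epi Q E k"
proof -
  note S = sesD[OF ses] and P = sesD[OF po(1)]
  obtain a where a: "a \<in> carrier_mat (fst M) (fst K)" "a * h = ident M"
    using h by (auto simp: epi_def surj_map_def)
  obtain b where b: "b \<in> carrier_mat (fst X) (fst Q)" "b * p = ident X"
    using S(2) by (auto simp: epi_def surj_map_def)
  obtain s t where st: "s \<in> carrier_mat (fst X) (fst E)" "t \<in> carrier_mat (fst E) (fst M)" "q * s + t * j = ident E"
    by (rule ses_splitting[OF po(1)])
  note d0 = mor_dims[OF mono_mor[OF S(1)]] mor_dims[OF epi_mor[OF S(2)]] mor_dims[OF mono_mor[OF P(1)]]
    mor_dims[OF epi_mor[OF P(2)]] mor_dims[OF po(2)] mor_dims[OF epi_mor[OF h]]
  have d: "dim_row a = fst M" "dim_col a = fst K" "dim_row b = fst X" "dim_col b = fst Q"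
    "dim_row s = fst X" "dim_col s = fst E" "dim_row t = fst E" "dim_col t = fst M"
    using a b st by auto
  let ?c = "ident E - q * (b * k)"
  have "?c * q = q - q * (b * (k * q))" using d0 d by (simp add: mat_distr mat_assoc)
  then have cq: "?c * q = nul E X" unfolding po(4) b(2) using d0 by simp
  have "?c = ?c * (q * s + t * j)" unfolding st(3) using d0 d by simp
  also have "\<dots> = (?c * q) * s + (?c * t) * j" using d0 d by (simp add: mat_distr(2) mat_assoc)
  finally have c: "?c = (?c * t) * j" unfolding cq using d0 d by simp
  have "j = (a * h) * j" unfolding a(2) using d0 by simp
  also have "\<dots> = a * (i * k)" unfolding po(3) using d0 d by (simp add: mat_assoc)
  finally have j: "j = a * (i * k)" .
  have "(q * b + (?c * t) * (a * i)) * k = q * (b * k) + (?c * t) * (a * (i * k))"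
    using d0 d by (simp add: mat_distr(1) mat_assoc)
  also have "\<dots> = q * (b * k) + ?c" unfolding j[symmetric] c[symmetric] ..
  also have "\<dots> = ident E" using d0 d by (intro eq_matI) auto
  finally show ?thesis using po(2) d0 d by (intro epiI[of _ _ _ "q * b + (?c * t) * (a * i)"]) auto
qed

end

context hereditary_category begin

text \<open>
For modules X with projective presentation K X \<rightarrow> Q X, the list L spans Ext(X, E) over the base field: modulo
the maps that extend along i X, every map K X \<rightarrow> E is a linear combination of the maps listed for X.
\<close>
definition ext_span :: "('a,'k) rmod set \<Rightarrow> (('a,'k) rmod \<Rightarrow> ('a,'k) rmod) \<Rightarrow> (('a,'k) rmod \<Rightarrow> 'k mat) \<Rightarrow>
    (('a,'k) rmod \<Rightarrow> ('a,'k) rmod) \<Rightarrow> (('a,'k) rmod \<times> 'k mat) list \<Rightarrow> ('a,'k) rmod \<Rightarrow> bool" where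
  "ext_span S K i Q L E \<longleftrightarrow> (\<forall>X\<in>S. \<forall>R. lin_closed R \<and> (\<forall>g. mor (Q X) E g \<longrightarrow> i X * g \<in> R) \<and>
      (\<forall>g. (X,g) \<in> set L \<longrightarrow> g \<in> R) \<longrightarrow> (\<forall>h. mor (K X) E h \<longrightarrow> h \<in> R))"

lemma ext_spanD:
  assumes "ext_span S K i Q L E" "X \<in> S" "lin_closed R" "\<And>g. mor (Q X) E g \<Longrightarrow> i X * g \<in> R"
    "\<And>g. (X,g) \<in> set L \<Longrightarrow> g \<in> R" "mor (K X) E h"
  shows "h \<in> R"
  using assms unfolding ext_span_def by blast

text \<open>
As long as some map K X \<rightarrow> E does not extend to Q X, the pushout enlarges E by one copy of X. The
epimorphism onto X0 extends because Ext(X, X0) = 0, and it stays non-split: a section that does not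
already factor through E would split the pushout sequence.
\<close>
lemma universal_extension:
  assumes ext: "\<And>X Y. X \<in> S \<Longrightarrow> Y \<in> S \<Longrightarrow> ext1_zero sm X Y"
    and hom_iso: "\<And>X Y f. X \<in> S \<Longrightarrow> Y \<in> S \<Longrightarrow> mor X Y f \<Longrightarrow> f \<noteq> nul X Y \<Longrightarrow> \<exists>g. mor Y X g \<and> g * f = ident Y"
    and res: "\<And>X. X \<in> S \<Longrightarrow> ses sm (K X) (i X) (Q X) (p X) X" "\<And>X. X \<in> S \<Longrightarrow> projective sm (Q X)"
    and X0: "X0 \<in> S"
    and L: "\<And>X g. (X,g) \<in> set L \<Longrightarrow> X \<in> S \<and> mor (K X) E g"
    and sp: "ext_span S K i Q L E"
    and pi: "epi E X0 \<pi>" and nonsplit: "\<And>s. mor X0 E s \<Longrightarrow> s * \<pi> \<noteq> ident X0"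
  shows "\<exists>E' \<pi>'. epi E' X0 \<pi>' \<and> (\<forall>s. mor X0 E' s \<longrightarrow> s * \<pi>' \<noteq> ident X0) \<and> (\<forall>X\<in>S. ext1_zero sm X E')"
  using L sp pi nonsplit
proof (induction "length L" arbitrary: L E \<pi>)
  case (0 L1 E \<pi>)
  then have sp0: "ext_span S K i Q [] E" by simp
  have "ext1_zero sm X E" if X: "X \<in> S" for X
  proof -
    note r = res[OF X]
    note mi = mono_mor[OF sesD(1)[OF r(1)]]
    \<comment> \<open>With an empty list, the spanning property for the set of restrictions from Q X
      says that every map K X \<rightarrow> E extends.\<close>
    let ?R = "{i X * g | g. mor (Q X) E g}"
    have "lin_closed ?R" unfolding lin_closed_def
    proof (intro conjI ballI allI)
      fix a b assume "a \<in> ?R" "b \<in> ?R"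
      then obtain f g where f: "mor (Q X) E f" "a = i X * f" and g: "mor (Q X) E g" "b = i X * g" by blast
      have "a + b = i X * (f + g)" using f g mor_dims[OF f(1)] mor_dims[OF g(1)] mor_dims[OF mi] by (simp add: mat_distr)
      then show "a + b \<in> ?R" using mor_add[OF f(1) g(1)] by blast
    next
      fix c a assume "a \<in> ?R"
      then obtain f where f: "mor (Q X) E f" "a = i X * f" by blast
      have "c \<cdot>\<^sub>m a = i X * (c \<cdot>\<^sub>m f)" using f mor_dims[OF f(1)] mor_dims[OF mi] by (simp add: mat_smult)
      then show "c \<cdot>\<^sub>m a \<in> ?R" using mor_smult[OF f(1)] by blast
    qed
    then have "h \<in> ?R" if "mor (K X) E h" for h
      by (rule ext_spanD[OF sp0 X _ _ _ that]) auto
    then show ?thesis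
      using ext1_zero_iff[OF r mor_mod(1)[OF epi_mor[OF 0(4)]]] by blast
  qed
  then show ?case using 0(4,5) by blast
next
  case (Suc n L1 E \<pi>)
  from Suc.hyps(2) obtain a L where L1: "L1 = a # L" and n: "n = length L" by (cases L1) auto
  note prems = Suc.prems[unfolded L1]
  obtain X g where a: "a = (X,g)" by (metis surj_pair)
  have X: "X \<in> S" and g: "mor (K X) E g" using prems(1)[of X g] a by auto
  note r = res[OF X]
  note mi = mono_mor[OF sesD(1)[OF r(1)]]
  show ?case
  proof (cases "\<exists>k. mor (Q X) E k \<and> i X * k = g")
    case True
    have "ext_span S K i Q L E" unfolding ext_span_def
    proof (intro ballI allI impI, elim conjE)
      fix Y R h assume *: "Y \<in> S" "lin_closed R" "\<forall>g. mor (Q Y) E g \<longrightarrow> i Y * g \<in> R"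
        "\<forall>g. (Y, g) \<in> set L \<longrightarrow> g \<in> R" "mor (K Y) E h"
      show "h \<in> R"
        by (rule ext_spanD[OF prems(2) *(1,2) _ _ *(5)]) (use * True a in auto)
    qed
    with n prems(1,3,4) show ?thesis by (intro Suc.hyps(1)[of L E \<pi>]) auto
  next
    case False
    obtain E' j q k where po: "ses sm E j E' q X" "mor (Q X) E' k" "i X * k = g * j" "k * q = p X"
      by (rule pushout[OF r(1) g])
    note P = sesD[OF po(1)]
    note mj = mono_mor[OF P(1)] and mq = epi_mor[OF P(2)]
    obtain \<pi>' where \<pi>': "mor E' X0 \<pi>'" "j * \<pi>' = \<pi>"
      by (rule ext1_zero_extend[OF ext[OF X X0] po(1) epi_mor[OF prems(3)]])
    note d = mor_dims[OF mj] mor_dims[OF mq] mor_dims[OF \<pi>'(1)]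
    obtain s where s: "s \<in> carrier_mat (fst X0) (fst E)" "s * \<pi> = ident X0"
      using prems(3) by (auto simp: epi_def surj_map_def)
    have "(s * j) * \<pi>' = ident X0" using s \<pi>'(2) d by (simp add: mat_assoc)
    then have epi': "epi E' X0 \<pi>'" using \<pi>'(1) s d by (intro epiI) auto
    have nosec: "s' * q \<noteq> ident X" if s': "mor X E' s'" for s'
    proof
      assume "s' * q = ident X"
      then obtain r where r: "mor E' E r" "j * r = ident E" by (rule section_retraction[OF po(1) s'])
      have "i X * (k * r) = (g * j) * r"
        unfolding po(3)[symmetric] by (rule comp_assoc[OF mi po(2) r(1), symmetric])
      also have "\<dots> = g" using comp_assoc[OF g mj r(1)] r g by simp
      finally show False using False mor_comp[OF po(2) r(1)] by blast
    qed
    have nonsplit': "s' * \<pi>' \<noteq> ident X0" if s': "mor X0 E' s'" for s'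
    proof
      assume sp: "s' * \<pi>' = ident X0"
      show False
      proof (cases "s' * q = nul X0 X")
        case True
        obtain u where u: "mor X0 E u" "u * j = s'" by (rule ses_lift[OF po(1) s' True])
        have "u * \<pi> = (u * j) * \<pi>'" unfolding \<pi>'(2)[symmetric] by (rule comp_assoc[OF u(1) mj \<pi>'(1), symmetric])
        then show False using sp u prems(4)[OF u(1)] by simp
      next
        case False
        obtain w where w: "mor X X0 w" "w * (s' * q) = ident X"
          using hom_iso[OF X0 X mor_comp[OF s' mq] False] by blast
        then show False using nosec[OF mor_comp[OF w(1) s']] comp_assoc[OF w(1) s' mq] by simp
      qed
    qed
    \<comment> \<open>The head of the list is dropped, since g * j extends along i X after the
      pushout; the other generators are carried along j.\<close>
    let ?L = "map (\<lambda>(Y,f). (Y, f * j)) L"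
    have L': "Y \<in> S \<and> mor (K Y) E' f" if "(Y,f) \<in> set ?L" for Y f
    proof -
      from that obtain f0 where f0: "(Y, f0) \<in> set L" "f = f0 * j" by auto
      then have "Y \<in> S \<and> mor (K Y) E f0" using prems(1)[of Y f0] by simp
      then show ?thesis using mor_comp[OF _ mj] f0(2) by blast
    qed
    have "ext_span S K i Q ?L E'" unfolding ext_span_def
    proof (intro ballI allI impI, elim conjE)
      fix Y R h assume Y: "Y \<in> S" and R: "lin_closed R" and RQ: "\<forall>g. mor (Q Y) E' g \<longrightarrow> i Y * g \<in> R"
        and RL: "\<forall>g. (Y, g) \<in> set ?L \<longrightarrow> g \<in> R" and h: "mor (K Y) E' h"
      note rY = res[OF Y]
      note miY = mono_mor[OF sesD(1)[OF rY(1)]]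
      \<comment> \<open>The new copy of X contributes no new generator: as Ext(Y, X) = 0, the map h
        * q extends to Q Y, so up to an extendable map h has the form u * j.\<close>
      obtain e where e: "mor (Q Y) X e" "i Y * e = h * q"
        by (rule ext1_zero_extend[OF ext[OF Y X] rY(1) mor_comp[OF h mq]])
      obtain e' where e': "mor (Q Y) E' e'" "e' * q = e" by (rule projective_lift[OF rY(2) P(2) e(1)])
      note d = d mor_dims[OF h] mor_dims[OF e'(1)] mor_dims[OF miY]
      let ?d = "h - i Y * e'"
      have "?d * q = h * q - i Y * (e' * q)" using d by (simp add: mat_distr mat_assoc)
      then have "?d * q = nul (K Y) X" unfolding e'(2) e(2) using d by simp
      then obtain u where u: "mor (K Y) E u" "u * j = ?d"
        using ses_lift[OF po(1) mor_diff[OF h mor_comp[OF miY e'(1)]]] by blast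
      \<comment> \<open>R is pulled back along j so that the spanning property of the old E applies
        to u.\<close>
      let ?R = "{f. mor (K Y) E f \<and> f * j \<in> R}"
      have "u \<in> ?R"
      proof (rule ext_spanD[OF prems(2) Y _ _ _ u(1)])
        show "lin_closed ?R" unfolding lin_closed_def
        proof (intro conjI ballI allI)
          fix a b assume "a \<in> ?R" "b \<in> ?R"
          then have ab: "mor (K Y) E a" "mor (K Y) E b" "a * j + b * j \<in> R" using R unfolding lin_closed_def by auto
          have "(a + b) * j = a * j + b * j" using mor_dims[OF ab(1)] mor_dims[OF ab(2)] d by (simp add: mat_distr)
          then show "a + b \<in> ?R" using ab mor_add[OF ab(1,2)] by simp
        next
          fix c a assume "a \<in> ?R"
          then have a: "mor (K Y) E a" "c \<cdot>\<^sub>m (a * j) \<in> R" using R unfolding lin_closed_def by auto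
          have "(c \<cdot>\<^sub>m a) * j = c \<cdot>\<^sub>m (a * j)" using mor_dims[OF a(1)] d by (simp add: mat_smult)
          then show "c \<cdot>\<^sub>m a \<in> ?R" using a mor_smult[OF a(1)] by simp
        qed
        show "i Y * f \<in> ?R" if f: "mor (Q Y) E f" for f
          using mor_comp[OF miY f] comp_assoc[OF miY f mj] RQ mor_comp[OF f mj] by simp
        show "f \<in> ?R" if f: "(Y, f) \<in> set (a # L)" for f
        proof (cases "(Y,f) \<in> set L")
          case True
          then have "(Y, f * j) \<in> set ?L" by force
          then show ?thesis using RL True prems(1)[of Y f] by auto
        next
          case False
          then have "Y = X" "f = g" using f a by auto
          then show ?thesis using g RQ po(2,3) by auto
        qed
      qed
      then have "?d \<in> R" using u by simp
      moreover have "i Y * e' \<in> R" using RQ e'(1) by blast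
      ultimately have "?d + i Y * e' \<in> R" using R unfolding lin_closed_def by blast
      also have "?d + i Y * e' = h" using d by (intro eq_matI) auto
      finally show "h \<in> R" .
    qed
    from Suc.hyps(1)[of ?L, OF _ L' this epi' nonsplit'] n show ?thesis by simp
  qed
qed

text \<open>The iteration of pushouts starts from an epimorphism P \<rightarrow> X0 with P
  projective: a section would make X0 a direct summand of P, hence projective. The initial list
  exists because S is finite and each Hom(K X, P) is finite-dimensional.\<close>

lemma nonsplit_epi_ext1_zero:
  assumes fin: "finite S" and mods: "\<And>X. X \<in> S \<Longrightarrow> is_mod sm X"
    and ext: "\<And>X Y. X \<in> S \<Longrightarrow> Y \<in> S \<Longrightarrow> ext1_zero sm X Y"
    and hom_iso: "\<And>X Y f. X \<in> S \<Longrightarrow> Y \<in> S \<Longrightarrow> mor X Y f \<Longrightarrow> f \<noteq> nul X Y \<Longrightarrow> \<exists>g. mor Y X g \<and> g * f = ident Y"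
    and X0: "X0 \<in> S" "\<not> projective sm X0"
  obtains E \<pi> where "epi E X0 \<pi>" "\<And>s. mor X0 E s \<Longrightarrow> s * \<pi> \<noteq> ident X0" "\<And>X. X \<in> S \<Longrightarrow> ext1_zero sm X E"
proof -
  have "\<forall>X\<in>S. \<exists>r. ses sm (fst r) (fst (snd r)) (fst (snd (snd r))) (snd (snd (snd r))) X \<and> projective sm (fst (snd (snd r)))"
    using mods by (metis resolution fst_conv snd_conv)
  then obtain r where r: "\<And>X. X \<in> S \<Longrightarrow> ses sm (fst (r X)) (fst (snd (r X))) (fst (snd (snd (r X)))) (snd (snd (snd (r X)))) X"
     "\<And>X. X \<in> S \<Longrightarrow> projective sm (fst (snd (snd (r X))))" by metis
  define K where "K = (\<lambda>X. fst (r X))"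
  define i where "i = (\<lambda>X. fst (snd (r X)))"
  define Q where "Q = (\<lambda>X. fst (snd (snd (r X))))"
  define p where "p = (\<lambda>X. snd (snd (snd (r X))))"
  have res: "X \<in> S \<Longrightarrow> ses sm (K X) (i X) (Q X) (p X) X" "X \<in> S \<Longrightarrow> projective sm (Q X)" for X
    using r by (auto simp: K_def i_def Q_def p_def)
  obtain P \<pi> where P: "projective sm P" and pi: "epi P X0 \<pi>" using enough_projectives[OF mods[OF X0(1)]] by blast
  have Pm: "is_mod sm P" using P by (simp add: projective_def)
  have nonsplit: "s * \<pi> \<noteq> ident X0" if s: "mor X0 P s" for s
  proof
    assume sp: "s * \<pi> = ident X0"
    have "projective sm X0" unfolding projective_def
    proof (intro conjI allI impI)
      fix M N g h assume "is_mod sm M \<and> is_mod sm N \<and> is_hom M N g \<and> surj_map (fst M) (fst N) g \<and> is_hom X0 N h"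
      then have g: "epi M N g" and h: "mor X0 N h" using mods[OF X0(1)] by (auto simp: epi_def mor_def)
      obtain k where k: "mor P M k" "k * g = \<pi> * h"
        by (rule projective_lift[OF P g mor_comp[OF epi_mor[OF pi] h]])
      have "(s * k) * g = s * (k * g)" by (rule comp_assoc[OF s k(1) epi_mor[OF g]])
      also have "\<dots> = (s * \<pi>) * h" unfolding k(2) by (rule comp_assoc[OF s epi_mor[OF pi] h, symmetric])
      finally have "(s * k) * g = h" using sp h by simp
      then show "\<exists>k. is_hom X0 M k \<and> k * g = h" using mor_comp[OF s k(1)] by (auto simp: mor_def)
    qed (use mods X0 in blast)
    then show False using X0 by blast
  qed
  have "\<exists>G. finite G \<and> (\<forall>g\<in>G. mor (K X) P g) \<and>
      (\<forall>R h. lin_closed R \<longrightarrow> nul (K X) P \<in> R \<longrightarrow> G \<subseteq> R \<longrightarrow> mor (K X) P h \<longrightarrow> h \<in> R)" if X: "X \<in> S" for X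
    by (rule hom_finite_span[OF mor_mod(1)[OF mono_mor[OF sesD(1)[OF res(1)[OF X]]]] Pm]) blast
  then obtain G where G: "\<And>X. X \<in> S \<Longrightarrow> finite (G X)" "\<And>X g. X \<in> S \<Longrightarrow> g \<in> G X \<Longrightarrow> mor (K X) P g"
    "\<And>X R h. X \<in> S \<Longrightarrow> lin_closed R \<Longrightarrow> nul (K X) P \<in> R \<Longrightarrow> G X \<subseteq> R \<Longrightarrow> mor (K X) P h \<Longrightarrow> h \<in> R" 
    by metis
  have "finite (Sigma S G)" using fin G(1) by blast
  then obtain L where L: "set L = Sigma S G" using finite_list by blast
  have "ext_span S K i Q L P" unfolding ext_span_def
  proof (intro ballI allI impI, elim conjE)
    fix X R h assume X: "X \<in> S" and R: "lin_closed R" "\<forall>g. mor (Q X) P g \<longrightarrow> i X * g \<in> R" "\<forall>g. (X, g) \<in> set L \<longrightarrow> g \<in> R"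
      and h: "mor (K X) P h"
    note mi = mono_mor[OF sesD(1)[OF res(1)[OF X]]]
    have "i X * nul (Q X) P \<in> R" using R(2) mor_nul[OF mor_mod(2)[OF mi] Pm] by blast
    then show "h \<in> R" using G(3)[OF X R(1) _ _ h] R(3) L X mor_dims[OF mi] by auto
  qed
  then have "\<exists>E' \<pi>'. epi E' X0 \<pi>' \<and> (\<forall>s. mor X0 E' s \<longrightarrow> s * \<pi>' \<noteq> ident X0) \<and> (\<forall>X\<in>S. ext1_zero sm X E')"
    using universal_extension[OF ext hom_iso res X0(1) _ _ pi nonsplit] L G(2) by blast
  then show thesis using that by blast
qed

lemma pop_down_preimage:
  assumes T: "torsion_class sm T"
    and ext: "\<And>X X'. X \<in> down_labels sm T \<Longrightarrow> X' \<in> down_labels sm T \<Longrightarrow> ext1_zero sm X X'"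
    and noproj: "\<And>P. P \<in> T \<Longrightarrow> projective sm P \<Longrightarrow> fst P = 0"
  shows "\<exists>T'. torsion_class sm T' \<and> pop_down sm T' = T"
proof -
  have "\<forall>T1\<in>{T1. tors_cover sm T1 T}. \<exists>X. is_label T1 T X" using label_exists by blast
  \<comment> \<open>\<open>down_labels\<close> contains whole isomorphism classes; one
    representative per cover makes S finite.\<close>
  then obtain lab where lab: "\<And>T1. tors_cover sm T1 T \<Longrightarrow> is_label T1 T (lab T1)" by (metis mem_Collect_eq)
  define S where "S = lab ` {T1. tors_cover sm T1 T}"
  have "finite {T1. tors_cover sm T1 T}"
    using tors_finite unfolding tau_tilting_finite_def by (rule rev_finite_subset) (auto dest: coverD)
  then have finS: "finite S" unfolding S_def by blast
  have S_label: "\<exists>T1. is_label T1 T X" if "X \<in> S" for X using that lab unfolding S_def by blast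
  then have S_down: "X \<in> down_labels sm T" if "X \<in> S" for X
    using that unfolding down_labels_def is_label_def by blast
  have S_mod: "is_mod sm X" and S_T: "X \<in> T" and S_brick: "brick sm X" and S_nz: "fst X \<noteq> 0" if "X \<in> S" for X
  proof -
    from S_label[OF that] obtain T1 where "is_label T1 T X" by blast
    from labelD[OF this] show "is_mod sm X" "X \<in> T" "brick sm X" "fst X \<noteq> 0" by auto
  qed
  have S_gen: "T \<subseteq> U" if "torsion_class sm U" "S \<subseteq> U" for U
    by (rule labels_generate[OF tors_finite T that(1)]) (use lab that(2) in \<open>auto simp: S_def\<close>)
  have S_iso: "\<exists>g. mor Y X g \<and> g * f = ident Y" if XY: "X \<in> S" "Y \<in> S" and f: "mor X Y f" "f \<noteq> nul X Y" for X Y f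
    using S_label[OF XY(1)] S_label[OF XY(2)] label_hom_iso[OF _ _ f] by metis
  define T2 where "T2 = {M. is_mod sm M \<and> (\<forall>X\<in>S. ext1_zero sm X M)}"
  have T2: "torsion_class sm T2"
  proof (rule tcI)
    note E = tc_ext1_zero[OF S_mod]
    show "M \<in> T2" if "is_mod sm M" "fst M = 0" for M using tc_zero[OF E that] that unfolding T2_def by blast
    show "N \<in> T2" if "M \<in> T2" "epi M N g" for M N g
      using that tc_quot[OF E _ that(2)] mor_mod(2)[OF epi_mor[OF that(2)]] unfolding T2_def by blast
    show "E \<in> T2" if "ses sm Y f E g X" "Y \<in> T2" "X \<in> T2" for Y f E g X
      using that tc_ext[OF E that(1)] mor_mod(1)[OF epi_mor[OF sesD(2)[OF that(1)]]] unfolding T2_def by blast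
  qed (auto simp: T2_def)
  have TT2: "T \<subseteq> T2" by (rule S_gen[OF T2]) (use ext S_down S_mod in \<open>auto simp: T2_def\<close>)
  have below: "T \<subseteq> T1" if c: "tors_cover sm T1 T2" for T1
  proof (rule S_gen[OF coverD(1)[OF c]], rule subsetI, rule ccontr)
    fix X assume X: "X \<in> S" "X \<notin> T1"
    obtain Z where Z: "is_label T1 T2 Z" by (rule label_exists[OF c])
    note LZ = labelD[OF Z]
    obtain f where f: "mor X Z f" "f \<noteq> nul X Z" using cover_hom[OF c _ X(2) LZ(7,8,6)] S_T[OF X(1)] TT2 by blast
    have np: "\<not> projective sm X" using noproj[OF S_T[OF X(1)]] S_nz[OF X(1)] by blast
    obtain E \<pi> where E: "epi E X \<pi>" and nonsplit: "\<And>s. mor X E s \<Longrightarrow> s * \<pi> \<noteq> ident X"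
        and Eext: "\<And>Y. Y \<in> S \<Longrightarrow> ext1_zero sm Y E"
      using nonsplit_epi_ext1_zero[OF finS S_mod ext[OF S_down S_down] S_iso X(1) np] by blast
    note mpi = epi_mor[OF E]
    have ET2: "E \<in> T2" using Eext mor_mod(1)[OF mpi] unfolding T2_def by blast
    have "\<pi> * f \<noteq> nul E Z" using epi_cancel_nul[OF E f(1)] f(2) by blast
    then have epiZ: "epi E Z (\<pi> * f)" by (rule label_epi[OF Z ET2 mor_comp[OF mpi f(1)]])
    obtain G \<iota> where G: "ses sm G \<iota> E (\<pi> * f) Z" by (rule kernel[OF epiZ])
    \<comment> \<open>G is not yet known to lie in T2, so its torsion-free quotient C is examined.
      The pushout E' is a quotient of E, hence in T2, while the kernel C of q receives nothing
      nonzero from T2; so \<open>label_split\<close> splits q.\<close>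
    obtain N n C g where rad: "ses sm N n G g C" "N \<in> T2" "C \<in> perp sm T2"
      by (rule torsion_radical[OF T2 mor_mod(1)[OF mono_mor[OF sesD(1)[OF G]]]])
    obtain E' j q k where po: "ses sm C j E' q Z" "mor E E' k" "\<iota> * k = g * j" "k * q = \<pi> * f"
      by (rule pushout[OF G epi_mor[OF sesD(2)[OF rad(1)]]])
    note P = sesD[OF po(1)]
    have kepi: "epi E E' k"
      by (rule pushout_epi[OF G sesD(2)[OF rad(1)] po])
    have E'T2: "E' \<in> T2" by (rule tc_quot[OF T2 ET2 kepi])
    have "h = nul V E'" if V: "V \<in> T2" and h: "mor V E' h" "h * q = nul V Z" for V h
    proof -
      obtain u where u: "mor V C u" "u * j = h" by (rule ses_lift[OF po(1) h])
      have "u = nul V C" by (rule perpD[OF rad(3) V u(1)])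
      then show ?thesis using u comp_nul(1)[OF mono_mor[OF P(1)]] by simp
    qed
    moreover have "E' \<notin> perp sm T2" using perp_zero[OF E'T2] P(4) LZ(6) by auto
    ultimately obtain s where s: "mor Z E' s" "s * q = ident Z" using label_split[OF Z epi_mor[OF P(2)]] by blast
    obtain r where r: "mor E' C r" "j * r = ident C" by (rule section_retraction[OF po(1) s])
    \<comment> \<open>The splitting makes C a quotient of E', hence a module of T2, and G is an
      extension of C by N.\<close>
    have "epi E' C r" using r mor_dims[OF mono_mor[OF P(1)]] by (intro epiI) auto
    then have "C \<in> T2" by (rule tc_quot[OF T2 E'T2])
    then have "G \<in> T2" using tc_ext[OF T2 rad(1,2)] by blast
    then have "ext1_zero sm X G" using X(1) unfolding T2_def by blast
    then obtain w where w: "mor X E w" "w * (\<pi> * f) = f" by (rule ext1_zero_hom_lift[OF G _ f(1)])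
    have wf: "(w * \<pi>) * f = f" using w comp_assoc[OF w(1) mpi f(1)] by simp
    \<comment> \<open>Since (w * \<pi>) * f = f is nonzero, w * \<pi> is a nonzero endomorphism of
      the brick X; its inverse turns w into a section of \<pi>.\<close>
    have "w * \<pi> \<noteq> nul X X" using wf f comp_nul(1)[OF f(1)] by auto
    then obtain v where v: "mor X X v" "v * (w * \<pi>) = ident X"
      using brick_inverse[OF S_brick[OF X(1)] mor_comp[OF w(1) mpi]] by blast
    then show False using nonsplit[OF mor_comp[OF v(1) w(1)]] comp_assoc[OF v(1) w(1) mpi] by simp
  qed
  \<comment> \<open>Dividing a module perpendicular to T by a submodule in T2 keeps it
    perpendicular: Ext(X, I) = 0 lifts a map X \<rightarrow> N' to N, where it must vanish.\<close>
  have W_coker: "N' \<in> perp sm T" if s: "ses sm I u N g N'" and I: "I \<in> T2" and N: "N \<in> perp sm T" for I u N g N'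
  proof -
    note Ss = sesD[OF s]
    have N': "is_mod sm N'" using mor_mod(2)[OF epi_mor[OF Ss(2)]] .
    have "f = nul X N'" if X: "X \<in> S" and f: "mor X N' f" for X f
    proof -
      have "ext1_zero sm X I" using I X unfolding T2_def by blast
      then obtain k where k: "mor X N k" "k * g = f" by (rule ext1_zero_hom_lift[OF s _ f])
      have "k = nul X N" by (rule perpD[OF N S_T[OF X] k(1)])
      then show ?thesis using k comp_nul(1)[OF epi_mor[OF Ss(2)]] by simp
    qed
    then have "T \<subseteq> {V \<in> T. \<forall>f. mor V N' f \<longrightarrow> f = nul V N'}"
      using S_T by (intro S_gen[OF tc_left_orth[OF T]]) blast
    then show ?thesis using N' by (intro perpI[OF _ _ T]) blast+
  qed
  have above: "\<exists>T1. tors_cover sm T1 T2 \<and> M \<notin> T1" if M: "M \<in> T2" "M \<notin> T" for M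
  proof -
    obtain R n C g where rad: "ses sm R n M g C" "R \<in> T" "C \<in> perp sm T"
      by (rule torsion_radical[OF T tc_mod[OF T2 M(1)]])
    let ?P = "\<lambda>N. (\<exists>g. epi M N g) \<and> N \<in> perp sm T \<and> fst N \<noteq> 0"
    have "fst C \<noteq> 0" using tc_ext[OF T rad(1,2)] tc_zero[OF T perp_mod[OF rad(3)]] M(2) by blast
    then have "?P C" using sesD(2)[OF rad(1)] rad(3) by blast
    then obtain N where N: "?P N" and min: "\<And>N'. ?P N' \<Longrightarrow> fst N \<le> fst N'"
      using ex_has_least_nat[of ?P C fst] by blast
    obtain a where a: "epi M N a" using N by blast
    have NT2: "N \<in> T2" by (rule tc_quot[OF T2 M(1) a])
    \<comment> \<open>Otherwise the cokernel of the image of f would be a smaller nonzero quotient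
      of M perpendicular to T, against the choice of N.\<close>
    have onto: "epi V N f" if V: "V \<in> T2" and f: "mor V N f" "f \<noteq> nul V N" for V f
    proof -
      obtain I e u where ei: "epi V I e" "mono I N u" "f = e * u" by (rule image[OF f(1)])
      have I0: "fst I \<noteq> 0" using f(2) ei mor_through_zero epi_mor mono_mor by blast
      obtain N' b where s: "ses sm I u N b N'" by (rule cokernel[OF ei(2)])
      have "N' \<in> perp sm T" using W_coker[OF s tc_quot[OF T2 V ei(1)]] N by blast
      moreover have "fst N' < fst N" using sesD(4)[OF s] I0 by simp
      moreover have "epi M N' (a * b)" by (rule epi_comp[OF a sesD(2)[OF s]])
      ultimately have "fst N' = 0" using min[of N'] by force
      then have "fst N \<le> fst I" using sesD(4)[OF s] by simp
      then show ?thesis unfolding ei(3) using epi_comp[OF ei(1) mono_epi[OF ei(2)]] by blast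
    qed
    \<comment> \<open>This class omits N, so it is contained in some lower cover T1, and the label
      of T1 must have a nonzero map to N.\<close>
    let ?U = "{V \<in> T2. \<forall>f. mor V N f \<longrightarrow> f = nul V N}"
    have "ident N \<noteq> nul N N" using N ident_nul[of N] by auto
    then have "N \<notin> ?U" using mor_id[OF tc_mod[OF T2 NT2]] by blast
    then have "?U \<subset> T2" using NT2 by blast
    then obtain T1 where T1: "tors_cover sm T1 T2" "?U \<subseteq> T1" by (rule below_cover[OF tors_finite T2 tc_left_orth[OF T2]])
    obtain Z where Z: "is_label T1 T2 Z" by (rule label_exists[OF T1(1)])
    note LZ = labelD[OF Z]
    have "T \<subseteq> T1" using below[OF T1(1)] .
    then have Zperp: "Z \<in> perp sm T" using perp_mono LZ(8) by blast
    have "Z \<notin> ?U" using T1(2) LZ(9) by blast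
    then obtain f where f: "mor Z N f" "f \<noteq> nul Z N" using LZ(7) by blast
    have fe: "epi Z N f" by (rule onto[OF LZ(7) f])
    obtain L u where s: "ses sm L u Z f N" by (rule kernel[OF fe])
    note Ss = sesD[OF s]
    note mu = mono_mor[OF Ss(1)]
    \<comment> \<open>The kernel L lies in T2 because Z does and N receives nothing from S. A
      nonzero inclusion L \<rightarrow> Z would be onto by \<open>label_epi\<close> and make f zero,
      so Z is isomorphic to N.\<close>
    have "ext1_zero sm X L" if X: "X \<in> S" for X
    proof (rule ext1_zero_kernel[OF s S_mod[OF X]])
      show "ext1_zero sm X Z" using LZ(7) X unfolding T2_def by blast
      show "h = nul X N" if "mor X N h" for h using perpD[OF _ S_T[OF X] that] N by blast
    qed
    then have LT2: "L \<in> T2" using mor_mod(1)[OF mu] unfolding T2_def by blast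
    have "u = nul L Z"
    proof (rule ccontr)
      assume "u \<noteq> nul L Z"
      then have "epi L Z u" by (rule label_epi[OF Z LT2 mu])
      then have "f = nul Z N" using epi_cancel_nul f(1) Ss(3) by blast
      then show False using f(2) by blast
    qed
    then have "ident L * u = nul L L * u" using mu mor_dims[OF mu] by simp
    then have "ident L = nul L L" by (rule mono_cancel[OF Ss(1), rotated 2]) auto
    then have "fst L = 0" by (rule ident_nul)
    then have "fst Z \<le> fst N" using Ss(4) by simp
    then obtain f' where f': "mor N Z f'" "f * f' = ident Z" "f' * f = ident N" by (rule epi_iso[OF fe])
    have "epi N Z f'" using f' mor_dims[OF f(1)] by (intro epiI) auto
    then have "N \<notin> T1" using tc_quot[OF LZ(2)] LZ(9) by blast
    then have "M \<notin> T1" using tc_quot[OF LZ(2) _ a] by blast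
    then show ?thesis using T1(1) by blast
  qed
  have "pop_down sm T2 = T"
  proof
    show "pop_down sm T2 \<subseteq> T" using above unfolding pop_down_def by blast
    show "T \<subseteq> pop_down sm T2" using TT2 below unfolding pop_down_def by blast
  qed
  then show ?thesis using T2 by blast
qed

theorem pop_down_image_iff:
  assumes T: "torsion_class sm T"
  shows "(\<exists>T'. torsion_class sm T' \<and> pop_down sm T' = T) \<longleftrightarrow>
           (\<forall>X\<in>down_labels sm T. \<forall>X'\<in>down_labels sm T. ext1_zero sm X X') \<and>
           (\<forall>P\<in>T. projective sm P \<longrightarrow> fst P = 0)"
  using pop_down_preimage[OF T] pop_down_ext1_zero[OF _ T] pop_down_no_projective by blast

end

section \<open>Enough projectives\<close>

text \<open>\<open>fd_algebra\<close> provides only a finite spanning family. A basis extracted from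
  it has linear coordinate functions, which turn right multiplication into matrices.\<close>

lemma fd_algebra_coordinates:
  fixes sm :: "'k::field \<Rightarrow> 'a::ring_1 \<Rightarrow> 'a"
  assumes fd: "fd_algebra sm"
  obtains co :: "'a \<Rightarrow> nat \<Rightarrow> 'k" and bs :: "nat \<Rightarrow> 'a" and d :: nat where
    "\<And>x. (\<Sum>j<d. sm (co x j) (bs j)) = x" "\<And>i j. i < d \<Longrightarrow> j < d \<Longrightarrow> co (bs i) j = (if i = j then 1 else 0)"
    "\<And>x y j. co (x + y) j = co x j + co y j" "\<And>c x j. co (sm c x) j = c * co x j"
proof -
  interpret vs: vector_space sm
    using fd unfolding fd_algebra_def by unfold_locales metis+
  obtain B0 where B0: "finite B0" "\<And>x. \<exists>co. x = (\<Sum>b\<in>B0. sm (co b) b)"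
    using fd unfolding fd_algebra_def by blast
  have span0: "vs.span B0 = UNIV"
  proof -
    have "x \<in> vs.span B0" for x
    proof -
      obtain co where x: "x = (\<Sum>b\<in>B0. sm (co b) b)" using B0(2) by blast
      show ?thesis unfolding x by (intro vs.span_sum vs.span_scale vs.span_base)
    qed
    then show ?thesis by blast
  qed
  obtain B where B: "B \<subseteq> B0" "vs.independent B" "B0 \<subseteq> vs.span B"
    using vs.maximal_independent_subset[of B0] by blast
  have spanB: "x \<in> vs.span B" for x
    using vs.span_minimal[OF B(3) vs.subspace_span] span0 by blast
  have finB: "finite B" using B(1) B0(1) finite_subset by blast
  then obtain bs where bs: "bij_betw bs {..<card B} B"
    using ex_bij_betw_nat_finite[of B] by (auto simp: lessThan_atLeast0)
  let ?co = "\<lambda>x j. vs.representation B x (bs j)"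
  show thesis
  proof (rule that[of ?co bs "card B"])
    show "(\<Sum>j<card B. sm (?co x j) (bs j)) = x" for x
    proof -
      have "(\<Sum>j<card B. sm (?co x j) (bs j)) = (\<Sum>b\<in>B. sm (vs.representation B x b) b)"
        by (rule sum.reindex_bij_betw[OF bs])
      also have "\<dots> = x" by (rule vs.sum_representation_eq[OF B(2) spanB finB]) simp
      finally show ?thesis .
    qed
    show "?co (bs i) j = (if i = j then 1 else 0)" if "i < card B" "j < card B" for i j
    proof -
      have "bs i \<in> B" using bs that(1) by (auto simp: bij_betw_def)
      moreover have "bs j = bs i \<longleftrightarrow> i = j" using bs that by (auto simp: bij_betw_def inj_on_def)
      ultimately show ?thesis using vs.representation_basis[OF B(2)] by simp
    qed
    show "?co (x + y) j = ?co x j + ?co y j" for x y j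
      using vs.representation_add[OF B(2) spanB spanB] by simp
    show "?co (sm c x) j = c * ?co x j" for c x j
      using vs.representation_scale[OF B(2) spanB] by simp
  qed
qed

context module_category begin

lemma projective_mod: "projective sm P \<Longrightarrow> is_mod sm P"
  by (simp add: projective_def)

lemma projectiveI:
  assumes "is_mod sm P"
    and "\<And>M N g h. epi M N g \<Longrightarrow> mor P N h \<Longrightarrow> \<exists>k. mor P M k \<and> k * g = h"
  shows "projective sm P"
  using assms unfolding projective_def epi_def mor_def by meson

lemma projective_zero: "projective sm (0, \<lambda>a. 0\<^sub>m 0 0)"
proof (rule projectiveI[OF zero_module])
  fix M N g h assume g: "epi M N g" and h: "mor (0, \<lambda>a. 0\<^sub>m 0 0) N h"
  have "nul (0, \<lambda>a. 0\<^sub>m 0 0) M * g = h"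
    using mor_zero_source[OF h] mor_dims[OF epi_mor[OF g]] by simp
  then show "\<exists>k. mor (0, \<lambda>a. 0\<^sub>m 0 0) M k \<and> k * g = h"
    using mor_nul[OF zero_module mor_mod(1)[OF epi_mor[OF g]]] by blast
qed

lemma projective_direct_sum:
  assumes P: "projective sm P" and Q: "projective sm Q"
    and js: "mor P E j" "mor E Q q" "mor Q E \<sigma>" "mor E P r" "q * \<sigma> + r * j = ident E"
  shows "projective sm E"
proof (rule projectiveI)
  show "is_mod sm E" using js(1) mor_mod by blast
  fix M N g h assume g: "epi M N g" and h: "mor E N h"
  obtain k where k: "mor P M k" "k * g = j * h" by (rule projective_lift[OF P g mor_comp[OF js(1) h]])
  obtain l where l: "mor Q M l" "l * g = \<sigma> * h" by (rule projective_lift[OF Q g mor_comp[OF js(3) h]])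
  note d = mor_dims[OF js(1)] mor_dims[OF js(2)] mor_dims[OF js(3)] mor_dims[OF js(4)] mor_dims[OF k(1)]
    mor_dims[OF l(1)] mor_dims[OF h] mor_dims[OF epi_mor[OF g]]
  have "(q * l + r * k) * g = q * (l * g) + r * (k * g)" using d by (simp add: mat_distr mat_assoc)
  also have "\<dots> = (q * \<sigma> + r * j) * h" unfolding k(2) l(2) using d by (simp add: mat_distr mat_assoc)
  also have "\<dots> = h" unfolding js(5) using d by simp
  finally show "\<exists>k. mor E M k \<and> k * g = h"
    using mor_add[OF mor_comp[OF js(2) l(1)] mor_comp[OF js(4) k(1)]] by blast
qed

text \<open>R is the algebra as a right module over itself and u is the coordinate row of 1.
  Morphisms R \<rightarrow> M correspond to vectors of M by evaluation at 1, which yields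
  projectivity.\<close>

lemma regular_module:
  assumes fd: "fd_algebra sm"
  obtains R u where "projective sm R" "dim_row u = 1" "dim_col u = fst R"
    "\<And>M w. is_mod sm M \<Longrightarrow> dim_row w = 1 \<Longrightarrow> dim_col w = fst M \<Longrightarrow> \<exists>k. mor R M k \<and> u * k = w"
proof -
  obtain co :: "'a \<Rightarrow> nat \<Rightarrow> 'k" and bs :: "nat \<Rightarrow> 'a" and d :: nat where co: "\<And>x. (\<Sum>j<d. sm (co x j) (bs j)) = x"
    "\<And>i j. i < d \<Longrightarrow> j < d \<Longrightarrow> co (bs i) j = (if i = j then 1 else 0)"
    "\<And>x y j. co (x + y) j = co x j + co y j" "\<And>c x j. co (sm c x) j = c * co x j"
    by (rule fd_algebra_coordinates[OF fd]) (rule that)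
  have sm_mult: "sm c x * y = sm c (x * y)" "x * sm c y = sm c (x * y)" for c x y
    using fd unfolding fd_algebra_def by metis+
  \<comment> \<open>A linear functional is recovered from its values on the basis; the actions on R
    and on M are computed with this.\<close>
  have linear: "(\<Sum>k<d. co x k * \<phi> (bs k)) = \<phi> x"
    if add: "\<And>x y. \<phi> (x + y) = \<phi> x + \<phi> y" and sc: "\<And>c x. \<phi> (sm c x) = c * \<phi> x" for x and \<phi> :: "'a \<Rightarrow> 'k"
  proof -
    have z: "\<phi> 0 = 0" using add[of 0 0] by (metis add_0_right add_left_imp_eq)
    have "\<phi> (\<Sum>k\<in>A. sm (co x k) (bs k)) = (\<Sum>k\<in>A. co x k * \<phi> (bs k))" if "finite A" for A
      using that by (induction A) (auto simp: z add sc)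
    from this[of "{..<d}"] show ?thesis using co(1)[of x] by simp
  qed
  define \<rho> where "\<rho> = (\<lambda>a. mat d d (\<lambda>(i,j). co (bs i * a) j))"
  define R where "R = (d, \<rho>)"
  define cv where "cv = (\<lambda>x. mat 1 d (\<lambda>(i,j). co x j))"
  have co_mult: "(\<Sum>k<d. co x k * co (bs k * a) j) = co (x * a) j" for x a j
    by (rule linear) (auto simp: distrib_right co sm_mult)
  have R: "is_mod sm R" unfolding is_mod_def R_def fst_conv snd_conv
  proof (intro conjI allI)
    show "\<rho> a \<in> carrier_mat d d" for a by (simp add: \<rho>_def)
    show "\<rho> 1 = 1\<^sub>m d" by (rule eq_matI) (auto simp: \<rho>_def co(2))
    show "\<rho> (a * b) = \<rho> a * \<rho> b" for a b
    proof (rule eq_matI)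
      fix i j assume ij: "i < dim_row (\<rho> a * \<rho> b)" "j < dim_col (\<rho> a * \<rho> b)"
      then have "(\<rho> a * \<rho> b) $$ (i,j) = (\<Sum>k<d. co (bs i * a) k * co (bs k * b) j)"
        by (simp add: \<rho>_def scalar_prod_def lessThan_atLeast0)
      then show "\<rho> (a * b) $$ (i,j) = (\<rho> a * \<rho> b) $$ (i,j)" using ij unfolding co_mult by (simp add: \<rho>_def mult.assoc)
    qed (auto simp: \<rho>_def)
    show "\<rho> (a + b) = \<rho> a + \<rho> b" for a b by (rule eq_matI) (auto simp: \<rho>_def co(3) distrib_left)
    show "\<rho> (sm c a) = c \<cdot>\<^sub>m \<rho> a" for c a by (rule eq_matI) (auto simp: \<rho>_def co(4) sm_mult)
  qed
  have act: "(\<Sum>k<d. co x k * (w * snd M (bs k)) $$ (0,j)) = (w * snd M x) $$ (0,j)"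
    if M: "is_mod sm M" and w: "dim_row w = 1" "dim_col w = fst M" and j: "j < fst M" for M w x j
  proof (rule linear)
    note dM = mod_dims[OF M]
    show "(w * snd M (x + y)) $$ (0,j) = (w * snd M x) $$ (0,j) + (w * snd M y) $$ (0,j)" for x y
      using M w j dM[of x] dM[of y] by (simp add: is_mod_def mat_distr)
    show "(w * snd M (sm c x)) $$ (0,j) = c * (w * snd M x) $$ (0,j)" for c x
      using M w j dM[of x] by (simp add: is_mod_def mat_smult)
  qed
  \<comment> \<open>The morphism that sends 1 to w, and hence the basis vector bs i to w acted on by
    bs i.\<close>
  define K :: "('a,'k) rmod \<Rightarrow> 'k mat \<Rightarrow> 'k mat" where "K = (\<lambda>M w. mat d (fst M) (\<lambda>(i,j). (w * snd M (bs i)) $$ (0,j)))"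
  have K: "mor R M (K M w) \<and> cv 1 * K M w = w"
    if M: "is_mod sm M" and w: "dim_row w = 1" "dim_col w = fst M" for M w
  proof
    note dM = mod_dims[OF M]
    show "mor R M (K M w)"
    proof (rule morI[OF R M])
      fix a
      show "snd R a * K M w = K M w * snd M a"
      proof (rule eq_matI)
        fix i j assume "i < dim_row (K M w * snd M a)" "j < dim_col (K M w * snd M a)"
        then have ij: "i < d" "j < fst M" using dM by (auto simp: K_def)
        have "(snd R a * K M w) $$ (i,j) = (\<Sum>k<d. co (bs i * a) k * (w * snd M (bs k)) $$ (0,j))"
          using ij by (simp add: R_def \<rho>_def K_def scalar_prod_def lessThan_atLeast0)
        also have "\<dots> = (w * snd M (bs i * a)) $$ (0,j)" by (rule act[OF M w ij(2)])
        also have "w * snd M (bs i * a) = (w * snd M (bs i)) * snd M a"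
          using M w dM by (simp add: is_mod_def mat_assoc)
        also have "\<dots> $$ (0,j) = (K M w * snd M a) $$ (i,j)"
          using ij w dM by (simp add: K_def scalar_prod_def)
        finally show "(snd R a * K M w) $$ (i,j) = (K M w * snd M a) $$ (i,j)" .
      qed (use dM in \<open>auto simp: R_def \<rho>_def K_def\<close>)
    qed (auto simp: R_def K_def)
    show "cv 1 * K M w = w"
    proof (rule eq_matI)
      fix i j assume "i < dim_row w" "j < dim_col w"
      then have ij: "i = 0" "j < fst M" using w by auto
      have "(cv 1 * K M w) $$ (i,j) = (\<Sum>k<d. co 1 k * (w * snd M (bs k)) $$ (0,j))"
        using ij by (simp add: cv_def K_def scalar_prod_def lessThan_atLeast0)
      also have "\<dots> = (w * snd M 1) $$ (0,j)" by (rule act[OF M w ij(2)])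
      also have "\<dots> = w $$ (i,j)" using M w ij by (simp add: is_mod_def)
      finally show "(cv 1 * K M w) $$ (i,j) = w $$ (i,j)" .
    qed (use w in \<open>auto simp: cv_def K_def\<close>)
  qed
  have unique: "h = K N (cv 1 * h)" if h: "mor R N h" for N h
  proof (rule eq_matI)
    note dh = mor_dims[OF h]
    have dR: "fst R = d" by (simp add: R_def)
    fix i j assume "i < dim_row (K N (cv 1 * h))" "j < dim_col (K N (cv 1 * h))"
    then have ij: "i < d" "j < fst N" by (auto simp: K_def)
    have "(cv 1 * h) * snd N (bs i) = (cv 1 * \<rho> (bs i)) * h"
      using dh dR mor_eq[OF h, of "bs i"] by (simp add: mat_assoc cv_def R_def \<rho>_def)
    also have "cv 1 * \<rho> (bs i) = cv (bs i)"
    proof (rule eq_matI)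
      fix a b assume "a < dim_row (cv (bs i))" "b < dim_col (cv (bs i))"
      then have ab: "a = 0" "b < d" by (auto simp: cv_def)
      have "(cv 1 * \<rho> (bs i)) $$ (a,b) = (\<Sum>k<d. co 1 k * co (bs k * bs i) b)"
        using ab by (simp add: cv_def \<rho>_def scalar_prod_def lessThan_atLeast0)
      then show "(cv 1 * \<rho> (bs i)) $$ (a,b) = cv (bs i) $$ (a,b)" unfolding co_mult using ab by (simp add: cv_def)
    qed (auto simp: cv_def \<rho>_def)
    finally have "((cv 1 * h) * snd N (bs i)) $$ (0,j) = (cv (bs i) * h) $$ (0,j)" by simp
    also have "\<dots> = (\<Sum>k<d. (if i = k then 1 else 0) * h $$ (k,j))"
      using ij dh dR co(2) by (simp add: cv_def scalar_prod_def lessThan_atLeast0)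
    also have "\<dots> = (\<Sum>k<d. if k = i then h $$ (k,j) else 0)" by (rule sum.cong) auto
    also have "\<dots> = h $$ (i,j)" using ij by simp
    finally show "h $$ (i,j) = K N (cv 1 * h) $$ (i,j)" using ij by (simp add: K_def)
  qed (use mor_dims[OF h] in \<open>auto simp: K_def R_def\<close>)
  have "projective sm R"
  proof (rule projectiveI[OF R])
    fix M N g h assume g: "epi M N g" and h: "mor R N h"
    obtain s where s: "s \<in> carrier_mat (fst N) (fst M)" "s * g = ident N"
      using g by (auto simp: epi_def surj_map_def)
    note dh = mor_dims[OF h] mor_dims[OF epi_mor[OF g]]
    \<comment> \<open>The image of 1 under h, lifted linearly through g. The morphism with this
      value at 1, followed by g, agrees with h at 1 and therefore everywhere, by
      \<open>unique\<close>.\<close>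
    let ?w = "(cv 1 * h) * s"
    have dc: "dim_row (cv 1) = 1" "dim_col (cv 1) = fst R" by (auto simp: cv_def R_def)
    have k: "mor R M (K M ?w)" "cv 1 * K M ?w = ?w"
      using K[of M ?w] mor_mod(1)[OF epi_mor[OF g]] s dc by auto
    have "cv 1 * (K M ?w * g) = (cv 1 * K M ?w) * g" using dc dh mor_dims[OF k(1)] by (simp add: mat_assoc)
    also have "\<dots> = (cv 1 * h) * (s * g)" unfolding k(2) using s(1) dc dh by (simp add: mat_assoc)
    also have "\<dots> = cv 1 * h" unfolding s(2) using dh by simp
    finally have "K M ?w * g = h" using unique[OF h] unique[OF mor_comp[OF k(1) epi_mor[OF g]]] by simp
    then show "\<exists>k. mor R M k \<and> k * g = h" using k(1) by blast
  qed
  then show thesis by (rule that[of R "cv 1"]) (use K in \<open>auto simp: cv_def R_def\<close>)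
qed

text \<open>One copy of the regular module is added for each basis vector of X, so that after c
  steps the first c basis vectors are in the image.\<close>

lemma fd_algebra_enough_projectives:
  assumes fd: "fd_algebra sm" and X: "is_mod sm X"
  shows "\<exists>P p. projective sm P \<and> epi P X p"
proof -
  obtain R u where R: "projective sm R" "dim_row u = 1" "dim_col u = fst R"
    "\<And>M w. is_mod sm M \<Longrightarrow> dim_row w = 1 \<Longrightarrow> dim_col w = fst M \<Longrightarrow> \<exists>k. mor R M k \<and> u * k = w"
    by (rule regular_module[OF fd]) blast
  let ?n = "fst X"
  define e where "e = (\<lambda>i. mat 1 ?n (\<lambda>(a,j). if j = i then 1 else (0::'k)))"
  have "\<exists>P f. projective sm P \<and> mor P X f \<and> (\<forall>i<c. \<exists>v. dim_row v = 1 \<and> dim_col v = fst P \<and> v * f = e i)" for c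
  proof (induction c)
    case 0
    show ?case using projective_zero mor_nul[OF zero_module X] by blast
  next
    case (Suc c)
    then obtain P f where P: "projective sm P" "mor P X f"
      and v: "\<And>i. i < c \<Longrightarrow> \<exists>v. dim_row v = 1 \<and> dim_col v = fst P \<and> v * f = e i" by blast
    obtain E j \<sigma> r q where js: "mor P E j" "mor E R q" "mor R E \<sigma>" "mor E P r"
      "j * r = ident P" "\<sigma> * q = ident R" "j * q = nul P R" "\<sigma> * r = nul R P" "q * \<sigma> + r * j = ident E"
      by (rule direct_sum[OF projective_mod[OF P(1)] projective_mod[OF R(1)]])
    obtain k where k: "mor R X k" "u * k = e c" using R(4)[OF X, of "e c"] by (auto simp: e_def)
    note d = mor_dims[OF js(1)] mor_dims[OF js(2)] mor_dims[OF js(3)] mor_dims[OF js(4)] mor_dims[OF k(1)] mor_dims[OF P(2)]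
    let ?f = "r * f + q * k"
    have jf: "j * ?f = f"
    proof -
      have "j * ?f = (j * r) * f + (j * q) * k" using d by (simp add: mat_distr mat_assoc)
      then show ?thesis unfolding js using d by simp
    qed
    have sf: "\<sigma> * ?f = k"
    proof -
      have "\<sigma> * ?f = (\<sigma> * r) * f + (\<sigma> * q) * k" using d by (simp add: mat_distr mat_assoc)
      then show ?thesis unfolding js using d by simp
    qed
    have "\<exists>v. dim_row v = 1 \<and> dim_col v = fst E \<and> v * ?f = e i" if i: "i < Suc c" for i
    proof (cases "i = c")
      case True
      have "(u * \<sigma>) * ?f = u * (\<sigma> * ?f)" using d R(2,3) by (intro mat_assoc) auto
      then have "(u * \<sigma>) * ?f = e i" unfolding sf k(2) True .
      then show ?thesis using d R(2) by (intro exI[of _ "u * \<sigma>"]) auto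
    next
      case False
      then obtain w where w: "dim_row w = 1" "dim_col w = fst P" "w * f = e i" using v[of i] i by auto
      have "(w * j) * ?f = w * (j * ?f)" using d w by (intro mat_assoc) auto
      then have "(w * j) * ?f = e i" unfolding jf w(3) .
      then show ?thesis using d w by (intro exI[of _ "w * j"]) auto
    qed
    moreover have "projective sm E" by (rule projective_direct_sum[OF P(1) R(1) js(1-4,9)])
    moreover have "mor E X ?f" by (rule mor_add[OF mor_comp[OF js(4) P(2)] mor_comp[OF js(2) k(1)]])
    ultimately show ?case by blast
  qed
  then obtain P f where P: "projective sm P" "mor P X f"
    and "\<forall>i<?n. \<exists>v. dim_row v = 1 \<and> dim_col v = fst P \<and> v * f = e i" by blast
  then obtain v where v: "\<And>i. i < ?n \<Longrightarrow> dim_row (v i) = 1 \<and> dim_col (v i) = fst P \<and> v i * f = e i" by metis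
  define s where "s = mat ?n (fst P) (\<lambda>(i,j). v i $$ (0,j))"
  note d = mor_dims[OF P(2)]
  have "s * f = ident X"
  proof (rule eq_matI)
    fix i j assume "i < dim_row (ident X)" "j < dim_col (ident X)"
    then have ij: "i < ?n" "j < ?n" by auto
    have vi: "dim_row (v i) = 1" "dim_col (v i) = fst P" using v[OF ij(1)] by auto
    have "(s * f) $$ (i,j) = (v i * f) $$ (0,j)" using ij d vi by (simp add: s_def scalar_prod_def)
    also have "\<dots> = ident X $$ (i,j)" using v[OF ij(1)] ij by (simp add: e_def)
    finally show "(s * f) $$ (i,j) = ident X $$ (i,j)" .
  qed (use d in \<open>auto simp: s_def\<close>)
  then have "epi P X f" using P(2) by (intro epiI) (auto simp: s_def)
  then show ?thesis using P(1) by blast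
qed


section \<open>Perpendicular classes under extensions and the double perpendicular\<close>

lemma perp_ext:
  assumes T: "torsion_class sm T" and s: "ses sm Y f E g X" and Y: "Y \<in> perp sm T" and X: "X \<in> perp sm T"
  shows "E \<in> perp sm T"
proof (rule perpI[OF _ _ T])
  note S = sesD[OF s]
  show "is_mod sm E" using mor_mod(2)[OF mono_mor[OF S(1)]] .
  fix N h assume N: "N \<in> T" and h: "mor N E h"
  have "h * g = nul N X" using perpD[OF X N mor_comp[OF h epi_mor[OF S(2)]]] .
  then obtain u where u: "mor N Y u" "u * f = h" by (rule ses_lift[OF s h])
  have "u = nul N Y" using perpD[OF Y N u(1)] .
  then show "h = nul N E" using u comp_nul(1)[OF mono_mor[OF S(1)]] by simp
qed

lemma perp_zero_module: "is_mod sm M \<Longrightarrow> fst M = 0 \<Longrightarrow> torsion_class sm T \<Longrightarrow> M \<in> perp sm T"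
  by (rule perpI) (use mor_zero_target[of _ M] in blast)+

text \<open>The torsion-free quotient of M receives only the zero map from M, although M maps onto
  it; so it is zero and M is its own torsion part.\<close>

lemma double_perp:
  assumes T: "torsion_class sm T" and M: "is_mod sm M"
    and orth: "\<And>N f. N \<in> perp sm T \<Longrightarrow> mor M N f \<Longrightarrow> f = nul M N"
  shows "M \<in> T"
proof -
  obtain N n C g where s: "ses sm N n M g C" "N \<in> T" "C \<in> perp sm T" by (rule torsion_radical[OF T M])
  note S = sesD[OF s(1)]
  note mg = epi_mor[OF S(2)]
  have "g = nul M C" by (rule orth[OF s(3) mg])
  then have "g * ident C = g * nul C C" using mg by simp
  then have "ident C = nul C C" by (rule epi_cancel[OF S(2), rotated 2]) auto
  then have "C \<in> T" by (intro tc_zero[OF T perp_mod[OF s(3)]] ident_nul)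
  then show ?thesis using tc_ext[OF T s(1,2)] by blast
qed

lemma tc_pop_down:
  assumes T: "torsion_class sm T"
  shows "torsion_class sm (pop_down sm T)"
proof (rule tcI)
  show "is_mod sm M" if "M \<in> pop_down sm T" for M using that tc_mod[OF T] by (auto simp: pop_down_def)
  show "M \<in> pop_down sm T" if "is_mod sm M" "fst M = 0" for M
    using tc_zero[OF _ that] T coverD(1) by (auto simp: pop_down_def)
  show "N \<in> pop_down sm T" if "M \<in> pop_down sm T" "epi M N g" for M N g
    using that(1) tc_quot[OF _ _ that(2)] T coverD(1) unfolding pop_down_def by blast
  show "E \<in> pop_down sm T" if "ses sm Y f E g X" "Y \<in> pop_down sm T" "X \<in> pop_down sm T" for Y f E g X
    using that(2,3) tc_ext[OF _ that(1)] T coverD(1) unfolding pop_down_def by blast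
qed

end

context hereditary_category begin

text \<open>Right exactness of Ext(X, -) carries Ext(X, I) = 0 over to the quotient J. Heredity of
  the opposite algebra is obtained from this dual form.\<close>

lemma injective_quotient:
  assumes I: "injective sm I" and g: "epi I J g"
  shows "injective sm J"
proof -
  have ext: "ext1_zero sm X I" for X unfolding ext1_zero_def
  proof (intro allI impI)
    fix f E p assume s: "ses sm I f E p X"
    note mf = mono_mor[OF sesD(1)[OF s]]
    obtain k where k: "mor E I k" "f * k = ident I"
      using I sesD(1)[OF s] mor_id[OF mor_mod(1)[OF mf]]
      unfolding injective_def mono_def mor_def by meson
    show "\<exists>s. is_hom X E s \<and> s * p = ident X"
      by (rule retraction_section[OF s k]) (auto simp: mor_def)
  qed
  have J: "is_mod sm J" using mor_mod(2)[OF epi_mor[OF g]] .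
  have Im: "is_mod sm I" using mor_mod(1)[OF epi_mor[OF g]] .
  show ?thesis unfolding injective_def
  proof (intro conjI allI impI)
    fix M N u h assume "is_mod sm M \<and> is_mod sm N \<and> is_hom M N u \<and> inj_map (fst M) (fst N) u \<and> is_hom M J h"
    then have u: "mono M N u" and h: "mor M J h" using J by (auto simp: mono_def mor_def)
    obtain X q where s: "ses sm M u N q X" by (rule cokernel[OF u])
    have X: "is_mod sm X" using mor_mod(2)[OF epi_mor[OF sesD(2)[OF s]]] .
    have "ext1_zero sm X J" using tc_quot[OF tc_ext1_zero[OF X] _ g] ext Im by blast
    then obtain k where "mor N J k" "u * k = h" by (rule ext1_zero_extend[OF _ s h])
    then show "\<exists>k. is_hom N J k \<and> u * k = h" by (auto simp: mor_def)
  qed (rule J)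
qed

end

section \<open>Duality\<close>

text \<open>D and D' are inverse to each other on the nose, not only up to isomorphism, so classes
  of modules are recovered exactly from their images. The assumptions are symmetric, hence each
  transfer lemma also serves in the opposite direction.\<close>

locale module_duality =
  fixes sm :: "'k::field \<Rightarrow> 'a::ring_1 \<Rightarrow> 'a" and sm' :: "'k \<Rightarrow> 'b::ring_1 \<Rightarrow> 'b"
    and D :: "('a,'k) rmod \<Rightarrow> ('b,'k) rmod" and D' :: "('b,'k) rmod \<Rightarrow> ('a,'k) rmod"
  assumes fst_D: "fst (D M) = fst M"
    and D_inv: "D' (D M) = M" "D (D' M') = M'"
    and mod_D: "is_mod sm' (D M) \<longleftrightarrow> is_mod sm M"
    and hom_D: "is_mod sm M \<Longrightarrow> is_mod sm N \<Longrightarrow> is_hom (D N) (D M) (transpose_mat f) \<longleftrightarrow> is_hom M N f"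
begin

sublocale C: module_category sm .
sublocale O: module_category sm' .

lemma symmetric: "module_duality sm' sm D' D"
proof
  show "fst (D' M) = fst M" for M using fst_D[of "D' M"] D_inv by simp
  show "is_mod sm (D' M) \<longleftrightarrow> is_mod sm' M" for M using mod_D[of "D' M"] D_inv by simp
  show "is_hom (D' N) (D' M) (transpose_mat f) \<longleftrightarrow> is_hom M N f" if "is_mod sm' M" "is_mod sm' N" for M N f
    using hom_D[of "D' N" "D' M" "transpose_mat f"] mod_D[of "D' M"] mod_D[of "D' N"] that D_inv by simp
qed (rule D_inv)+

lemma mor_D: "C.mor M N f \<Longrightarrow> O.mor (D N) (D M) (transpose_mat f)"
  unfolding C.mor_def O.mor_def by (simp add: mod_D hom_D)

lemma transpose_comp: "C.mor M N f \<Longrightarrow> dim_row g = fst N \<Longrightarrow> transpose_mat (f * g) = transpose_mat g * transpose_mat f"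
  using C.mor_carrier transpose_mult[of f "fst M" "fst N" g "dim_col g"] by blast

lemma mono_D: assumes "C.mono M N f" shows "O.epi (D N) (D M) (transpose_mat f)"
proof -
  obtain t where t: "t \<in> carrier_mat (fst N) (fst M)" "f * t = C.ident M"
    using assms by (auto simp: C.mono_def inj_map_def)
  have "transpose_mat t * transpose_mat f = O.ident (D M)"
    using transpose_comp[OF C.mono_mor[OF assms], of t] t by (simp add: fst_D)
  then show ?thesis using mor_D[OF C.mono_mor[OF assms]] t by (intro O.epiI) (auto simp: fst_D)
qed

lemma epi_D: assumes "C.epi M N f" shows "O.mono (D N) (D M) (transpose_mat f)"
proof -
  obtain s where s: "s \<in> carrier_mat (fst N) (fst M)" "s * f = C.ident N"
    using assms by (auto simp: C.epi_def surj_map_def)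
  have "transpose_mat (s * f) = transpose_mat f * transpose_mat s"
    by (rule transpose_mult[OF s(1) C.mor_carrier[OF C.epi_mor[OF assms]]])
  then have "transpose_mat f * transpose_mat s = O.ident (D N)" using s by (simp add: fst_D)
  then show ?thesis using mor_D[OF C.epi_mor[OF assms]] s by (intro O.monoI[of _ _ _ "transpose_mat s"]) (auto simp: fst_D)
qed

lemma ses_D: assumes "ses sm Y f E g X"
  shows "ses sm' (D X) (transpose_mat g) (D E) (transpose_mat f) (D Y)"
proof -
  note S = C.sesD[OF assms]
  have "transpose_mat (f * g) = transpose_mat g * transpose_mat f"
    using transpose_comp[OF C.mono_mor[OF S(1)]] C.mor_dims[OF C.epi_mor[OF S(2)]] by simp
  then show ?thesis using S epi_D[OF S(2)] mono_D[OF S(1)] by (intro O.sesI) (auto simp: fst_D)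
qed

lemma injective_D: assumes I: "injective sm I" shows "projective sm' (D I)"
proof (rule O.projectiveI)
  interpret S: module_duality sm' sm D' D by (rule symmetric)
  show "is_mod sm' (D I)" using I by (simp add: injective_def mod_D)
  fix M N g h assume g: "O.epi M N g" and h: "O.mor (D I) N h"
  have "C.mono (D' N) (D' M) (transpose_mat g)" by (rule S.epi_D[OF g])
  moreover have "C.mor (D' N) I (transpose_mat h)" using S.mor_D[OF h] by (simp add: D_inv)
  ultimately obtain k where k: "C.mor (D' M) I k" "transpose_mat g * k = transpose_mat h"
    using I unfolding injective_def C.mono_def C.mor_def by meson
  have "O.mor (D I) M (transpose_mat k)" using mor_D[OF k(1)] by (simp add: D_inv)
  moreover have "transpose_mat k * g = h"
    using S.transpose_comp[OF O.epi_mor[OF g], of "transpose_mat k"] C.mor_dims[OF k(1)] S.fst_D k(2)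
      arg_cong[OF k(2), of transpose_mat] transpose_mult[of "transpose_mat g" "fst N" "fst M" k "fst I"]
      C.mor_carrier[OF k(1)] O.mor_carrier[OF O.epi_mor[OF g]] by simp
  ultimately show "\<exists>k. O.mor (D I) M k \<and> k * g = h" by blast
qed

lemma projective_D: assumes P: "projective sm P" shows "injective sm' (D P)"
  unfolding injective_def
proof (intro conjI allI impI)
  interpret S: module_duality sm' sm D' D by (rule symmetric)
  show Pm: "is_mod sm' (D P)" using P by (simp add: projective_def mod_D)
  fix M N g h assume "is_mod sm' M \<and> is_mod sm' N \<and> is_hom M N g \<and> inj_map (fst M) (fst N) g \<and> is_hom M (D P) h"
  then have g: "O.mono M N g" and h: "O.mor M (D P) h" using Pm by (auto simp: O.mono_def O.mor_def)
  have g': "C.epi (D' N) (D' M) (transpose_mat g)" by (rule S.mono_D[OF g])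
  have h': "C.mor P (D' M) (transpose_mat h)" using S.mor_D[OF h] by (simp add: D_inv)
  obtain k where k: "C.mor P (D' N) k" "k * transpose_mat g = transpose_mat h"
    by (rule C.projective_lift[OF P g' h'])
  have "O.mor N (D P) (transpose_mat k)" using mor_D[OF k(1)] by (simp add: D_inv)
  moreover have "g * transpose_mat k = h"
    using arg_cong[OF k(2), of transpose_mat] transpose_mult[of k "fst P" "fst N" "transpose_mat g" "fst M"]
      C.mor_carrier[OF k(1)] O.mor_carrier[OF O.mono_mor[OF g]] S.fst_D by simp
  ultimately show "\<exists>k. is_hom N (D P) k \<and> g * k = h" by (auto simp: O.mor_def)
qed

lemma ext1_zero_D: assumes "ext1_zero sm X Y" shows "ext1_zero sm' (D Y) (D X)"
  unfolding ext1_zero_def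
proof (intro allI impI)
  interpret S: module_duality sm' sm D' D by (rule symmetric)
  fix f E g assume s: "ses sm' (D X) f E g (D Y)"
  have "ses sm Y (transpose_mat g) (D' E) (transpose_mat f) X" using S.ses_D[OF s] by (simp add: D_inv)
  then obtain k where k: "C.mor X (D' E) k" "k * transpose_mat f = C.ident X" by (rule C.ext1_zeroD[OF assms])
  have k': "O.mor E (D X) (transpose_mat k)" using mor_D[OF k(1)] by (simp add: D_inv)
  have "f * transpose_mat k = O.ident (D X)"
    using arg_cong[OF k(2), of transpose_mat] transpose_mult[of k "fst X" "fst E" "transpose_mat f" "fst X"]
      C.mor_carrier[OF k(1)] O.mor_carrier[OF O.mono_mor[OF O.sesD(1)[OF s]]] S.fst_D fst_D by simp
  from O.retraction_section[OF s k' this] show "\<exists>s. is_hom (D Y) E s \<and> s * g = O.ident (D Y)"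
    by (metis O.mor_def)
qed

lemma brick_D: assumes "brick sm X" shows "brick sm' (D X)"
  unfolding brick_def
proof (intro conjI allI impI)
  interpret S: module_duality sm' sm D' D by (rule symmetric)
  have X: "is_mod sm X" "fst X \<noteq> 0" using assms by (auto simp: brick_def)
  then show "is_mod sm' (D X)" "fst (D X) \<noteq> 0" by (auto simp: mod_D fst_D)
  fix f assume f: "is_hom (D X) (D X) f \<and> f \<noteq> O.nul (D X) (D X)"
  then have "O.mor (D X) (D X) f" using X by (simp add: O.mor_def mod_D)
  then have f': "C.mor X X (transpose_mat f)" using S.mor_D by (metis D_inv(1))
  moreover have "transpose_mat f \<noteq> C.nul X X" using f fst_D by (metis transpose_transpose zero_transpose_mat)
  ultimately obtain g where g: "C.mor X X g" "transpose_mat f * g = C.ident X" "g * transpose_mat f = C.ident X"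
    by (rule C.brick_inverse[OF assms])
  have c: "g \<in> carrier_mat (fst X) (fst X)" "transpose_mat f \<in> carrier_mat (fst X) (fst X)"
    using C.mor_carrier[OF g(1)] C.mor_carrier[OF f'] by blast+
  have "transpose_mat g * f = O.ident (D X)" "f * transpose_mat g = O.ident (D X)"
    using arg_cong[OF g(2), of transpose_mat] arg_cong[OF g(3), of transpose_mat]
      transpose_mult[OF c] transpose_mult[OF c(2,1)] by (auto simp: fst_D)
  then show "\<exists>g. is_hom (D X) (D X) g \<and> f * g = O.ident (D X) \<and> g * f = O.ident (D X)"
    using mor_D[OF g(1)] by (auto simp: O.mor_def)
qed

text \<open>Duality reverses arrows and turns torsion-free classes into torsion classes, so the
  perpendicular class is the one to be dualized.\<close>

definition dual_tc :: "('a,'k) rmod set \<Rightarrow> ('b,'k) rmod set" where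
  "dual_tc T = D ` perp sm T"

lemma dual_tc_iff: "N \<in> dual_tc T \<longleftrightarrow> D' N \<in> perp sm T"
  unfolding dual_tc_def using D_inv by (metis image_iff)

lemma torsion_class_dual_tc: assumes T: "torsion_class sm T" shows "torsion_class sm' (dual_tc T)"
proof (rule O.tcI)
  interpret S: module_duality sm' sm D' D by (rule symmetric)
  show "is_mod sm' M" if "M \<in> dual_tc T" for M
    using that C.perp_mod[of "D' M" T] S.mod_D[of M] by (simp add: dual_tc_iff)
  show "M \<in> dual_tc T" if "is_mod sm' M" "fst M = 0" for M
    using that C.perp_zero_module[OF _ _ T] by (simp add: dual_tc_iff S.mod_D S.fst_D)
  show "N \<in> dual_tc T" if "M \<in> dual_tc T" "O.epi M N g" for M N g
    using that(1) C.perp_sub[OF _ T S.epi_D[OF that(2)]] by (simp add: dual_tc_iff)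
  show "E \<in> dual_tc T" if "ses sm' Y f E g X" "Y \<in> dual_tc T" "X \<in> dual_tc T" for Y f E g X
    using that(2,3) C.perp_ext[OF T S.ses_D[OF that(1)]] by (simp add: dual_tc_iff)
qed

text \<open>One inclusion transposes maps; the other is \<open>double_perp\<close> carried through
  the duality.\<close>

lemma perp_dual_tc: assumes T: "torsion_class sm T" shows "perp sm' (dual_tc T) = D ` T"
proof
  interpret S: module_duality sm' sm D' D by (rule symmetric)
  note T' = torsion_class_dual_tc[OF T]
  show "D ` T \<subseteq> perp sm' (dual_tc T)"
  proof
    fix N assume "N \<in> D ` T"
    then obtain M where M: "M \<in> T" "N = D M" by blast
    show "N \<in> perp sm' (dual_tc T)"
    proof (rule O.perpI[OF _ _ T'])
      show "is_mod sm' N" using M C.tc_mod[OF T] by (simp add: mod_D)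
      fix L f assume L: "L \<in> dual_tc T" and f: "O.mor L N f"
      have "C.mor M (D' L) (transpose_mat f)" using S.mor_D[OF f] M by (simp add: D_inv)
      then have "transpose_mat f = C.nul M (D' L)" using C.perpD[of "D' L" T M] L M by (simp add: dual_tc_iff)
      then show "f = O.nul L N" using S.fst_D fst_D M(2) by (metis transpose_transpose zero_transpose_mat)
    qed
  qed
  show "perp sm' (dual_tc T) \<subseteq> D ` T"
  proof
    fix N assume N: "N \<in> perp sm' (dual_tc T)"
    have "D' N \<in> T"
    proof (rule C.double_perp[OF T])
      show "is_mod sm (D' N)" using O.perp_mod[OF N] by (simp add: S.mod_D)
      fix L f assume L: "L \<in> perp sm T" and f: "C.mor (D' N) L f"
      have "O.mor (D L) N (transpose_mat f)" using mor_D[OF f] by (simp add: D_inv)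
      then have "transpose_mat f = O.nul (D L) N" using O.perpD[OF N] L by (simp add: dual_tc_def)
      then show "f = C.nul (D' N) L" using S.fst_D fst_D by (metis transpose_transpose zero_transpose_mat)
    qed
    then show "N \<in> D ` T" using D_inv(2) by (metis image_eqI)
  qed
qed

lemma dual_tc_dual_tc: assumes T: "torsion_class sm T" shows "module_duality.dual_tc sm' D' (dual_tc T) = T"
proof -
  interpret S: module_duality sm' sm D' D by (rule symmetric)
  have "S.dual_tc (dual_tc T) = D' ` D ` T" unfolding S.dual_tc_def perp_dual_tc[OF T] ..
  then show ?thesis by (simp add: image_image D_inv)
qed

lemma dual_tc_anti: "T \<subseteq> U \<Longrightarrow> dual_tc U \<subseteq> dual_tc T"
  unfolding dual_tc_def using C.perp_mono by blast

lemma dual_tc_inject: "torsion_class sm T \<Longrightarrow> torsion_class sm U \<Longrightarrow> dual_tc T = dual_tc U \<Longrightarrow> T = U"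
  using dual_tc_dual_tc by metis

lemma cover_dual_tc: assumes c: "tors_cover sm T U" shows "tors_cover sm' (dual_tc U) (dual_tc T)"
proof -
  interpret S: module_duality sm' sm D' D by (rule symmetric)
  note T = C.coverD[OF c]
  have "\<not> (dual_tc U \<subset> V \<and> V \<subset> dual_tc T)" if V: "torsion_class sm' V" for V
  proof
    assume *: "dual_tc U \<subset> V \<and> V \<subset> dual_tc T"
    note V' = S.torsion_class_dual_tc[OF V] and VV = S.dual_tc_dual_tc[OF V]
    have "T \<subseteq> S.dual_tc V" using S.dual_tc_anti[of V "dual_tc T"] * dual_tc_dual_tc[OF T(1)] by auto
    moreover have "S.dual_tc V \<subseteq> U" using S.dual_tc_anti[of "dual_tc U" V] * dual_tc_dual_tc[OF T(2)] by auto
    ultimately have "S.dual_tc V = T \<or> S.dual_tc V = U" using C.cover_eq[OF c V'] by blast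
    then show False using * VV by auto
  qed
  moreover have "dual_tc U \<subset> dual_tc T" using dual_tc_anti[OF T(3)] dual_tc_inject[OF T(1,2)] T(4) by blast
  ultimately show ?thesis using torsion_class_dual_tc T(1,2) unfolding tors_cover_def by blast
qed

lemma tau_tilting_finite_dual: assumes "tau_tilting_finite sm" shows "tau_tilting_finite sm'"
proof -
  interpret S: module_duality sm' sm D' D by (rule symmetric)
  have "{T. torsion_class sm' T} \<subseteq> dual_tc ` {T. torsion_class sm T}"
    using S.dual_tc_dual_tc S.torsion_class_dual_tc by (metis image_eqI mem_Collect_eq subsetI)
  then show ?thesis using assms unfolding tau_tilting_finite_def by (metis finite_imageI finite_subset)
qed

text \<open>An up label lies in T2 and in the perpendicular class of T. Its dual lies in the
  perpendicular class of \<open>dual_tc T2\<close> and in \<open>dual_tc T\<close>, as required of a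
  down label.\<close>

lemma up_labels_D: assumes T: "torsion_class sm T" shows "down_labels sm' (dual_tc T) = D ` up_labels sm T"
proof
  interpret S: module_duality sm' sm D' D by (rule symmetric)
  show "D ` up_labels sm T \<subseteq> down_labels sm' (dual_tc T)"
  proof
    fix Y assume "Y \<in> D ` up_labels sm T"
    then obtain X T2 where X: "Y = D X" "tors_cover sm T T2" "brick sm X" "X \<in> T2" "X \<in> perp sm T"
      by (auto simp: up_labels_def)
    have "Y \<in> dual_tc T \<inter> perp sm' (dual_tc T2)"
      unfolding perp_dual_tc[OF C.coverD(2)[OF X(2)]] using X by (auto simp: dual_tc_def)
    then show "Y \<in> down_labels sm' (dual_tc T)"
      using cover_dual_tc[OF X(2)] brick_D[OF X(3)] X(1) unfolding down_labels_def by blast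
  qed
  show "down_labels sm' (dual_tc T) \<subseteq> D ` up_labels sm T"
  proof
    fix Y assume "Y \<in> down_labels sm' (dual_tc T)"
    then obtain T1 where Y: "tors_cover sm' T1 (dual_tc T)" "brick sm' Y" "Y \<in> dual_tc T" "Y \<in> perp sm' T1"
      by (auto simp: down_labels_def)
    have T1: "dual_tc (S.dual_tc T1) = T1" using S.dual_tc_dual_tc[OF O.coverD(1)[OF Y(1)]] .
    have "D' Y \<in> S.dual_tc T1" using Y(4) by (simp add: S.dual_tc_def)
    moreover have "tors_cover sm T (S.dual_tc T1)" using S.cover_dual_tc[OF Y(1)] dual_tc_dual_tc[OF T] by simp
    ultimately have "D' Y \<in> up_labels sm T"
      using S.brick_D[OF Y(2)] Y(3) unfolding up_labels_def by (auto simp: dual_tc_iff)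
    then show "Y \<in> D ` up_labels sm T" using D_inv(2) by (metis image_eqI)
  qed
qed

text \<open>As \<open>dual_tc\<close> reverses inclusion, it exchanges upper and lower bounds. The
  dual of the pop-down is itself one of the classes intersected in \<open>pop_up\<close> and lies
  below all the others.\<close>

lemma pop_up_dual:
  assumes T: "torsion_class sm T"
  shows "torsion_class sm (pop_up sm T)" "dual_tc (pop_up sm T) = pop_down sm' (dual_tc T)"
proof -
  interpret S: module_duality sm' sm D' D by (rule symmetric)
  let ?V = "pop_down sm' (dual_tc T)"
  have V: "torsion_class sm' ?V" by (rule O.tc_pop_down[OF torsion_class_dual_tc[OF T]])
  have W: "torsion_class sm (S.dual_tc ?V)" by (rule S.torsion_class_dual_tc[OF V])
  have "pop_up sm T = S.dual_tc ?V"
  proof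
    have "T \<subseteq> S.dual_tc ?V"
      using S.dual_tc_anti[of ?V "dual_tc T"] dual_tc_dual_tc[OF T] by (auto simp: pop_down_def)
    moreover have "U \<subseteq> S.dual_tc ?V" if U: "tors_cover sm T U" for U
    proof -
      have "?V \<subseteq> dual_tc U" using cover_dual_tc[OF U] by (auto simp: pop_down_def)
      then show ?thesis using S.dual_tc_anti dual_tc_dual_tc[OF C.coverD(2)[OF U]] by blast
    qed
    ultimately show "pop_up sm T \<subseteq> S.dual_tc ?V" using W unfolding pop_up_def by blast
    show "S.dual_tc ?V \<subseteq> pop_up sm T" unfolding pop_up_def
    proof (rule Inter_greatest)
      fix U assume "U \<in> {S. torsion_class sm S \<and> T \<subseteq> S \<and> (\<forall>U. tors_cover sm T U \<longrightarrow> U \<subseteq> S)}"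
      then have U: "torsion_class sm U" "T \<subseteq> U" "\<And>S. tors_cover sm T S \<Longrightarrow> S \<subseteq> U" by auto
      have "dual_tc U \<subseteq> R" if R: "tors_cover sm' R (dual_tc T)" for R
      proof -
        have "tors_cover sm T (S.dual_tc R)" using S.cover_dual_tc[OF R] dual_tc_dual_tc[OF T] by simp
        then have "dual_tc U \<subseteq> dual_tc (S.dual_tc R)" by (intro dual_tc_anti U(3))
        then show ?thesis using S.dual_tc_dual_tc[OF O.coverD(1)[OF R]] by simp
      qed
      then have "dual_tc U \<subseteq> ?V" using dual_tc_anti[OF U(2)] unfolding pop_down_def by blast
      then show "S.dual_tc ?V \<subseteq> U" using S.dual_tc_anti dual_tc_dual_tc[OF U(1)] by blast
    qed
  qed
  then show "torsion_class sm (pop_up sm T)" "dual_tc (pop_up sm T) = ?V"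
    using W S.dual_tc_dual_tc[OF V] by auto
qed

lemma pop_up_image_iff:
  assumes T: "torsion_class sm T"
  shows "(\<exists>T'. torsion_class sm T' \<and> pop_up sm T' = T) \<longleftrightarrow>
    (\<exists>T'. torsion_class sm' T' \<and> pop_down sm' T' = dual_tc T)"
proof
  interpret S: module_duality sm' sm D' D by (rule symmetric)
  show "\<exists>T'. torsion_class sm' T' \<and> pop_down sm' T' = dual_tc T"
    if "\<exists>T'. torsion_class sm T' \<and> pop_up sm T' = T"
    using that pop_up_dual(2) torsion_class_dual_tc by metis
  show "\<exists>T'. torsion_class sm T' \<and> pop_up sm T' = T"
    if "\<exists>T'. torsion_class sm' T' \<and> pop_down sm' T' = dual_tc T"
  proof -
    from that obtain V where V: "torsion_class sm' V" "pop_down sm' V = dual_tc T" by blast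
    note W = S.torsion_class_dual_tc[OF V(1)]
    have "dual_tc (pop_up sm (S.dual_tc V)) = dual_tc T"
      using pop_up_dual(2)[OF W] S.dual_tc_dual_tc[OF V(1)] V(2) by simp
    then show ?thesis using dual_tc_inject[OF pop_up_dual(1)[OF W] T] W by blast
  qed
qed

text \<open>An inclusion of M into a projective module dualizes to an epimorphism from an injective
  module onto the dual of M, where \<open>injective_quotient\<close> applies.\<close>

lemma hereditary_dual:
  assumes "hereditary_category sm" shows "hereditary sm'"
  unfolding hereditary_def
proof (intro allI impI)
  interpret S: module_duality sm' sm D' D by (rule symmetric)
  interpret H: hereditary_category sm by (rule assms)
  fix M P f assume "is_mod sm' M \<and> projective sm' P \<and> is_hom M P f \<and> inj_map (fst M) (fst P) f"
  then have P: "projective sm' P" and f: "O.mono M P f"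
    by (auto simp: O.mono_def O.mor_def projective_def)
  have "injective sm (D' M)" by (rule H.injective_quotient[OF S.projective_D[OF P] S.mono_D[OF f]])
  from injective_D[OF this] show "projective sm' M" by (simp add: D_inv)
qed

end

text \<open>The multiplication of an algebra is fixed by its type class, so the opposite algebra
  needs a type of its own.\<close>

datatype 'a opp = Op (unop: 'a)

instantiation opp :: (ring_1) ring_1
begin
definition "0 = Op 0"
definition "1 = Op 1"
definition "x + y = Op (unop x + unop y)"
definition "x - y = Op (unop x - unop y)"
definition "- x = Op (- unop x)"
definition "x * y = Op (unop y * unop x)"
instance
  by standard (auto simp: zero_opp_def one_opp_def plus_opp_def minus_opp_def uminus_opp_def times_opp_def
      algebra_simps intro: opp.expand)
end

lemmas opp_defs = zero_opp_def one_opp_def plus_opp_def times_opp_def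

definition opp_scale :: "('k \<Rightarrow> 'a \<Rightarrow> 'a) \<Rightarrow> 'k \<Rightarrow> 'a opp \<Rightarrow> 'a opp" where
  "opp_scale sm c x = Op (sm c (unop x))"

text \<open>The vector space dual in coordinates: transposition reverses products, matching the
  reversed multiplication, so the dual is again a right module.\<close>

definition dual_mod :: "('a,'k::field) rmod \<Rightarrow> ('a opp,'k) rmod" where
  "dual_mod M = (fst M, \<lambda>a. transpose_mat (snd M (unop a)))"

definition undual_mod :: "('a opp,'k::field) rmod \<Rightarrow> ('a,'k) rmod" where
  "undual_mod M = (fst M, \<lambda>a. transpose_mat (snd M (Op a)))"

lemma all_unop: "(\<forall>a. P (unop a)) \<longleftrightarrow> (\<forall>a. P a)"
  by (metis opp.sel)

lemma fd_algebra_opp: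
  fixes sm :: "'k::field \<Rightarrow> 'a::ring_1 \<Rightarrow> 'a"
  assumes "fd_algebra sm" shows "fd_algebra (opp_scale sm)"
proof -
  have fd: "\<And>c x y. sm c (x + y) = sm c x + sm c y" "\<And>c d x. sm (c + d) x = sm c x + sm d x"
    "\<And>c d x. sm (c * d) x = sm c (sm d x)" "\<And>x. sm 1 x = x"
    "\<And>c x y. sm c (x * y) = sm c x * y" "\<And>c x y. sm c (x * y) = x * sm c y"
    using assms unfolding fd_algebra_def by metis+
  obtain B where B: "finite B" "\<And>x. \<exists>co. x = (\<Sum>b\<in>B. sm (co b) b)"
    using assms unfolding fd_algebra_def by blast
  have sum: "(\<Sum>b\<in>A. Op (h b)) = Op (\<Sum>b\<in>A. h b)" if "finite A" for A :: "'b set" and h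
    using that by (induction A) (auto simp: opp_defs)
  have "\<exists>co. x = (\<Sum>b\<in>Op ` B. opp_scale sm (co b) b)" for x
  proof -
    obtain co where co: "unop x = (\<Sum>b\<in>B. sm (co b) b)" using B(2) by blast
    have "(\<Sum>b\<in>Op ` B. opp_scale sm (co (unop b)) b) = (\<Sum>b\<in>B. Op (sm (co b) b))"
      by (subst sum.reindex) (auto simp: inj_on_def opp_scale_def)
    also have "\<dots> = Op (unop x)" unfolding co by (rule sum[OF B(1)])
    finally show ?thesis by (intro exI[of _ "\<lambda>b. co (unop b)"]) simp
  qed
  moreover have "finite (Op ` B)" using B(1) by simp
  ultimately have "\<exists>B. finite B \<and> (\<forall>x. \<exists>co. x = (\<Sum>b\<in>B. opp_scale sm (co b) b))" by blast
  moreover have "opp_scale sm c (x * y) = opp_scale sm c x * y" "opp_scale sm c (x * y) = x * opp_scale sm c y" for c x y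
    unfolding opp_scale_def opp_defs opp.sel by (metis fd(5,6))+
  ultimately show ?thesis unfolding fd_algebra_def
    by (simp add: opp_scale_def plus_opp_def fd(1-4))
qed

lemma opposite_duality:
  fixes sm :: "'k::field \<Rightarrow> 'a::ring_1 \<Rightarrow> 'a"
  shows "module_duality sm (opp_scale sm) dual_mod undual_mod"
proof
  show "fst (dual_mod M) = fst M" for M :: "('a,'k) rmod" by (simp add: dual_mod_def)
  show "undual_mod (dual_mod M) = M" for M :: "('a,'k) rmod" by (simp add: dual_mod_def undual_mod_def)
  show "dual_mod (undual_mod N) = N" for N :: "('a opp,'k) rmod" by (simp add: dual_mod_def undual_mod_def)
  show "is_mod (opp_scale sm) (dual_mod M) \<longleftrightarrow> is_mod sm M" for M
  proof -
    let ?n = "fst M" and ?r = "snd M"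
    have c: "(\<forall>a. transpose_mat (?r (unop a)) \<in> carrier_mat ?n ?n) \<longleftrightarrow> (\<forall>a. ?r a \<in> carrier_mat ?n ?n)"
      using all_unop[of "\<lambda>a. ?r a \<in> carrier_mat ?n ?n"] by (metis transpose_carrier_mat transpose_transpose)
    show ?thesis
    proof (cases "\<forall>a. ?r a \<in> carrier_mat ?n ?n")
      case False
      then show ?thesis using c by (auto simp: is_mod_def dual_mod_def)
    next
      case True
      then have d: "?r a \<in> carrier_mat ?n ?n" for a by blast
      have t: "transpose_mat A = transpose_mat B \<longleftrightarrow> A = B" for A B :: "'k mat" by (metis transpose_transpose)
      have 1: "transpose_mat (?r 1) = 1\<^sub>m ?n \<longleftrightarrow> ?r 1 = 1\<^sub>m ?n" by (metis transpose_one transpose_transpose)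
      have 2: "(\<forall>a b. transpose_mat (?r (unop (a * b))) = transpose_mat (?r (unop a)) * transpose_mat (?r (unop b))) \<longleftrightarrow>
         (\<forall>a b. ?r (a * b) = ?r a * ?r b)"
        unfolding transpose_mult[OF d d, symmetric] t times_opp_def opp.sel by (metis opp.sel)
      have 3: "(\<forall>a b. transpose_mat (?r (unop (a + b))) = transpose_mat (?r (unop a)) + transpose_mat (?r (unop b))) \<longleftrightarrow>
         (\<forall>a b. ?r (a + b) = ?r a + ?r b)"
        unfolding transpose_add[OF d d, symmetric] t plus_opp_def opp.sel by (metis opp.sel)
      have ts: "transpose_mat (c \<cdot>\<^sub>m A) = c \<cdot>\<^sub>m transpose_mat A" for c and A :: "'k mat"
        by (rule eq_matI) auto
      have 4: "(\<forall>c a. transpose_mat (?r (unop (opp_scale sm c a))) = c \<cdot>\<^sub>m transpose_mat (?r (unop a))) \<longleftrightarrow>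
         (\<forall>c a. ?r (sm c a) = c \<cdot>\<^sub>m ?r a)"
        unfolding ts[symmetric] t opp_scale_def opp.sel by (metis opp.sel)
      show ?thesis unfolding is_mod_def dual_mod_def fst_conv snd_conv using c True 1 2 3 4
        by (simp add: one_opp_def)
    qed
  qed
  show "is_hom (dual_mod N) (dual_mod M) (transpose_mat f) \<longleftrightarrow> is_hom M N f" if "is_mod sm M" "is_mod sm N" for M N f
  proof (cases "f \<in> carrier_mat (fst M) (fst N)")
    case False
    then show ?thesis by (auto simp: is_hom_def dual_mod_def)
  next
    case f: True
    have d: "snd M a \<in> carrier_mat (fst M) (fst M)" "snd N a \<in> carrier_mat (fst N) (fst N)" for a
      using that by (auto simp: is_mod_def)
    have t: "transpose_mat A = transpose_mat B \<longleftrightarrow> A = B" for A B :: "'k mat" by (metis transpose_transpose)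
    have "(\<forall>a. transpose_mat (snd N (unop a)) * transpose_mat f = transpose_mat f * transpose_mat (snd M (unop a)))
        \<longleftrightarrow> (\<forall>a. snd M a * f = f * snd N a)"
      unfolding transpose_mult[OF f d(2), symmetric] transpose_mult[OF d(1) f, symmetric] t by (metis opp.sel)
    then show ?thesis using f by (simp add: is_hom_def dual_mod_def)
  qed
qed

theorem theorem5p10:
  fixes sm :: "'k::field \<Rightarrow> 'a::ring_1 \<Rightarrow> 'a"
    and T :: "('a,'k) rmod set"
  assumes "fd_algebra sm" and "basic_alg TYPE('a)" and "tau_tilting_finite sm"
    and "hereditary sm" and "torsion_class sm T"
  shows "((\<exists>T'. torsion_class sm T' \<and> pop_down sm T' = T) \<longleftrightarrow>
           (\<forall>X\<in>down_labels sm T. \<forall>X'\<in>down_labels sm T. ext1_zero sm X X') \<and>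
           (\<forall>P\<in>T. projective sm P \<longrightarrow> fst P = 0))
       \<and> ((\<exists>T'. torsion_class sm T' \<and> pop_up sm T' = T) \<longleftrightarrow>
           (\<forall>Y\<in>up_labels sm T. \<forall>Y'\<in>up_labels sm T. ext1_zero sm Y Y') \<and>
           (\<forall>I\<in>perp sm T. injective sm I \<longrightarrow> fst I = 0))"
proof
  interpret H: hereditary_category sm
    by standard (use assms module_category.fd_algebra_enough_projectives in blast)+
  interpret D: module_duality sm "opp_scale sm" dual_mod undual_mod by (rule opposite_duality)
  interpret S: module_duality "opp_scale sm" sm undual_mod dual_mod by (rule D.symmetric)
  \<comment> \<open>Over the opposite algebra, heredity comes from quotients of injectives and
    finiteness from the bijection \<open>dual_tc\<close> between torsion classes.\<close>
  interpret H': hereditary_category "opp_scale sm"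
    by standard
      (use module_category.fd_algebra_enough_projectives[OF fd_algebra_opp[OF assms(1)]]
        D.hereditary_dual[OF H.hereditary_category_axioms] D.tau_tilting_finite_dual[OF assms(3)] in blast)+
  show "(\<exists>T'. torsion_class sm T' \<and> pop_down sm T' = T) \<longleftrightarrow>
           (\<forall>X\<in>down_labels sm T. \<forall>X'\<in>down_labels sm T. ext1_zero sm X X') \<and>
           (\<forall>P\<in>T. projective sm P \<longrightarrow> fst P = 0)"
    by (rule H.pop_down_image_iff[OF assms(5)])
  have ext: "ext1_zero (opp_scale sm) (dual_mod X) (dual_mod Y) \<longleftrightarrow> ext1_zero sm Y X" for X Y
    using D.ext1_zero_D[of Y X] S.ext1_zero_D[of "dual_mod X" "dual_mod Y"] by (auto simp: D.D_inv)
  have inj: "projective (opp_scale sm) (dual_mod I) \<longleftrightarrow> injective sm I" for I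
    using D.injective_D[of I] S.projective_D[of "dual_mod I"] by (auto simp: D.D_inv)
  show "(\<exists>T'. torsion_class sm T' \<and> pop_up sm T' = T) \<longleftrightarrow>
           (\<forall>Y\<in>up_labels sm T. \<forall>Y'\<in>up_labels sm T. ext1_zero sm Y Y') \<and>
           (\<forall>I\<in>perp sm T. injective sm I \<longrightarrow> fst I = 0)"
    \<comment> \<open>What remains are the two conditions for \<open>dual_tc T\<close>: its down
      labels are the duals of the up labels of T, and its projectives are the duals of the
      injectives in \<open>perp sm T\<close>.\<close>
    unfolding D.pop_up_image_iff[OF assms(5)] H'.pop_down_image_iff[OF D.torsion_class_dual_tc[OF assms(5)]]
      D.up_labels_D[OF assms(5)]
    by (auto simp: D.dual_tc_def ext inj D.fst_D)
qed

end
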